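(* Let $\mu$ be a probability measure on $\mathbb{C}$ and let $\{z_i\}_{i\ge1}$ be a $\mu$-distributed, log-Cesàro bounded sequence of complex numbers. Let $\{X_i\}_{i\ge1}$ be an i.i.d. sequence of symmetric random variables that are non-zero (i.e. not almost surely equal to $0$) and satisfy $\mathbf{E}[|X_1|]<\infty$. Let $\{\sigma_i\}_{i\ge1}$ be a decreasing sequence of positive real numbers with $\lim_{i\to\infty}\sigma_i=0$. For each $n\in\mathbb{N}$ let $$P_n(z):=\prod_{i=1}^n(z-z_i+\sigma_iX_i).$$ Then, as $n\to\infty$, $\mathcal{M}(P_n)\to\mu$ almost surely, and $\mathcal{M}(P_n^{(k)})\to\mu$ in probability for any $k\in\mathbb{N}$.
   Context: A sequence $\{z_n\}_{n\ge1}$ of complex numbers is $\mu$-distributed if $\frac1n\sum_{i=1}^n\delta_{z_i}$ converges weakly to the probability measure $\mu$. It is log-Cesàro bounded if the sequence $\{\frac1n\sum_{i=1}^n\log_+|z_i|\}_{n\ge1}$ is bounded, where $\log_+x=\max(\log x,0)$ (and $\log_+0=0$). Random variables are complex-valued; $X$ is symmetric if $X$ and $-X$ have the same distribution. For a non-constant polynomial $P$, $\mathcal{M}(P)$ denotes the uniform probability measure on the multiset of zeros of $P$ (zeros counted with multiplicity). $P_n^{(k)}$ is the $k$-th derivative (so $\mathcal{M}(P_n^{(k)})$ is considered for $n>k$). Convergence of random probability measures, almost surely or in probability, is with respect to the topology of weak convergence of probability measures on $\mathbb{C}$. *)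

theory Defs
  imports "HOL-Probability.Probability"
begin

definition borel_prob_measures :: "'a::topological_space measure set" where
  "borel_prob_measures = {M. prob_space M \<and> sets M = sets borel}"

text \<open>The coarsest topology on the Borel probability measures that makes \<open>N \<mapsto> \<integral>f dN\<close>
  continuous for every bounded continuous real function \<open>f\<close>.\<close>

definition weak_topology :: "'a::topological_space measure topology" where
  "weak_topology = topology_generated_by
     {{N \<in> borel_prob_measures. (LINT x|N. f x) \<in> U} | (f :: 'a \<Rightarrow> real) U.
        continuous_on UNIV f \<and> bounded (range f) \<and> open U}"

lemma topspace_weak_topology: "topspace weak_topology = borel_prob_measures"
proof
  show "topspace weak_topology \<subseteq> (borel_prob_measures :: 'a measure set)"
    unfolding weak_topology_def topology_generated_by_topspace by (intro Union_least) blast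
next
  have "{N \<in> borel_prob_measures. (LINT x|N. (0::real)) \<in> UNIV} \<in>
     {{N \<in> borel_prob_measures. (LINT x|N. f x) \<in> U} | (f :: 'a \<Rightarrow> real) U.
        continuous_on UNIV f \<and> bounded (range f) \<and> open U}"
    by (intro CollectI exI[of _ "\<lambda>_. 0"] exI[of _ UNIV]) auto
  from Union_upper[OF this] show "borel_prob_measures \<subseteq> topspace (weak_topology :: 'a measure topology)"
    unfolding weak_topology_def topology_generated_by_topspace by simp
qed

lemma limitin_weak_topology_iff:
  fixes N :: "'b \<Rightarrow> 'a::topological_space measure"
  assumes N: "\<And>n. N n \<in> borel_prob_measures" and L: "L \<in> borel_prob_measures"
  shows "limitin weak_topology N L F \<longleftrightarrow>
    (\<forall>f :: 'a \<Rightarrow> real. continuous_on UNIV f \<longrightarrow> bounded (range f) \<longrightarrow>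
       ((\<lambda>n. LINT x|N n. f x) \<longlongrightarrow> (LINT x|L. f x)) F)"
    (is "?lhs \<longleftrightarrow> ?rhs")
proof
  assume lim: ?lhs
  show ?rhs
  proof (intro allI impI topological_tendstoI)
    fix f :: "'a \<Rightarrow> real" and U
    assume *: "continuous_on UNIV f" "bounded (range f)" "open U" "(LINT x|L. f x) \<in> U"
    then have "openin weak_topology {N \<in> borel_prob_measures. (LINT x|N. f x) \<in> U}"
      unfolding weak_topology_def by (intro topology_generated_by_Basis) blast
    from limitinD[OF lim this] show "\<forall>\<^sub>F n in F. (LINT x|N n. f x) \<in> U"
      using L * by (simp add: N)
  qed
next
  assume rhs: ?rhs
  let ?S = "{{N \<in> borel_prob_measures. (LINT x|N. f x) \<in> U} | (f :: 'a \<Rightarrow> real) U.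
        continuous_on UNIV f \<and> bounded (range f) \<and> open U}"
  have "\<forall>\<^sub>F n in F. N n \<in> V" if "generate_topology_on ?S V" "L \<in> V" for V
    using that
  proof (induction rule: generate_topology_on.induct)
    case (UN K)
    then obtain k where "k \<in> K" "L \<in> k" by blast
    with UN.IH[of k] have "\<forall>\<^sub>F n in F. N n \<in> k" by simp
    then show ?case by (rule eventually_mono) (use \<open>k \<in> K\<close> in blast)
  next
    case (Basis s)
    then obtain f :: "'a \<Rightarrow> real" and U where
      s: "s = {N \<in> borel_prob_measures. (LINT x|N. f x) \<in> U}"
      and f: "continuous_on UNIV f" "bounded (range f)" "open U" by blast
    with Basis have "(LINT x|L. f x) \<in> U" by blast
    then have "\<forall>\<^sub>F n in F. (LINT x|N n. f x) \<in> U"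
      by (intro topological_tendstoD[OF rhs[rule_format, OF f(1,2)] f(3)])
    then show ?case by (simp add: s N)
  qed (auto intro: eventually_conj)
  then show ?lhs
    using L unfolding limitin_def topspace_weak_topology
    by (simp add: weak_topology_def openin_topology_generated_by_iff)
qed

text \<open>The library assigns measure \<open>0\<close> to non-measurable sets. The outer measure, which agrees
  with the measure on measurable sets, rules out convergence for want of measurability.\<close>

definition limit_in_prob :: "'w measure \<Rightarrow> 'b topology \<Rightarrow> (nat \<Rightarrow> 'w \<Rightarrow> 'b) \<Rightarrow> 'b \<Rightarrow> bool" where
  "limit_in_prob M T Y l \<longleftrightarrow> l \<in> topspace T \<and>
     (\<forall>U. openin T U \<longrightarrow> l \<in> U \<longrightarrow>
        (\<lambda>n. outer_measure_of M {\<omega> \<in> space M. Y n \<omega> \<notin> U}) \<longlonglongrightarrow> 0)"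

text \<open>\<open>measure_pmf\<close> lives on the discrete \<open>\<sigma>\<close>-algebra, hence the \<open>distr\<close> to \<open>borel\<close>. The
  definition is meaningful for \<open>A \<noteq> {#}\<close> only.\<close>

definition uniform_mset_measure :: "'a::topological_space multiset \<Rightarrow> 'a measure" where
  "uniform_mset_measure A = distr (measure_pmf (pmf_of_multiset A)) borel (\<lambda>x. x)"

lemma uniform_mset_measure_in: "uniform_mset_measure A \<in> borel_prob_measures"
  unfolding uniform_mset_measure_def borel_prob_measures_def
  by (auto intro!: prob_space.prob_space_distr measure_pmf.prob_space_axioms)

lemma integral_uniform_mset_measure:
  fixes f :: "'a::topological_space \<Rightarrow> real"
  assumes "A \<noteq> {#}" and [measurable]: "f \<in> borel_measurable borel"
  shows "(LINT x|uniform_mset_measure A. f x) = (\<Sum>x\<in>#A. f x) / size A"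
proof -
  have "(LINT x|uniform_mset_measure A. f x) = measure_pmf.expectation (pmf_of_multiset A) f"
    unfolding uniform_mset_measure_def by (subst integral_distr) auto
  also have "\<dots> = (\<Sum>x\<in>set_mset A. f x * (count A x / size A))"
    using assms(1) by (subst integral_measure_pmf[of "set_mset A"])
      (auto simp: mult.commute)
  also have "\<dots> = (\<Sum>x\<in>set_mset A. of_nat (count A x) * f x) / size A"
    by (simp add: sum_divide_distrib mult.commute)
  also have "(\<Sum>x\<in>set_mset A. of_nat (count A x) * f x) = (\<Sum>x\<in>#A. f x)"
  proof (induction A)
    case (add x A)
    have "(\<Sum>y\<in>set_mset (add_mset x A). of_nat (count (add_mset x A) y) * f y)
        = (\<Sum>y\<in>insert x (set_mset A). of_nat (count A y) * f y + (if y = x then f x else 0))"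
      by (intro sum.cong) (auto simp: algebra_simps)
    also have "\<dots> = (\<Sum>y\<in>insert x (set_mset A). of_nat (count A y) * f y) + f x"
      by (simp only: sum.distrib sum.delta finite_insert finite_set_mset insertI1 if_True)
    also have "(\<Sum>y\<in>insert x (set_mset A). of_nat (count A y) * f y)
        = (\<Sum>y\<in>set_mset A. of_nat (count A y) * f y)"
      by (intro sum.mono_neutral_right) (auto simp: not_in_iff)
    finally show ?case using add by simp
  qed simp
  finally show ?thesis .
qed

text \<open>Sequences are indexed from \<open>1\<close>; the value at index \<open>0\<close> is never used.\<close>

definition empirical_measure :: "(nat \<Rightarrow> complex) \<Rightarrow> nat \<Rightarrow> complex measure" where
  "empirical_measure z n = uniform_mset_measure (image_mset z (mset_set {1..n}))"

definition distributed_as :: "(nat \<Rightarrow> complex) \<Rightarrow> complex measure \<Rightarrow> bool" where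
  "distributed_as z \<mu> \<longleftrightarrow> limitin weak_topology (empirical_measure z) \<mu> sequentially"

definition log_plus :: "real \<Rightarrow> real" where
  "log_plus x = (if x = 0 then 0 else max (ln x) 0)"

definition log_Cesaro_bounded :: "(nat \<Rightarrow> complex) \<Rightarrow> bool" where
  "log_Cesaro_bounded z \<longleftrightarrow> Bseq (\<lambda>n. (\<Sum>i=1..n. log_plus (cmod (z i))) / real n)"

definition zeros_measure :: "complex poly \<Rightarrow> complex measure" where
  "zeros_measure p = uniform_mset_measure (proots p)"

definition perturbed_poly ::
    "(nat \<Rightarrow> complex) \<Rightarrow> (nat \<Rightarrow> real) \<Rightarrow> (nat \<Rightarrow> 'w \<Rightarrow> complex) \<Rightarrow> nat \<Rightarrow> 'w \<Rightarrow> complex poly" where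
  "perturbed_poly z \<sigma> X n \<omega> = (\<Prod>i=1..n. [: - z i + complex_of_real (\<sigma> i) * X i \<omega>, 1 :])"

lemma poly_perturbed_poly:
  "poly (perturbed_poly z \<sigma> X n \<omega>) w = (\<Prod>i=1..n. (w - z i + complex_of_real (\<sigma> i) * X i \<omega>))"
  by (simp add: perturbed_poly_def poly_prod algebra_simps)

end

theory Submission
  imports Defs
    "HOL-Complex_Analysis.Cauchy_Integral_Formula"
    "HOL-Computational_Algebra.Fundamental_Theorem_Algebra"
    "HOL-Real_Asymp.Real_Asymp"
begin

text \<open>
  Write \<open>\<xi> i = z i - \<sigma> i * X i\<close> for the zeros of \<open>P n\<close>. Few \<open>\<xi> i\<close> are far from \<open>z i\<close> (Hoeffding and
  Borel-Cantelli), so the zeros of \<open>P n\<close> are almost surely \<open>\<mu>\<close>-distributed.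

  For the derivatives let \<open>E n w\<close> be the \<open>k\<close>-th elementary symmetric function of the numbers
  \<open>1 / (w - \<xi> i)\<close>, which is the quotient of the \<open>k\<close>-th derivative and \<open>P n\<close> up to the factor \<open>k!\<close>.
  The potentials of the two zero sets differ by \<open>ln \<bar>E n w\<bar>\<close> plus a constant, so it suffices that
  \<open>(1 / n) * ln \<bar>E n w\<bar>\<close> tends to \<open>0\<close> in \<open>L\<^sup>1\<close> on discs, in probability. The upper bound is deterministic
  since \<open>\<Sum>i\<le>n. 1 / \<bar>w - \<xi> i\<bar>\<close> has integral \<open>O(n)\<close> over a disc. For the lower bound, \<open>- ln \<bar>E n w\<bar> / n\<close>
  is dominated by an average of translates of one integrable function plus a tight constant, which
  is uniformly integrable; and for every \<open>w\<close> other than \<open>lim z\<close> the variable \<open>E n w\<close> is not small with high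
  probability.

  That anti-concentration uses only finitely many of the variables, so the speed of decay of \<open>\<sigma>\<close> is
  irrelevant. As a function of a block of them, \<open>E n w\<close> is a combination of elementary symmetric functions
  with top coefficient \<open>1\<close>. Resampling half of the block and applying the Cauchy-Schwarz inequality
  lowers the degree by one; in degree one a sum of independent variables living on rapidly decreasing
  scales is seen to be spread out.
\<close>

subsection \<open>Anti-concentration of elementary symmetric functions\<close>

text \<open>The obstacle is the absence of any rate: \<open>X 1\<close> may take just two values and
  \<sigma> may decay arbitrarily fast, so neither densities nor small-ball estimates improving with
  n are at hand. The factor \<open>1 / n\<close> rescues the argument: it suffices that
  \<open>\<bar>E n w\<bar>\<close> stays above some fixed r with probability close to 1, and a
  finite block of indices guarantees this uniformly in all other variables. Without decay in n there
  is no Borel-Cantelli argument for the derivatives, hence convergence in probability only. The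
  block is taken among indices with \<open>\<bar>w - z i\<bar>\<close> bounded below; they exist
  unless z tends to w, and such w form a Lebesgue null set. For these indices
  \<open>1 / (w - \<xi> i)\<close> is close to a constant, yet by symmetry of X it is not confined
  to a small enough ball. Test functions need not be smooth: a continuous one with compact support
  is approximated uniformly by logarithmic potentials of bounded densities of mean zero, and the
  mean zero removes the additive constant.\<close>

lemma emeasure_Collect_eq_nn_integral:
  assumes [measurable]: "Measurable.pred M Q"
  shows "emeasure M {x \<in> space M. Q x} = (\<integral>\<^sup>+x. (if Q x then 1 else 0) \<partial>M)"
proof -
  have "emeasure M {x \<in> space M. Q x} = (\<integral>\<^sup>+x. indicator {x \<in> space M. Q x} x \<partial>M)"
    by simp
  also have "\<dots> = (\<integral>\<^sup>+x. (if Q x then 1 else 0) \<partial>M)"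
    by (intro nn_integral_cong) (auto simp: indicator_def)
  finally show ?thesis .
qed

lemma borel_measurable_coeff_prod_linear:
  fixes f :: "'i \<Rightarrow> 'a \<Rightarrow> complex"
  assumes "finite J" "\<And>i. i \<in> J \<Longrightarrow> f i \<in> borel_measurable N"
  shows "(\<lambda>x. coeff (\<Prod>i\<in>J. [:1, f i x:]) k) \<in> borel_measurable N"
  using assms
proof (induction J arbitrary: k rule: finite_induct)
  case (insert i J)
  have eq: "coeff (\<Prod>i\<in>insert i J. [:1, f i x:]) k = coeff (\<Prod>i\<in>J. [:1, f i x:]) k +
      (case k of 0 \<Rightarrow> 0 | Suc j \<Rightarrow> f i x * coeff (\<Prod>i\<in>J. [:1, f i x:]) j)" for x
    using insert.hyps by (simp add: coeff_pCons split: nat.split)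
  from insert have [measurable]: "(\<lambda>x. coeff (\<Prod>i\<in>J. [:1, f i x:]) k) \<in> borel_measurable N"
    "f i \<in> borel_measurable N" for k
    by auto
  show ?case
    unfolding eq by (cases k) simp_all
qed simp

text \<open>Every coordinate has the same law \<nu>; the dependence on the index is put into
  \<open>u\<close>. In the application \<open>u i x\<close> is
  \<open>inverse (w - z i + of_real (\<sigma> i) * x)\<close> for a fixed \<open>w\<close>, and
  independence is built in by working on product measures.\<close>

locale indep_perturbation = prob_space \<nu> for \<nu> :: "'a measure" +
  fixes u :: "nat \<Rightarrow> 'a \<Rightarrow> complex"
  assumes u_measurable [measurable]: "\<And>i. u i \<in> borel_measurable \<nu>"
begin

abbreviation prod_law :: "nat set \<Rightarrow> (nat \<Rightarrow> 'a) measure" where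
  "prod_law J \<equiv> PiM J (\<lambda>_. \<nu>)"

sublocale P: product_prob_space "\<lambda>_. \<nu>" UNIV
  by standard

text \<open>Generating polynomial of the elementary symmetric functions of the
  \<open>u i (x i)\<close>. Disjoint index blocks multiply, so the splitting formula for these
  functions is just \<open>coeff_mult\<close>.\<close>

definition gen_poly :: "nat set \<Rightarrow> (nat \<Rightarrow> 'a) \<Rightarrow> complex poly" where
  "gen_poly J x = (\<Prod>i\<in>J. [:1, u i (x i):])"

lemma prob_space_prod_law: "prob_space (prod_law J)"
  by (rule prob_space_PiM) (rule prob_space_axioms)

lemma coeff_gen_poly_0 [simp]: "coeff (gen_poly J x) 0 = 1"
  unfolding gen_poly_def by (induction J rule: infinite_finite_induct) (auto simp: mult.commute)

lemma coeff_gen_poly_1: "coeff (gen_poly J x) (Suc 0) = (\<Sum>i\<in>J. u i (x i))"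
proof (induction J rule: infinite_finite_induct)
  case (insert i J)
  then have "gen_poly (insert i J) x = [:1, u i (x i):] * gen_poly J x"
    by (simp add: gen_poly_def)
  with insert show ?case
    by simp
qed (auto simp: gen_poly_def)

lemma measurable_coeff_gen_poly [measurable]:
  assumes "finite J" "J \<subseteq> I"
  shows "(\<lambda>x. coeff (gen_poly J x) k) \<in> borel_measurable (prod_law I)"
  unfolding gen_poly_def
proof (rule borel_measurable_coeff_prod_linear[OF assms(1)])
  show "(\<lambda>x. u i (x i)) \<in> borel_measurable (prod_law I)" if "i \<in> J" for i
    using assms that by (intro measurable_compose[OF _ u_measurable] measurable_component_singleton) auto
qed

lemma gen_poly_union:
  assumes "finite I" "finite J" "I \<inter> J = {}"
  shows "gen_poly (I \<union> J) x = gen_poly I x * gen_poly J x"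
  unfolding gen_poly_def by (rule prod.union_disjoint) (use assms in auto)

lemma gen_poly_cong:
  "(\<And>i. i \<in> J \<Longrightarrow> x i = y i) \<Longrightarrow> gen_poly J x = gen_poly J y"
  unfolding gen_poly_def by (intro prod.cong) auto

lemma gen_poly_merge:
  assumes "finite I" "finite J" "I \<inter> J = {}"
  shows "gen_poly (I \<union> J) (merge I J (x, y)) = gen_poly I x * gen_poly J y"
  unfolding gen_poly_union[OF assms]
  by (intro arg_cong2[where f = "(*)"] gen_poly_cong) (use assms in \<open>auto simp: merge_def\<close>)

lemma emeasure_prod_law_union:
  assumes "I \<inter> J = {}" "finite I" "finite J" and [measurable]: "Measurable.pred (prod_law (I \<union> J)) Q"
  shows "emeasure (prod_law (I \<union> J)) {x \<in> space (prod_law (I \<union> J)). Q x} =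
    (\<integral>\<^sup>+x. emeasure (prod_law J) {y \<in> space (prod_law J). Q (merge I J (x, y))} \<partial>prod_law I)"
proof -
  have "emeasure (prod_law (I \<union> J)) {x \<in> space (prod_law (I \<union> J)). Q x} =
     (\<integral>\<^sup>+x. indicator {x \<in> space (prod_law (I \<union> J)). Q x} x \<partial>prod_law (I \<union> J))"
    by simp
  also have "\<dots> = (\<integral>\<^sup>+x. (\<integral>\<^sup>+y. indicator {x \<in> space (prod_law (I \<union> J)). Q x} (merge I J (x, y))
      \<partial>prod_law J) \<partial>prod_law I)"
    using assms by (intro P.product_nn_integral_fold) auto
  also have "\<dots> = (\<integral>\<^sup>+x. (\<integral>\<^sup>+y. indicator {y \<in> space (prod_law J). Q (merge I J (x, y))} y
      \<partial>prod_law J) \<partial>prod_law I)"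
  proof (intro nn_integral_cong)
    fix x y assume "x \<in> space (prod_law I)" "y \<in> space (prod_law J)"
    then have "merge I J (x, y) \<in> space (prod_law (I \<union> J))"
      using measurable_space[OF measurable_merge, of "(x, y)" I "\<lambda>_. \<nu>" J]
      by (simp add: space_pair_measure)
    then show "indicator {x \<in> space (prod_law (I \<union> J)). Q x} (merge I J (x, y)) =
      (indicator {y \<in> space (prod_law J). Q (merge I J (x, y))} y :: ennreal)"
      using \<open>y \<in> _\<close> by (auto simp: indicator_def)
  qed
  also have "\<dots> = (\<integral>\<^sup>+x. emeasure (prod_law J) {y \<in> space (prod_law J). Q (merge I J (x, y))} \<partial>prod_law I)"
  proof (intro nn_integral_cong nn_integral_indicator)
    fix x assume [simp]: "x \<in> space (prod_law I)"
    have [measurable]: "(\<lambda>y. merge I J (x, y)) \<in> prod_law J \<rightarrow>\<^sub>M prod_law (I \<union> J)"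
      by (rule measurable_compose[OF measurable_Pair1' measurable_merge]) simp
    show "{y \<in> space (prod_law J). Q (merge I J (x, y))} \<in> sets (prod_law J)"
      by measurable
  qed
  finally show ?thesis .
qed

text \<open>The indices are picked on rapidly decreasing scales. Then the first index where the
  variable is displaced by more than its scale decides the sum, whatever the later ones do.\<close>

lemma sum_concentration_aux:
  fixes p :: real
  assumes "0 < p" "p \<le> 1"
    and *: "\<And>N \<tau> \<eta>. \<tau> > 0 \<Longrightarrow> \<eta> > 0 \<Longrightarrow> \<exists>i>N. \<exists>s>0. \<exists>c.
      (\<forall>b. emeasure \<nu> {x \<in> space \<nu>. cmod (u i x - b) < s} \<le> ennreal (1 - p)) \<and>
      emeasure \<nu> {x \<in> space \<nu>. cmod (u i x - c) \<ge> \<tau>} \<le> ennreal \<eta>"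
    and "\<eta> > 0" "\<tau> > 0"
  shows "\<exists>J s c. finite J \<and> J \<subseteq> {N<..} \<and> s > 0 \<and>
     (\<forall>b. emeasure (prod_law J) {x \<in> space (prod_law J). cmod ((\<Sum>i\<in>J. u i (x i)) - b) < s}
            \<le> ennreal ((1 - p) ^ m + \<eta>)) \<and>
     emeasure (prod_law J) {x \<in> space (prod_law J). cmod ((\<Sum>i\<in>J. u i (x i)) - c) \<ge> \<tau>} \<le> ennreal \<eta>"
  using \<open>\<eta> > 0\<close> \<open>\<tau> > 0\<close>
proof (induction m arbitrary: N \<eta> \<tau>)
  case 0
  have "emeasure (prod_law {}) A \<le> ennreal (1 + \<eta>)" for A
  proof -
    interpret Q: prob_space "prod_law {}" by (rule prob_space_prod_law)
    have "emeasure (prod_law {}) A \<le> 1" by (rule Q.measure_le_1)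
    also have "\<dots> \<le> ennreal (1 + \<eta>)" using 0 by simp
    finally show ?thesis .
  qed
  with 0 show ?case
    by (intro exI[of _ "{}"] exI[of _ 1] exI[of _ 0]) auto
next
  case (Suc m)
  from *[of "\<tau>/2" "\<eta>/2" N] Suc.prems obtain i s1 c1 where i: "i > N" "s1 > 0"
    and b1: "\<And>b. emeasure \<nu> {x \<in> space \<nu>. cmod (u i x - b) < s1} \<le> ennreal (1 - p)"
    and t1: "emeasure \<nu> {x \<in> space \<nu>. cmod (u i x - c1) \<ge> \<tau>/2} \<le> ennreal (\<eta>/2)" by auto
  \<comment> \<open>The order of choice matters: the scale \<open>s1\<close> of the first index is
    known before the later indices are picked, so their sum can be kept within \<open>s1/2\<close>
    of \<open>c\<close> up to probability \<open>\<eta>/2\<close>. The bound \<open>\<tau>/2\<close>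
    keeps the whole sum concentrated.\<close>
  define \<tau>' where "\<tau>' = min (\<tau>/2) (s1/2)"
  have \<tau>': "\<tau>' > 0" "\<tau>' \<le> \<tau>/2" "\<tau>' \<le> s1/2" using Suc.prems i by (auto simp: \<tau>'_def)
  from Suc.IH[of "\<eta>/2" \<tau>' i] Suc.prems \<tau>' obtain J s c where J: "finite J" "J \<subseteq> {i<..}" "s > 0"
    and bJ: "\<And>b. emeasure (prod_law J) {x \<in> space (prod_law J). cmod ((\<Sum>i\<in>J. u i (x i)) - b) < s}
            \<le> ennreal ((1 - p) ^ m + \<eta>/2)"
    and tJ: "emeasure (prod_law J) {x \<in> space (prod_law J). cmod ((\<Sum>i\<in>J. u i (x i)) - c) \<ge> \<tau>'}
            \<le> ennreal (\<eta>/2)" by auto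
  define U where "U x = (\<Sum>i\<in>J. u i (x i))" for x
  note bJ = bJ[folded U_def] and tJ = tJ[folded U_def]
  have iJ: "i \<notin> J" using J by auto
  have U_upd: "(\<Sum>j\<in>insert i J. u j ((x(i := y)) j)) = u i y + U x" for x y
  proof -
    have "(\<Sum>j\<in>J. u j ((x(i := y)) j)) = U x"
      unfolding U_def using iJ by (intro sum.cong) auto
    then show ?thesis using J iJ by simp
  qed
  have [measurable]: "(\<lambda>x. x j) \<in> prod_law I \<rightarrow>\<^sub>M \<nu>" if "j \<in> I" for j I
    using that by (intro measurable_component_singleton) auto
  have [measurable]: "U \<in> borel_measurable (prod_law J)"
    unfolding U_def by measurable
  interpret QJ: prob_space "prod_law J" by (rule prob_space_prod_law)
  have fub: "emeasure (prod_law (insert i J)) {x \<in> space (prod_law (insert i J)). R (\<Sum>j\<in>insert i J. u j (x j))}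
     = (\<integral>\<^sup>+y. emeasure (prod_law J) {x \<in> space (prod_law J). R (u i y + U x)} \<partial>\<nu>)"
    if [measurable]: "Measurable.pred borel R" for R
  proof -
    have "emeasure (prod_law (insert i J)) {x \<in> space (prod_law (insert i J)). R (\<Sum>j\<in>insert i J. u j (x j))}
      = (\<integral>\<^sup>+x. (if R (\<Sum>j\<in>insert i J. u j (x j)) then 1 else 0) \<partial>prod_law (insert i J))"
      by (rule emeasure_Collect_eq_nn_integral) measurable
    also have "\<dots> = (\<integral>\<^sup>+y. (\<integral>\<^sup>+x. (if R (\<Sum>j\<in>insert i J. u j ((x(i := y)) j)) then 1 else 0)
        \<partial>prod_law J) \<partial>\<nu>)"
      using J iJ by (intro P.product_nn_integral_insert_rev) auto
    also have "\<dots> = (\<integral>\<^sup>+y. (\<integral>\<^sup>+x. (if R (u i y + U x) then 1 else 0) \<partial>prod_law J) \<partial>\<nu>)"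
      by (simp only: U_upd)
    also have "\<dots> = (\<integral>\<^sup>+y. emeasure (prod_law J) {x \<in> space (prod_law J). R (u i y + U x)} \<partial>\<nu>)"
      by (intro nn_integral_cong emeasure_Collect_eq_nn_integral[symmetric]) measurable
    finally show ?thesis .
  qed
  let ?A = "\<lambda>y b. {x \<in> space (prod_law J). cmod (U x - (b - u i y)) < s}"
  let ?T = "{x \<in> space (prod_law J). cmod (U x - c) \<ge> \<tau>'}"
  have "emeasure (prod_law (insert i J)) {x \<in> space (prod_law (insert i J)).
      cmod ((\<Sum>j\<in>insert i J. u j (x j)) - b) < min s (s1/2)} \<le> ennreal ((1 - p) ^ Suc m + \<eta>)" for b
  proof -
    \<comment> \<open>Condition on the first coordinate \<open>y\<close>. If \<open>u i y\<close>
      lies within \<open>s1\<close> of \<open>b - c\<close>, which has probability at most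
      \<open>1 - p\<close>, the induction hypothesis bounds the rest; otherwise the later sum has to
      deviate from \<open>c\<close> by \<open>\<tau>'\<close>, which costs
      \<open>\<eta>/2\<close>.\<close>
    have "(\<integral>\<^sup>+y. emeasure (prod_law J) {x \<in> space (prod_law J). cmod (u i y + U x - b) < min s (s1/2)} \<partial>\<nu>)
      \<le> (\<integral>\<^sup>+y. ennreal ((1 - p) ^ m + \<eta>/2) * indicator {y \<in> space \<nu>. cmod (u i y - (b - c)) < s1} y
            + ennreal (\<eta>/2) \<partial>\<nu>)"
    proof (intro nn_integral_mono)
      fix y assume y: "y \<in> space \<nu>"
      show "emeasure (prod_law J) {x \<in> space (prod_law J). cmod (u i y + U x - b) < min s (s1/2)}
         \<le> ennreal ((1 - p) ^ m + \<eta>/2) * indicator {y \<in> space \<nu>. cmod (u i y - (b - c)) < s1} y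
            + ennreal (\<eta>/2)"
      proof (cases "cmod (u i y - (b - c)) < s1")
        case True
        have "emeasure (prod_law J) {x \<in> space (prod_law J). cmod (u i y + U x - b) < min s (s1/2)}
          \<le> emeasure (prod_law J) (?A y b)"
          by (intro emeasure_mono) (auto simp: algebra_simps)
        also have "\<dots> \<le> ennreal ((1 - p) ^ m + \<eta>/2)" by (rule bJ)
        also have "\<dots> \<le> ennreal ((1 - p) ^ m + \<eta>/2) + ennreal (\<eta>/2)" by simp
        finally show ?thesis using True y by simp
      next
        case False
        have "{x \<in> space (prod_law J). cmod (u i y + U x - b) < min s (s1/2)} \<subseteq> ?T"
        proof safe
          fix x assume "cmod (u i y + U x - b) < min s (s1/2)"
          moreover have "cmod (u i y - (b - c)) \<le> cmod (u i y + U x - b) + cmod (U x - c)"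
            using norm_triangle_ineq4[of "u i y + U x - b" "U x - c"] by (simp add: algebra_simps)
          ultimately show "\<tau>' \<le> cmod (U x - c)" using False \<tau>' by simp
        qed
        then have "emeasure (prod_law J) {x \<in> space (prod_law J). cmod (u i y + U x - b) < min s (s1/2)}
          \<le> emeasure (prod_law J) ?T"
          by (intro emeasure_mono) auto
        also have "\<dots> \<le> ennreal (\<eta>/2)" by (rule tJ)
        finally show ?thesis using False y by simp
      qed
    qed
    also have "\<dots> = ennreal ((1 - p) ^ m + \<eta>/2) * emeasure \<nu> {y \<in> space \<nu>. cmod (u i y - (b - c)) < s1}
            + ennreal (\<eta>/2)"
      by (subst nn_integral_add) (auto simp: nn_integral_cmult emeasure_space_1)
    also have "\<dots> \<le> ennreal ((1 - p) ^ m + \<eta>/2) * ennreal (1 - p) + ennreal (\<eta>/2)"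
      by (intro add_right_mono mult_left_mono b1) auto
    also have "\<dots> = ennreal (((1 - p) ^ m + \<eta>/2) * (1 - p) + \<eta>/2)"
      using assms(1,2) Suc.prems by (simp add: ennreal_mult ennreal_plus)
    also have "\<dots> \<le> ennreal ((1 - p) ^ Suc m + \<eta>)"
    proof (intro ennreal_leI)
      have "((1 - p) ^ m + \<eta>/2) * (1 - p) + \<eta>/2 = (1 - p) ^ Suc m + \<eta> - \<eta> * p / 2"
        by (simp add: field_simps)
      with mult_pos_pos[OF Suc.prems(1) assms(1)]
      show "((1 - p) ^ m + \<eta>/2) * (1 - p) + \<eta>/2 \<le> (1 - p) ^ Suc m + \<eta>" by linarith
    qed
    finally show ?thesis
      by (subst fub[of "\<lambda>v. cmod (v - b) < min s (s1/2)"]) auto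
  qed
  \<comment> \<open>The bound just proved relied on this concentration for the later indices, so the
    induction has to reproduce it.\<close>
  moreover have "emeasure (prod_law (insert i J)) {x \<in> space (prod_law (insert i J)).
      cmod ((\<Sum>j\<in>insert i J. u j (x j)) - (c1 + c)) \<ge> \<tau>} \<le> ennreal \<eta>"
  proof -
    have "(\<integral>\<^sup>+y. emeasure (prod_law J) {x \<in> space (prod_law J). cmod (u i y + U x - (c1 + c)) \<ge> \<tau>} \<partial>\<nu>)
      \<le> (\<integral>\<^sup>+y. indicator {y \<in> space \<nu>. cmod (u i y - c1) \<ge> \<tau>/2} y + ennreal (\<eta>/2) \<partial>\<nu>)"
    proof (intro nn_integral_mono)
      fix y assume y: "y \<in> space \<nu>"
      show "emeasure (prod_law J) {x \<in> space (prod_law J). cmod (u i y + U x - (c1 + c)) \<ge> \<tau>}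
         \<le> indicator {y \<in> space \<nu>. cmod (u i y - c1) \<ge> \<tau>/2} y + ennreal (\<eta>/2)"
      proof (cases "cmod (u i y - c1) \<ge> \<tau>/2")
        case True
        have "emeasure (prod_law J) {x \<in> space (prod_law J). cmod (u i y + U x - (c1 + c)) \<ge> \<tau>} \<le> 1"
          by (rule QJ.measure_le_1)
        also have "\<dots> \<le> 1 + ennreal (\<eta>/2)" by simp
        finally show ?thesis using True y by simp
      next
        case False
        have "{x \<in> space (prod_law J). cmod (u i y + U x - (c1 + c)) \<ge> \<tau>} \<subseteq> ?T"
        proof safe
          fix x assume "\<tau> \<le> cmod (u i y + U x - (c1 + c))"
          moreover have "cmod (u i y + U x - (c1 + c)) \<le> cmod (u i y - c1) + cmod (U x - c)"
            using norm_triangle_ineq[of "u i y - c1" "U x - c"] by (simp add: algebra_simps)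
          ultimately show "\<tau>' \<le> cmod (U x - c)" using False \<tau>' by simp
        qed
        then have "emeasure (prod_law J) {x \<in> space (prod_law J). cmod (u i y + U x - (c1 + c)) \<ge> \<tau>}
          \<le> emeasure (prod_law J) ?T"
          by (intro emeasure_mono) auto
        also have "\<dots> \<le> ennreal (\<eta>/2)" by (rule tJ)
        finally show ?thesis using False y by simp
      qed
    qed
    also have "\<dots> = emeasure \<nu> {y \<in> space \<nu>. cmod (u i y - c1) \<ge> \<tau>/2} + ennreal (\<eta>/2)"
      by (subst nn_integral_add) (auto simp: emeasure_space_1)
    also have "\<dots> \<le> ennreal (\<eta>/2) + ennreal (\<eta>/2)"
      by (intro add_right_mono t1)
    also have "\<dots> = ennreal \<eta>"
      using Suc.prems by (simp flip: ennreal_plus)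
    finally show ?thesis
      by (subst fub[of "\<lambda>v. cmod (v - (c1 + c)) \<ge> \<tau>"]) auto
  qed
  ultimately show ?case
    using J i by (intro exI[of _ "insert i J"] exI[of _ "min s (s1/2)"] exI[of _ "c1 + c"]) auto
qed

section \<open>Anti-concentration by induction on the degree\<close>

text \<open>The \<open>b j\<close> are arbitrary because conditioning on the variables outside
  \<open>J\<close> multiplies \<open>gen_poly J x\<close> by a polynomial with constant term 1: the
  top coefficient keeps weight 1, the lower ones get unknown weights. Since \<open>J\<close> lies
  beyond any given \<open>N\<close>, blocks for different degrees can be made disjoint.\<close>

definition spread_out :: "nat \<Rightarrow> bool" where
  "spread_out k \<longleftrightarrow> (\<forall>\<delta>>0. \<forall>N. \<exists>J r. finite J \<and> J \<subseteq> {N<..} \<and> r > 0 \<and>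
     (\<forall>b. emeasure (prod_law J) {x \<in> space (prod_law J).
        cmod (coeff (gen_poly J x) k + (\<Sum>j<k. b j * coeff (gen_poly J x) j)) < r} \<le> ennreal \<delta>))"

lemma spread_out_0: "spread_out 0"
  unfolding spread_out_def by (intro allI impI exI[of _ "{}"] exI[of _ 1]) auto

text \<open>In degree one this concerns the Levy concentration function of the sum: coefficient 0 is
  1, so \<open>b 0\<close> is a mere shift.\<close>

lemma spread_out_1:
  fixes p :: real
  assumes "0 < p" "p \<le> 1"
    and *: "\<And>N \<tau> \<eta>. \<tau> > 0 \<Longrightarrow> \<eta> > 0 \<Longrightarrow> \<exists>i>N. \<exists>s>0. \<exists>c.
      (\<forall>b. emeasure \<nu> {x \<in> space \<nu>. cmod (u i x - b) < s} \<le> ennreal (1 - p)) \<and>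
      emeasure \<nu> {x \<in> space \<nu>. cmod (u i x - c) \<ge> \<tau>} \<le> ennreal \<eta>"
  shows "spread_out (Suc 0)"
  unfolding spread_out_def
proof (intro allI impI)
  fix \<delta> :: real and N :: nat assume \<delta>: "\<delta> > 0"
  have "(\<lambda>m. (1 - p) ^ m) \<longlonglongrightarrow> 0"
    using assms by (intro LIMSEQ_power_zero) auto
  then have "\<forall>\<^sub>F m in sequentially. (1 - p) ^ m < \<delta>/2"
    by (rule order_tendstoD) (use \<delta> in auto)
  then obtain m where m: "(1 - p) ^ m < \<delta>/2"
    by (auto simp: eventually_sequentially)
  from sum_concentration_aux[OF assms(1,2) *, of "\<delta>/2" 1 N m] \<delta>
  obtain J s where J: "finite J" "J \<subseteq> {N<..}" "s > 0" and b: "\<And>b. emeasure (prod_law J)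
     {x \<in> space (prod_law J). cmod ((\<Sum>i\<in>J. u i (x i)) - b) < s} \<le> ennreal ((1 - p) ^ m + \<delta>/2)"
    by auto
  have "ennreal ((1 - p) ^ m + \<delta>/2) \<le> ennreal \<delta>"
    using m by (intro ennreal_leI) auto
  then have "emeasure (prod_law J) {x \<in> space (prod_law J).
        cmod (coeff (gen_poly J x) (Suc 0) + (\<Sum>j<Suc 0. b j * coeff (gen_poly J x) j)) < s}
          \<le> ennreal \<delta>" for b :: "nat \<Rightarrow> complex"
    using b[of "- b 0"] by (auto simp: coeff_gen_poly_1)
  with J show "\<exists>J r. finite J \<and> J \<subseteq> {N<..} \<and> r > 0 \<and>
     (\<forall>b. emeasure (prod_law J) {x \<in> space (prod_law J).
        cmod (coeff (gen_poly J x) (Suc 0) + (\<Sum>j<Suc 0. b j * coeff (gen_poly J x) j)) < r} \<le> ennreal \<delta>)"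
    by blast
qed


text \<open>Compare two samples x, x' on a block \<open>J1\<close> with the same y on a disjoint
  block \<open>J2\<close>. In the difference of the two values the coefficient of degree
  \<open>Suc k\<close> in y cancels, because the first factors both have constant term 1, and the
  one of degree \<open>k\<close> gets the weight D, the difference of the two sums over
  \<open>J1\<close>. Where D is at least \<open>s\<close> in modulus, division by D leaves a
  combination of degree \<open>k\<close> with top weight 1.\<close>

lemma spread_out_Suc:
  assumes "spread_out (Suc 0)" "spread_out k"
  shows "spread_out (Suc k)"
  unfolding spread_out_def
proof (intro allI impI)
  fix \<delta> :: real and N :: nat assume \<delta>: "\<delta> > 0"
  \<comment> \<open>Cauchy-Schwarz bounds the square of the probability, and two events contribute
    to it.\<close>
  then have \<delta>2: "\<delta>^2 / 2 > 0" by simp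
  obtain J1 s where J1: "finite J1" "J1 \<subseteq> {N<..}" "s > 0"
    and b1: "\<And>b. emeasure (prod_law J1) {x \<in> space (prod_law J1).
        cmod (coeff (gen_poly J1 x) (Suc 0) + (\<Sum>j<Suc 0. b j * coeff (gen_poly J1 x) j)) < s} \<le> ennreal (\<delta>^2/2)"
    using assms(1) \<delta>2 unfolding spread_out_def by meson
  obtain J2 r where J2: "finite J2" "J2 \<subseteq> {Max (insert N J1)<..}" "r > 0"
    and b2: "\<And>b. emeasure (prod_law J2) {x \<in> space (prod_law J2).
        cmod (coeff (gen_poly J2 x) k + (\<Sum>j<k. b j * coeff (gen_poly J2 x) j)) < r} \<le> ennreal (\<delta>^2/2)"
    using assms(2) \<delta>2 unfolding spread_out_def by meson
  have J2': "j > N" "j \<notin> J1" if "j \<in> J2" for j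
    using J1 J2 that by (auto simp: subset_iff)
  then have disj: "J2 \<inter> J1 = {}" by auto
  interpret Q1: prob_space "prod_law J1" by (rule prob_space_prod_law)
  interpret Q2: prob_space "prod_law J2" by (rule prob_space_prod_law)
  interpret Q: prob_space "prod_law (J2 \<union> J1)" by (rule prob_space_prod_law)
  interpret Q12: pair_sigma_finite "prod_law J1" "prod_law J2" ..
  interpret Q21: pair_sigma_finite "prod_law J2" "prod_law J1" ..
  interpret Q11: pair_sigma_finite "prod_law J1" "prod_law J1" ..
  define e1 where "e1 i x = coeff (gen_poly J1 x) i" for i x
  define e2 where "e2 i x = coeff (gen_poly J2 x) i" for i x
  have [measurable]: "e1 i \<in> borel_measurable (prod_law J1)" "e2 i \<in> borel_measurable (prod_law J2)" for i
    unfolding e1_def e2_def using J1 J2 by simp_all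
  have "emeasure (prod_law (J2 \<union> J1)) {x \<in> space (prod_law (J2 \<union> J1)).
        cmod (coeff (gen_poly (J2 \<union> J1) x) (Suc k) + (\<Sum>j<Suc k. b j * coeff (gen_poly (J2 \<union> J1) x) j)) < s * r / 2}
        \<le> ennreal \<delta>" (is "?p \<le> _") for b
  proof -
    \<comment> \<open>Giving the leading term its own weight 1 makes the expression a single sum
      over \<open>j \<le> Suc k\<close>, which can be rearranged by degree in y.\<close>
    define b' where "b' = b(Suc k := 1)"
    define F where "F x y = (\<Sum>j\<le>Suc k. b' j * (\<Sum>l\<le>j. e2 l y * e1 (j - l) x))" for x y
    define A where "A x y \<longleftrightarrow> cmod (F x y) < s * r / 2" for x y
    have [measurable]: "Measurable.pred (prod_law J1 \<Otimes>\<^sub>M prod_law J2) (\<lambda>(x, y). A x y)"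
      unfolding A_def F_def by measurable
    have F_eq: "coeff (gen_poly J2 y * gen_poly J1 x) (Suc k) +
        (\<Sum>j<Suc k. b j * coeff (gen_poly J2 y * gen_poly J1 x) j) = F x y" for x y
    proof -
      have "(\<Sum>j<Suc k. b j * coeff (gen_poly J2 y * gen_poly J1 x) j) =
          (\<Sum>j<Suc k. b' j * coeff (gen_poly J2 y * gen_poly J1 x) j)"
        by (intro sum.cong) (auto simp: b'_def)
      then have "coeff (gen_poly J2 y * gen_poly J1 x) (Suc k) +
        (\<Sum>j<Suc k. b j * coeff (gen_poly J2 y * gen_poly J1 x) j) =
        (\<Sum>j\<le>Suc k. b' j * coeff (gen_poly J2 y * gen_poly J1 x) j)"
        unfolding lessThan_Suc_atMost[symmetric] sum.lessThan_Suc[of _ "Suc k"] by (simp add: b'_def)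
      then show ?thesis
        unfolding F_def e1_def e2_def coeff_mult by simp
    qed
    have swap: "F x y - F x' y = (\<Sum>l\<le>Suc k. e2 l y * (\<Sum>j\<in>{j \<in> {..Suc k}. l \<le> j}. b' j * (e1 (j - l) x - e1 (j - l) x')))"
      for x x' y
    proof -
      have "F x y - F x' y = (\<Sum>j\<in>{..Suc k}. \<Sum>l\<in>{l \<in> {..Suc k}. l \<le> j}. e2 l y * (b' j * (e1 (j - l) x - e1 (j - l) x')))"
        unfolding F_def sum_subtractf[symmetric] right_diff_distrib[symmetric] sum_distrib_left
        by (intro sum.cong) (auto simp: algebra_simps)
      also have "\<dots> = (\<Sum>l\<in>{..Suc k}. \<Sum>j\<in>{j \<in> {..Suc k}. l \<le> j}. e2 l y * (b' j * (e1 (j - l) x - e1 (j - l) x')))"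
        by (rule sum.swap_restrict) auto
      finally show ?thesis by (simp add: sum_distrib_left)
    qed
    have diff: "emeasure (prod_law J2) {y \<in> space (prod_law J2). A x y \<and> A x' y} \<le> ennreal (\<delta>^2/2)"
      if D: "cmod (e1 (Suc 0) x - e1 (Suc 0) x') \<ge> s" for x x'
    proof -
      define D where "D = e1 (Suc 0) x - e1 (Suc 0) x'"
      define c where "c l = (\<Sum>j\<in>{j \<in> {..Suc k}. l \<le> j}. b' j * (e1 (j - l) x - e1 (j - l) x'))" for l
      have "{j \<in> {..Suc k}. k \<le> j} = {k, Suc k}" "{j \<in> {..Suc k}. Suc k \<le> j} = {Suc k}" by auto
      \<comment> \<open>For \<open>l = k\<close> the summand \<open>j = k\<close> vanishes because
        \<open>e1 0\<close> is 1 for both samples; \<open>j = Suc k\<close> remains, with weight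
        \<open>b' (Suc k) = 1\<close>.\<close>
      then have c: "c k = D" "c (Suc k) = 0"
        by (simp_all add: c_def D_def e1_def b'_def)
      have D0: "cmod D \<ge> s" "D \<noteq> 0" using D J1 by (auto simp: D_def)
      have "F x y - F x' y = (\<Sum>l<Suc (Suc k). e2 l y * c l)" for y
        unfolding swap c_def lessThan_Suc_atMost ..
      then have F_diff: "F x y - F x' y = D * (e2 k y + (\<Sum>l<k. c l / D * e2 l y))" for y
        using D0 by (simp add: c sum_distrib_left algebra_simps)
      have "{y \<in> space (prod_law J2). A x y \<and> A x' y} \<subseteq>
         {y \<in> space (prod_law J2). cmod (e2 k y + (\<Sum>l<k. c l / D * e2 l y)) < r}"
      proof safe
        fix y assume "A x y" "A x' y"
        then have "cmod (F x y - F x' y) < s * r"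
          unfolding A_def using norm_triangle_ineq4[of "F x y" "F x' y"] by simp
        also have "\<dots> \<le> cmod D * r"
          using D0 J2 by (intro mult_right_mono) auto
        finally have "cmod D * cmod (e2 k y + (\<Sum>l<k. c l / D * e2 l y)) < cmod D * r"
          unfolding F_diff norm_mult .
        then show "cmod (e2 k y + (\<Sum>l<k. c l / D * e2 l y)) < r"
          using D0 by simp
      qed
      then have "emeasure (prod_law J2) {y \<in> space (prod_law J2). A x y \<and> A x' y} \<le>
        emeasure (prod_law J2) {y \<in> space (prod_law J2). cmod (e2 k y + (\<Sum>l<k. c l / D * e2 l y)) < r}"
        by (intro emeasure_mono) measurable
      also have "\<dots> \<le> ennreal (\<delta>^2/2)"
        using b2[of "\<lambda>l. c l / D"] by (simp add: e2_def)
      finally show ?thesis .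
    qed
    define \<phi> where "\<phi> y = emeasure (prod_law J1) {x \<in> space (prod_law J1). A x y}" for y
    define i where "i x y = (if A x y then 1 else 0 :: ennreal)" for x y
    have [measurable]: "(\<lambda>(x, y). i x y) \<in> borel_measurable (prod_law J1 \<Otimes>\<^sub>M prod_law J2)"
      unfolding i_def by measurable
    have \<phi>_eq: "\<phi> y = (\<integral>\<^sup>+x. i x y \<partial>prod_law J1)" if "y \<in> space (prod_law J2)" for y
      unfolding \<phi>_def i_def using that by (intro emeasure_Collect_eq_nn_integral) measurable
    have "?p = (\<integral>\<^sup>+y. emeasure (prod_law J1) {x \<in> space (prod_law J1).
        cmod (coeff (gen_poly (J2 \<union> J1) (merge J2 J1 (y, x))) (Suc k) +
        (\<Sum>j<Suc k. b j * coeff (gen_poly (J2 \<union> J1) (merge J2 J1 (y, x))) j)) < s * r / 2} \<partial>prod_law J2)"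
      using J1 J2 disj by (intro emeasure_prod_law_union) auto
    also have "\<dots> = (\<integral>\<^sup>+y. \<phi> y \<partial>prod_law J2)"
      unfolding gen_poly_merge[OF J2(1) J1(1) disj] F_eq \<phi>_def A_def ..
    also have "\<dots> = (\<integral>\<^sup>+y. (\<integral>\<^sup>+x. i x y \<partial>prod_law J1) \<partial>prod_law J2)"
      by (intro nn_integral_cong \<phi>_eq)
    finally have p: "?p = (\<integral>\<^sup>+y. (\<integral>\<^sup>+x. i x y \<partial>prod_law J1) \<partial>prod_law J2)" .
    \<comment> \<open>Cauchy-Schwarz against the constant 1. The integral of the squared inner
      probability is the probability that two independent samples on \<open>J1\<close> both give a
      small value at the same y.\<close>
    have "?p\<^sup>2 \<le> (\<integral>\<^sup>+y. (\<integral>\<^sup>+x. i x y \<partial>prod_law J1)\<^sup>2 \<partial>prod_law J2) * (\<integral>\<^sup>+y. 1\<^sup>2 \<partial>prod_law J2)"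
      unfolding p by (rule order_trans[OF _ Cauchy_Schwarz_nn_integral]) auto
    also have "\<dots> = (\<integral>\<^sup>+y. (\<integral>\<^sup>+x'. i x' y * (\<integral>\<^sup>+x. i x y \<partial>prod_law J1) \<partial>prod_law J1) \<partial>prod_law J2)"
      by (simp add: Q2.emeasure_space_1 nn_integral_multc power2_eq_square cong: nn_integral_cong)
    also have "\<dots> = (\<integral>\<^sup>+x'. (\<integral>\<^sup>+y. i x' y * (\<integral>\<^sup>+x. i x y \<partial>prod_law J1) \<partial>prod_law J2) \<partial>prod_law J1)"
      by (rule Q12.Fubini') measurable
    also have "\<dots> = (\<integral>\<^sup>+x'. (\<integral>\<^sup>+y. (\<integral>\<^sup>+x. i x' y * i x y \<partial>prod_law J1) \<partial>prod_law J2) \<partial>prod_law J1)"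
      by (simp add: nn_integral_cmult cong: nn_integral_cong)
    also have "\<dots> = (\<integral>\<^sup>+x'. (\<integral>\<^sup>+x. (\<integral>\<^sup>+y. i x' y * i x y \<partial>prod_law J2) \<partial>prod_law J1) \<partial>prod_law J1)"
      by (intro nn_integral_cong Q12.Fubini') measurable
    also have "\<dots> \<le> (\<integral>\<^sup>+x'. (\<integral>\<^sup>+x. (if cmod (e1 (Suc 0) x - e1 (Suc 0) x') < s then 1 else 0) + ennreal (\<delta>^2/2)
        \<partial>prod_law J1) \<partial>prod_law J1)"
    proof (intro nn_integral_mono)
      fix x' x assume [measurable]: "x' \<in> space (prod_law J1)" "x \<in> space (prod_law J1)"
      have "(\<integral>\<^sup>+y. i x' y * i x y \<partial>prod_law J2) = emeasure (prod_law J2) {y \<in> space (prod_law J2). A x y \<and> A x' y}"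
        by (subst emeasure_Collect_eq_nn_integral) (auto simp: i_def intro!: nn_integral_cong)
      also have "\<dots> \<le> (if cmod (e1 (Suc 0) x - e1 (Suc 0) x') < s then 1 else 0) + ennreal (\<delta>^2/2)"
      proof (cases "cmod (e1 (Suc 0) x - e1 (Suc 0) x') < s")
        case True
        have "emeasure (prod_law J2) {y \<in> space (prod_law J2). A x y \<and> A x' y} \<le> 1"
          by (rule Q2.measure_le_1)
        also have "\<dots> \<le> 1 + ennreal (\<delta>^2/2)" by simp
        finally show ?thesis using True by simp
      qed (use diff[of x x'] in auto)
      finally show "(\<integral>\<^sup>+y. i x' y * i x y \<partial>prod_law J2) \<le>
        (if cmod (e1 (Suc 0) x - e1 (Suc 0) x') < s then 1 else 0) + ennreal (\<delta>^2/2)" .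
    qed
    also have "\<dots> = (\<integral>\<^sup>+x'. emeasure (prod_law J1) {x \<in> space (prod_law J1). cmod (e1 (Suc 0) x - e1 (Suc 0) x') < s}
        + ennreal (\<delta>^2/2) \<partial>prod_law J1)"
      by (intro nn_integral_cong, subst nn_integral_add)
         (auto simp: Q1.emeasure_space_1 emeasure_Collect_eq_nn_integral)
    \<comment> \<open>For fixed x' the condition on D is a small-ball event for the sum over
      \<open>J1\<close>, centred at the value for x', so the degree-one bound applies.\<close>
    also have "\<dots> \<le> (\<integral>\<^sup>+x'. ennreal (\<delta>^2/2) + ennreal (\<delta>^2/2) \<partial>prod_law J1)"
      using b1[of "\<lambda>_. - e1 (Suc 0) x'" for x'] by (intro nn_integral_mono add_right_mono) (simp add: e1_def)
    also have "\<dots> = ennreal (\<delta>^2/2 + \<delta>^2/2)"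
      by (simp add: Q1.emeasure_space_1 flip: ennreal_plus)
    also have "\<dots> = (ennreal \<delta>)\<^sup>2"
      using \<delta> by (simp add: ennreal_power)
    finally have "?p\<^sup>2 \<le> (ennreal \<delta>)\<^sup>2" .
    then show ?thesis
      using \<delta> by (simp only: Q.emeasure_eq_measure ennreal_power measure_nonneg less_imp_le
        ennreal_le_iff zero_le_power power_mono_iff pos2)
  qed
  then show "\<exists>J r. finite J \<and> J \<subseteq> {N<..} \<and> r > 0 \<and> (\<forall>b. emeasure (prod_law J) {x \<in> space (prod_law J).
        cmod (coeff (gen_poly J x) (Suc k) + (\<Sum>j<Suc k. b j * coeff (gen_poly J x) j)) < r} \<le> ennreal \<delta>)"
    using J1 J2 J2' by (intro exI[of _ "J2 \<union> J1"] exI[of _ "s * r / 2"]) auto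
qed

lemma spread_out:
  assumes "spread_out (Suc 0)"
  shows "spread_out k"
  by (induction k) (auto intro: spread_out_0 spread_out_Suc assms)

text \<open>Condition on all indices outside \<open>J\<close>: by \<open>coeff_mult\<close> they
  only supply the weights of the lower coefficients, their own constant term being 1. The radius and
  the bound are the same for all large \<open>n\<close>.\<close>

lemma coeff_gen_poly_anticoncentration:
  assumes "spread_out k" "\<delta> > 0"
  obtains r N where "r > 0" "\<And>n. n \<ge> N \<Longrightarrow>
    emeasure (prod_law {1..n}) {x \<in> space (prod_law {1..n}). cmod (coeff (gen_poly {1..n} x) k) < r} \<le> ennreal \<delta>"
proof -
  obtain J r where J: "finite J" "J \<subseteq> {0<..}" "r > 0"
    and b: "\<And>b. emeasure (prod_law J) {x \<in> space (prod_law J).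
        cmod (coeff (gen_poly J x) k + (\<Sum>j<k. b j * coeff (gen_poly J x) j)) < r} \<le> ennreal \<delta>"
    using assms unfolding spread_out_def by meson
  have "emeasure (prod_law {1..n}) {x \<in> space (prod_law {1..n}). cmod (coeff (gen_poly {1..n} x) k) < r} \<le> ennreal \<delta>"
    if n: "n \<ge> Max (insert 0 J)" for n
  proof -
    define C where "C = {1..n} - J"
    have C: "C \<inter> J = {}" "finite C" by (auto simp: C_def)
    have eq: "{1..n} = C \<union> J"
      using J n unfolding C_def by (auto simp: Suc_le_eq)
    interpret Q: prob_space "prod_law C" by (rule prob_space_prod_law)
    have "emeasure (prod_law (C \<union> J)) {x \<in> space (prod_law (C \<union> J)). cmod (coeff (gen_poly (C \<union> J) x) k) < r}
      = (\<integral>\<^sup>+x. emeasure (prod_law J) {y \<in> space (prod_law J).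
         cmod (coeff (gen_poly (C \<union> J) (merge C J (x, y))) k) < r} \<partial>prod_law C)"
      using C J by (intro emeasure_prod_law_union) auto
    also have "\<dots> \<le> (\<integral>\<^sup>+x. ennreal \<delta> \<partial>prod_law C)"
    proof (intro nn_integral_mono)
      fix x
      have "coeff (gen_poly (C \<union> J) (merge C J (x, y))) k =
          coeff (gen_poly J y) k + (\<Sum>j<k. coeff (gen_poly C x) (k - j) * coeff (gen_poly J y) j)" for y
        unfolding gen_poly_merge[OF C(2) J(1) C(1)] mult.commute[of "gen_poly C x"] coeff_mult
          lessThan_Suc_atMost[symmetric]
        by (simp add: mult.commute)
      then show "emeasure (prod_law J) {y \<in> space (prod_law J).
         cmod (coeff (gen_poly (C \<union> J) (merge C J (x, y))) k) < r} \<le> ennreal \<delta>"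
        using b[of "\<lambda>j. coeff (gen_poly C x) (k - j)"] by simp
    qed
    also have "\<dots> = ennreal \<delta>" by (simp add: Q.emeasure_space_1)
    finally show ?thesis unfolding eq .
  qed
  with J that show ?thesis by blast
qed

end

section \<open>The law of X and its image under inversion\<close>

lemma measure_norm_ge_eventually_small:
  fixes \<nu> :: "'a::{real_normed_vector, second_countable_topology} measure"
  assumes "prob_space \<nu>" and [measurable_cong]: "sets \<nu> = sets borel" and "\<eta> > 0"
  obtains K where "K > 0" "\<And>L. L \<ge> K \<Longrightarrow> measure \<nu> {x. norm x \<ge> L} \<le> \<eta>"
proof -
  interpret prob_space \<nu> by fact
  have [simp]: "space \<nu> = UNIV" using sets_eq_imp_space_eq[OF assms(2)] by simp
  have "(\<lambda>n. measure \<nu> {x. norm x \<ge> real n}) \<longlonglongrightarrow> measure \<nu> (\<Inter>n. {x. norm x \<ge> real n})"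
    by (intro finite_Lim_measure_decseq) (auto simp: decseq_def)
  also have "(\<Inter>n. {x :: 'a. norm x \<ge> real n}) = {}"
  proof safe
    fix x :: 'a assume "x \<in> (\<Inter>n. {x. norm x \<ge> real n})"
    moreover obtain n where "norm x < real n" using reals_Archimedean2 by blast
    ultimately show "x \<in> {}" by (auto dest: spec[of _ n])
  qed
  finally have "(\<lambda>n. measure \<nu> {x. norm x \<ge> real n}) \<longlonglongrightarrow> 0"
    by simp
  then have "\<forall>\<^sub>F n in sequentially. measure \<nu> {x. norm x \<ge> real n} < \<eta>"
    by (rule order_tendstoD) fact
  then obtain n where n: "measure \<nu> {x. norm x \<ge> real n} < \<eta>"
    by (auto simp: eventually_sequentially)
  show ?thesis
  proof (rule that[of "real (Suc n)"])
    fix L assume "real (Suc n) \<le> L"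
    then have "measure \<nu> {x. norm x \<ge> L} \<le> measure \<nu> {x. norm x \<ge> real n}"
      by (intro finite_measure_mono) auto
    with n show "measure \<nu> {x. norm x \<ge> L} \<le> \<eta>" by simp
  qed simp
qed

text \<open>The annuli \<open>1/(n+1) \<le> norm x \<le> n+1\<close> exhaust the complement of 0.
  Both radii are used later: \<open>t\<close> separates the images of x and -x, and \<open>T\<close>
  keeps \<open>w - z i\<close> away from the perturbation.\<close>

lemma prob_annulus_pos:
  fixes \<nu> :: "'a::{real_normed_vector, second_countable_topology} measure"
  assumes "prob_space \<nu>" and [measurable_cong]: "sets \<nu> = sets borel" and "\<not> (AE x in \<nu>. x = 0)"
  obtains t T where "0 < t" "t \<le> T" "measure \<nu> {x. t \<le> norm x \<and> norm x \<le> T} > 0"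
proof -
  interpret prob_space \<nu> by fact
  have [simp]: "space \<nu> = UNIV" using sets_eq_imp_space_eq[OF assms(2)] by simp
  let ?K = "\<lambda>n. {x :: 'a. 1 / real (Suc n) \<le> norm x \<and> norm x \<le> real (Suc n)}"
  have "\<exists>n. measure \<nu> (?K n) > 0"
  proof (rule ccontr)
    assume "\<not> ?thesis"
    then have "measure \<nu> (?K n) = 0" for n
      by (simp add: zero_less_measure_iff)
    then have null: "?K n \<in> null_sets \<nu>" for n
      by (intro null_setsI) (auto simp: emeasure_eq_measure)
    then have "(\<Union>n. ?K n) \<in> null_sets \<nu>"
      by (intro null_sets_UN) auto
    moreover have "x \<in> (\<Union>n. ?K n)" if "x \<noteq> 0" for x :: 'a
    proof -
      obtain m where m: "norm x < real m" using reals_Archimedean2 by blast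
      have "norm x > 0" using that by simp
      then obtain k where k: "inverse (real (Suc k)) < norm x" by (rule reals_Archimedean[THEN exE])
      have "1 / real (Suc (max m k)) \<le> 1 / real (Suc k)" by (intro divide_left_mono) auto
      with m k show ?thesis by (intro UN_I[of "max m k"]) (auto simp: inverse_eq_divide)
    qed
    ultimately have "AE x in \<nu>. x = 0"
      by (intro AE_I'[of "\<Union>n. ?K n"]) auto
    with assms(3) show False by simp
  qed
  then obtain n where n: "measure \<nu> (?K n) > 0" ..
  then have "?K n \<noteq> {}" by (metis measure_empty less_irrefl)
  then have "1 / real (Suc n) \<le> real (Suc n)" by auto
  with n show ?thesis by (intro that[of "1 / real (Suc n)" "real (Suc n)"]) auto
qed

text \<open>Since \<open>x\<close> and \<open>-x\<close> are equally likely and have well separated images, no small ball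
  captures more than half of the mass of an annulus.\<close>

lemma spread_out_inverse:
  fixes \<nu> :: "complex measure" and z :: "nat \<Rightarrow> complex" and \<sigma> :: "nat \<Rightarrow> real"
  assumes "prob_space \<nu>" and sets_\<nu> [measurable_cong]: "sets \<nu> = sets borel"
    and symm: "distr \<nu> borel uminus = \<nu>" and nz: "\<not> (AE x in \<nu>. x = 0)"
    and \<sigma>_pos: "\<And>i. i \<ge> 1 \<Longrightarrow> \<sigma> i > 0" and \<sigma>_lim: "\<sigma> \<longlonglongrightarrow> 0"
    and not_lim: "\<not> z \<longlonglongrightarrow> w"
  shows "indep_perturbation.spread_out \<nu> (\<lambda>i x. inverse (w - z i + of_real (\<sigma> i) * x)) k"
proof -
  interpret prob_space \<nu> by fact
  define u where "u = (\<lambda>i x. inverse (w - z i + of_real (\<sigma> i) * x))"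
  interpret indep_perturbation \<nu> u
  proof
    show "u i \<in> borel_measurable \<nu>" for i unfolding u_def by measurable
  qed
  have [simp]: "space \<nu> = UNIV" using sets_eq_imp_space_eq[OF sets_\<nu>] by simp
  obtain t T where tT: "0 < t" "t \<le> T" and pos: "measure \<nu> {x. t \<le> norm x \<and> norm x \<le> T} > 0"
    using prob_annulus_pos[OF \<open>prob_space \<nu>\<close> sets_\<nu> nz] .
  let ?K = "{x :: complex. t \<le> norm x \<and> norm x \<le> T}"
  have p: "0 < measure \<nu> ?K / 2" "measure \<nu> ?K / 2 \<le> 1"
    using pos prob_le_1[of ?K] by linarith+
  \<comment> \<open>Failure of convergence yields infinitely many indices with
    \<open>w - z i\<close> bounded away from 0, and among them \<open>\<sigma> i\<close> gets as
    small as desired.\<close>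
  from not_lim obtain c where c: "c > 0" "\<And>N. \<exists>i\<ge>N. c \<le> cmod (w - z i)"
    unfolding LIMSEQ_def dist_norm by (metis not_le norm_minus_commute)
  have "spread_out (Suc 0)"
  proof (rule spread_out_1[OF p])
    fix N :: nat and \<tau> \<eta> :: real assume \<tau>\<eta>: "\<tau> > 0" "\<eta> > 0"
    \<comment> \<open>For \<open>\<bar>y\<bar> < t'\<close> the two bounds give
      \<open>\<bar>A + y\<bar> \<ge> c/2\<close> and then \<open>\<bar>1/(A + y) - 1/A\<bar> \<le>
      t' / (c\<^sup>2/2) \<le> \<tau>/2\<close>.\<close>
    define t' where "t' = min (c/2) (\<tau> * c\<^sup>2 / 4)"
    have t': "t' > 0" "t' \<le> c/2" "t' \<le> \<tau> * c\<^sup>2 / 4" using c \<tau>\<eta> by (auto simp: t'_def)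
    obtain L where L: "L > 0" "\<And>L'. L' \<ge> L \<Longrightarrow> measure \<nu> {x. norm x \<ge> L'} \<le> \<eta>"
      using measure_norm_ge_eventually_small[OF \<open>prob_space \<nu>\<close> sets_\<nu> \<open>\<eta> > 0\<close>] by blast
    \<comment> \<open>The first bound puts the event \<open>\<sigma> i * norm x \<ge> t'\<close>
      into the tail beyond \<open>L\<close>; the second keeps \<open>A + y\<close> and
      \<open>A - y\<close> different from 0 for x in the annulus.\<close>
    have "\<forall>\<^sub>F i in sequentially. \<sigma> i < min (t' / L) (c / 2 / T)"
      by (rule order_tendstoD[OF \<sigma>_lim]) (use t' L c tT in auto)
    then obtain N' where N': "\<And>i. i \<ge> N' \<Longrightarrow> \<sigma> i < min (t' / L) (c / 2 / T)"
      by (auto simp: eventually_sequentially)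
    obtain i where i: "i \<ge> max (Suc N) N'" and ci: "c \<le> cmod (w - z i)" using c(2) by blast
    define A where "A = w - z i"
    have \<sigma>: "\<sigma> i > 0" "\<sigma> i * L < t'" "\<sigma> i * T < c / 2"
      using N'[of i] i \<sigma>_pos[of i] L tT by (auto simp: field_simps)
    have A: "cmod A \<ge> c" "A \<noteq> 0" using ci c by (auto simp: A_def)
    \<comment> \<open>Half of a lower bound for
      \<open>\<bar>2 * y / ((A + y) * (A - y))\<bar>\<close>, the distance between the images of x
      and -x; two points of an open ball of radius \<open>s\<close> are closer than that.\<close>
    define s where "s = \<sigma> i * t / (cmod A + \<sigma> i * T)\<^sup>2"
    have A\<sigma>: "cmod A + \<sigma> i * T > 0"
      using \<sigma> tT A c by (intro add_pos_nonneg mult_nonneg_nonneg) auto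
    then have s: "s > 0"
      unfolding s_def using A\<sigma> \<sigma> tT by (intro divide_pos_pos mult_pos_pos zero_less_power) auto
    have sep: "cmod (u i x - u i (- x)) \<ge> 2 * s" if "x \<in> ?K" for x
    proof -
      define y where "y = of_real (\<sigma> i) * x"
      have y: "cmod y \<ge> \<sigma> i * t" "cmod y \<le> \<sigma> i * T"
        using that \<sigma> by (auto simp: y_def norm_mult)
      have nz: "A + y \<noteq> 0" "A - y \<noteq> 0"
        using y \<sigma> A c by (auto simp: add_eq_0_iff)
      have u: "u i x = inverse (A + y)" "u i (- x) = inverse (A - y)"
        by (simp_all add: u_def A_def y_def)
      have "u i x - u i (- x) = - (2 * y / ((A + y) * (A - y)))"
        unfolding u using nz by (simp add: field_simps)
      then have "cmod (u i x - u i (- x)) = cmod (2 * y) / (cmod (A + y) * cmod (A - y))"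
        by (simp only: norm_minus_cancel norm_divide norm_mult)
      also have "\<dots> \<ge> 2 * (\<sigma> i * t) / ((cmod A + \<sigma> i * T) * (cmod A + \<sigma> i * T))"
      proof (intro frac_le mult_mono)
        show "cmod (A + y) \<le> cmod A + \<sigma> i * T" "cmod (A - y) \<le> cmod A + \<sigma> i * T"
          using norm_triangle_ineq[of A y] norm_triangle_ineq4[of A y] y by linarith+
      qed (use y nz A\<sigma> in \<open>auto simp: norm_mult\<close>)
      finally show ?thesis by (simp add: s_def power2_eq_square)
    qed
    have "emeasure \<nu> {x \<in> space \<nu>. cmod (u i x - b) < s} \<le> ennreal (1 - measure \<nu> ?K / 2)" for b
    proof -
      let ?B = "{x. cmod (u i x - b) < s}"
      have "measure \<nu> (?K \<inter> ?B) = measure (distr \<nu> borel uminus) (?K \<inter> ?B)"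
        by (simp add: symm)
      also have "\<dots> = measure \<nu> (uminus -` (?K \<inter> ?B) \<inter> space \<nu>)"
        by (rule measure_distr) measurable
      also have "uminus -` (?K \<inter> ?B) \<inter> space \<nu> = ?K \<inter> {x. cmod (u i (- x) - b) < s}"
        by auto
      finally have eq: "measure \<nu> (?K \<inter> ?B) = measure \<nu> (?K \<inter> {x. cmod (u i (- x) - b) < s})" .
      \<comment> \<open>Reflection preserves \<nu> and the annulus, so the part of \<open>?K\<close>
        sent into the ball has the same mass as its mirror image. The two parts are disjoint, hence
        each has at most half of the mass of \<open>?K\<close>.\<close>
      have "(?K \<inter> ?B) \<inter> (?K \<inter> {x. cmod (u i (- x) - b) < s}) = {}"
      proof safe
        fix x assume "t \<le> cmod x" "cmod x \<le> T" "cmod (u i x - b) < s" "cmod (u i (- x) - b) < s"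
        with sep[of x] norm_triangle_ineq4[of "u i x - b" "u i (- x) - b"] show "x \<in> {}" by simp
      qed
      then have "measure \<nu> (?K \<inter> ?B) + measure \<nu> (?K \<inter> {x. cmod (u i (- x) - b) < s}) =
          measure \<nu> ((?K \<inter> ?B) \<union> (?K \<inter> {x. cmod (u i (- x) - b) < s}))"
        by (intro finite_measure_Union[symmetric]) auto
      also have "\<dots> \<le> measure \<nu> ?K"
        by (intro finite_measure_mono) auto
      finally have half: "measure \<nu> (?K \<inter> ?B) \<le> measure \<nu> ?K / 2" using eq by simp
      have "measure \<nu> ?B \<le> measure \<nu> ((?K \<inter> ?B) \<union> (UNIV - ?K))"
        by (intro finite_measure_mono) auto
      also have "\<dots> \<le> measure \<nu> (?K \<inter> ?B) + measure \<nu> (UNIV - ?K)"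
        by (intro measure_Un_le) auto
      also have "measure \<nu> (UNIV - ?K) = 1 - measure \<nu> ?K"
        using prob_compl[of ?K] by simp
      finally show ?thesis using half
        by (simp add: emeasure_eq_measure ennreal_leI)
    qed
    moreover have "emeasure \<nu> {x \<in> space \<nu>. cmod (u i x - inverse A) \<ge> \<tau>} \<le> ennreal \<eta>"
    proof -
      have "{x. cmod (u i x - inverse A) \<ge> \<tau>} \<subseteq> {x. norm x \<ge> t' / \<sigma> i}"
      proof safe
        fix x assume *: "\<tau> \<le> cmod (u i x - inverse A)"
        show "t' / \<sigma> i \<le> cmod x"
        proof (rule ccontr)
          assume "\<not> ?thesis"
          then have lt: "\<sigma> i * cmod x < t'" using \<sigma> by (simp add: field_simps)
          define y where "y = of_real (\<sigma> i) * x"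
          have y: "cmod y < t'" using lt \<sigma> by (simp add: y_def norm_mult)
          have Ay: "cmod (A + y) \<ge> c / 2"
            using norm_diff_ineq[of A y] A y t' by linarith
          then have nz: "A + y \<noteq> 0" using c by auto
          have u: "u i x = inverse (A + y)" by (simp add: u_def A_def y_def)
          have "u i x - inverse A = - (y / ((A + y) * A))"
            unfolding u using nz A by (simp add: field_simps)
          then have "cmod (u i x - inverse A) = cmod y / (cmod (A + y) * cmod A)"
            by (simp only: norm_minus_cancel norm_divide norm_mult)
          also have "\<dots> \<le> t' / (c / 2 * c)"
            using y Ay A c t' by (intro frac_le mult_mono) auto
          also have "\<dots> \<le> (\<tau> * c\<^sup>2 / 4) / (c / 2 * c)"
            using t' c by (intro divide_right_mono) auto
          also have "\<dots> < \<tau>" using c \<tau>\<eta> by (simp add: field_simps power2_eq_square)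
          finally show False using * by simp
        qed
      qed
      then have "measure \<nu> {x. cmod (u i x - inverse A) \<ge> \<tau>} \<le> measure \<nu> {x. norm x \<ge> t' / \<sigma> i}"
        by (intro finite_measure_mono) auto
      also have "\<dots> \<le> \<eta>"
        using \<sigma> by (intro L) (simp add: field_simps)
      finally show ?thesis
        by (simp add: emeasure_eq_measure ennreal_leI)
    qed
    ultimately show "\<exists>i>N. \<exists>s>0. \<exists>c. (\<forall>b. emeasure \<nu> {x \<in> space \<nu>. cmod (u i x - b) < s}
        \<le> ennreal (1 - measure \<nu> ?K / 2)) \<and> emeasure \<nu> {x \<in> space \<nu>. cmod (u i x - c) \<ge> \<tau>} \<le> ennreal \<eta>"
      using i s by (intro exI[of _ i] conjI exI[of _ s] exI[of _ "inverse A"]) auto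
  qed
  then have "spread_out k" by (rule spread_out)
  then show ?thesis unfolding u_def .
qed

text \<open>Up to the factor \<open>fact k\<close> this is the quotient of the \<open>k\<close>-th derivative of the polynomial
  with zeros \<open>\<xi> 1, \<dots>, \<xi> n\<close> and the polynomial itself.\<close>

definition deriv_ratio :: "(nat \<Rightarrow> complex) \<Rightarrow> nat \<Rightarrow> nat \<Rightarrow> complex \<Rightarrow> complex" where
  "deriv_ratio \<xi> k n w = coeff (\<Prod>i=1..n. [:1, inverse (w - \<xi> i):]) k"

section \<open>Transfer to the random sequence\<close>

locale random_perturbation = prob_space M for M :: "'w measure" +
  fixes z :: "nat \<Rightarrow> complex" and X :: "nat \<Rightarrow> 'w \<Rightarrow> complex" and \<sigma> :: "nat \<Rightarrow> real"
  assumes indep: "indep_vars (\<lambda>_. borel) X {1..}"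
    and ident: "\<And>i. i \<ge> 1 \<Longrightarrow> distr M borel (X i) = distr M borel (X 1)"
    and symmetric: "distr M borel (X 1) = distr M borel (\<lambda>\<omega>. - X 1 \<omega>)"
    and nonzero: "\<not> (AE \<omega> in M. X 1 \<omega> = 0)"
    and integrable_X: "integrable M (\<lambda>\<omega>. cmod (X 1 \<omega>))"
    and \<sigma>_pos: "\<And>i. i \<ge> 1 \<Longrightarrow> \<sigma> i > 0"
    and \<sigma>_decreasing: "\<And>i j. 1 \<le> i \<Longrightarrow> i \<le> j \<Longrightarrow> \<sigma> j \<le> \<sigma> i"
    and \<sigma>_lim: "\<sigma> \<longlonglongrightarrow> 0"
begin

lemma X_measurable [measurable]: "i \<ge> 1 \<Longrightarrow> X i \<in> borel_measurable M"
  by (rule indep[unfolded indep_vars_def, THEN conjunct1, THEN bspec]) (rule atLeast_iff[THEN iffD2])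

definition zero_at :: "nat \<Rightarrow> 'w \<Rightarrow> complex" where
  "zero_at i \<omega> = z i - of_real (\<sigma> i) * X i \<omega>"

lemma zero_at_measurable [measurable]: "i \<ge> 1 \<Longrightarrow> zero_at i \<in> borel_measurable M"
  unfolding zero_at_def
  by (intro borel_measurable_diff borel_measurable_times borel_measurable_const X_measurable)

lemma distr_X_PiM:
  assumes "n \<ge> 1"
  shows "distr M (PiM {1..n} (\<lambda>_. borel)) (\<lambda>\<omega>. \<lambda>i\<in>{1..n}. X i \<omega>) = PiM {1..n} (\<lambda>_. distr M borel (X 1))"
proof -
  have "indep_vars (\<lambda>_. borel) X {1..n}"
    using indep by (rule indep_vars_subset) auto
  then have "distr M (PiM {1..n} (\<lambda>_. borel)) (\<lambda>\<omega>. \<lambda>i\<in>{1..n}. X i \<omega>) = PiM {1..n} (\<lambda>i. distr M borel (X i))"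
    using assms by (subst (asm) indep_vars_iff_distr_eq_PiM') auto
  also have "\<dots> = PiM {1..n} (\<lambda>_. distr M borel (X 1))"
    by (intro PiM_cong ident) auto
  finally show ?thesis .
qed

text \<open>The event depends only on \<open>X 1, ..., X n\<close>, whose joint law is a power of
  the law of \<open>X 1\<close>; it is therefore an event of the product space treated
  above.\<close>

lemma deriv_ratio_anticoncentration:
  assumes "\<not> z \<longlonglongrightarrow> w" "\<delta> > 0"
  obtains r N where "r > 0" "\<And>n. n \<ge> N \<Longrightarrow>
    emeasure M {\<omega> \<in> space M. cmod (deriv_ratio (\<lambda>i. zero_at i \<omega>) k n w) < r} \<le> ennreal \<delta>"
proof -
  define \<nu> where "\<nu> = distr M borel (X 1)"
  interpret \<nu>: prob_space \<nu> unfolding \<nu>_def by (rule prob_space_distr) (rule X_measurable, rule order_refl)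
  have [measurable_cong]: "sets \<nu> = sets borel" by (simp add: \<nu>_def)
  define u where "u = (\<lambda>i x. inverse (w - z i + of_real (\<sigma> i) * x))"
  interpret I: indep_perturbation \<nu> u
  proof
    show "u i \<in> borel_measurable \<nu>" for i unfolding u_def by measurable
  qed
  have X1 [measurable]: "X 1 \<in> borel_measurable M"
    by (rule X_measurable) (rule order_refl)
  have "distr \<nu> borel uminus = distr M borel (uminus \<circ> X 1)"
    unfolding \<nu>_def by (intro distr_distr) measurable
  also have "\<dots> = \<nu>"
    unfolding \<nu>_def comp_def by (rule symmetric[symmetric])
  finally have "distr \<nu> borel uminus = \<nu>" .
  moreover have "\<not> (AE x in \<nu>. x = 0)"
    unfolding \<nu>_def using nonzero by (subst AE_distr_iff[OF X1]) simp_all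
  ultimately have "I.spread_out k"
    unfolding u_def
    by (intro spread_out_inverse \<nu>.prob_space_axioms \<open>sets \<nu> = _\<close> \<sigma>_pos \<sigma>_lim assms(1))
  from I.coeff_gen_poly_anticoncentration[OF this assms(2)] obtain r N where rN: "r > 0"
    "\<And>n. n \<ge> N \<Longrightarrow> emeasure (I.prod_law {1..n}) {x \<in> space (I.prod_law {1..n}).
       cmod (coeff (I.gen_poly {1..n} x) k) < r} \<le> ennreal \<delta>" by blast
  show ?thesis
  proof (rule that[OF \<open>r > 0\<close>])
    \<comment> \<open>The 1 makes the index set nonempty, as the description of independence by a
      product law demands.\<close>
    fix n assume n: "n \<ge> max 1 N"
    have law: "I.prod_law {1..n} = distr M (PiM {1..n} (\<lambda>_. borel)) (\<lambda>\<omega>. \<lambda>i\<in>{1..n}. X i \<omega>)"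
      unfolding \<nu>_def using distr_X_PiM[of n] n by simp
    have [measurable]: "(\<lambda>x. coeff (I.gen_poly {1..n} x) k) \<in> borel_measurable (PiM {1..n} (\<lambda>_. borel))"
    proof -
      have "(\<lambda>x. coeff (I.gen_poly {1..n} x) k) \<in> borel_measurable (I.prod_law {1..n})"
        by simp
      then show ?thesis unfolding law by simp
    qed
    have [measurable]: "(\<lambda>\<omega>. \<lambda>i\<in>{1..n}. X i \<omega>) \<in> M \<rightarrow>\<^sub>M PiM {1..n} (\<lambda>_. borel)"
      by (intro measurable_restrict X_measurable) auto
    have ratio: "coeff (I.gen_poly {1..n} (\<lambda>i\<in>{1..n}. X i \<omega>)) k = deriv_ratio (\<lambda>i. zero_at i \<omega>) k n w" for \<omega>
    proof -
      have "I.gen_poly {1..n} (\<lambda>i\<in>{1..n}. X i \<omega>) = (\<Prod>i=1..n. [:1, inverse (w - zero_at i \<omega>):])"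
        unfolding I.gen_poly_def
        by (intro prod.cong refl) (simp add: u_def zero_at_def)
      then show ?thesis unfolding deriv_ratio_def by simp
    qed
    let ?A = "{x \<in> space (PiM {1..n} (\<lambda>_. borel)). cmod (coeff (I.gen_poly {1..n} x) k) < r}"
    have "emeasure (I.prod_law {1..n}) {x \<in> space (I.prod_law {1..n}).
       cmod (coeff (I.gen_poly {1..n} x) k) < r} =
       emeasure M ((\<lambda>\<omega>. \<lambda>i\<in>{1..n}. X i \<omega>) -` ?A \<inter> space M)"
      unfolding law space_distr by (rule emeasure_distr) measurable
    also have "(\<lambda>\<omega>. \<lambda>i\<in>{1..n}. X i \<omega>) -` ?A \<inter> space M = {\<omega> \<in> space M. cmod (deriv_ratio (\<lambda>i. zero_at i \<omega>) k n w) < r}"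
      unfolding space_PiM by (auto simp only: vimage_def ratio space_borel restrict_PiE_iff restrict_apply if_False)
    finally show "emeasure M {\<omega> \<in> space M. cmod (deriv_ratio (\<lambda>i. zero_at i \<omega>) k n w) < r} \<le> ennreal \<delta>"
      using rN(2)[of n] n by simp
  qed
qed

end

subsection \<open>Logarithmic kernels\<close>

lemma cball_in_sets_borel [measurable]: "cball (a :: 'a::metric_space) r \<in> sets borel"
  by simp

text \<open>Parameter space of circles. A measure on the whole line, rather than an integral over a
  set, lets circle means enter Fubini's theorem together with \<open>lborel\<close>.\<close>

definition unit_interval :: "real measure" where
  "unit_interval = density lborel (\<lambda>x. ennreal (indicator {0..1} x))"

lemma space_unit_interval [simp]: "space unit_interval = UNIV"
  by (simp add: unit_interval_def)

lemma sets_unit_interval [simp, measurable_cong]: "sets unit_interval = sets borel"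
  by (simp add: unit_interval_def)

interpretation unit_interval: prob_space unit_interval
  by standard (simp add: unit_interval_def emeasure_density ennreal_indicator)

lemma integral_unit_interval:
  fixes f :: "real \<Rightarrow> real"
  assumes "continuous_on UNIV f"
  shows "(LINT x|unit_interval. f x) = integral {0..1} f"
proof -
  have [measurable]: "f \<in> borel_measurable borel"
    using assms by (rule borel_measurable_continuous_onI)
  have "(LINT x|unit_interval. f x) = (LINT x:{0..1}|lborel. f x)"
    unfolding unit_interval_def set_lebesgue_integral_def by (rule integral_density) auto
  also have "\<dots> = integral {0..1} f"
    using assms continuous_on_subset
    by (intro set_borel_integral_eq_integral borel_integrable_atLeastAtMost') blast
  finally show ?thesis .
qed

section \<open>Circle means and local integrability of the logarithm\<close>

text \<open>Mean value property: on the closed disc \<open>1 + b * w\<close> has positive real part,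
  so the principal logarithm is holomorphic there, and Cauchy's formula returns its value
  \<open>Ln 1 = 0\<close> at the centre.\<close>

lemma circle_mean_ln_norm_one_plus:
  assumes "cmod b * r < 1" "r > 0"
  shows "((\<lambda>x. ln (cmod (1 + b * (of_real r * cis (2 * pi * x))))) has_integral 0) {0..1}"
proof -
  have pos: "Re (1 + b * w) > 0" if "w \<in> cball 0 r" for w
  proof -
    have "\<bar>Re (b * w)\<bar> \<le> cmod b * cmod w"
      using abs_Re_le_cmod[of "b * w"] by (simp add: norm_mult)
    also have "\<dots> \<le> cmod b * r" using that by (intro mult_left_mono) auto
    finally show ?thesis using assms by simp
  qed
  have nonpos: "1 + b * w \<notin> \<real>\<^sub>\<le>\<^sub>0" if "w \<in> cball 0 r" for w
    using pos[OF that] by (auto simp: complex_nonpos_Reals_iff)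
  have "(\<lambda>w. Ln (1 + b * w)) holomorphic_on cball 0 r"
    by (intro holomorphic_intros nonpos)
  have cancel: "inverse c * (c * v) = v" if "c \<noteq> 0" for c v :: complex
    using that by (simp add: mult.assoc[symmetric])
  have pi_i: "2 * of_real pi * \<i> \<noteq> (0 :: complex)" by simp
  from \<open>_ holomorphic_on _\<close> have "((\<lambda>w. Ln (1 + b * w) / (w - 0)) has_contour_integral (2 * of_real pi * \<i> * Ln (1 + b * 0))) (circlepath 0 r)"
    using assms by (intro Cauchy_integral_circlepath_simple) auto
  then have "((\<lambda>x. Ln (1 + b * circlepath 0 r x) / circlepath 0 r x * vector_derivative (circlepath 0 r) (at x))
      has_integral 0) {0..1}"
    by (simp add: has_contour_integral)
  also have "(\<lambda>x. Ln (1 + b * circlepath 0 r x) / circlepath 0 r x * vector_derivative (circlepath 0 r) (at x))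
     = (\<lambda>x. 2 * of_real pi * \<i> * Ln (1 + b * (of_real r * cis (2 * pi * x))))"
    using assms by (intro ext) (simp add: vector_derivative_circlepath, simp add: circlepath cis_conv_exp mult_ac)
  finally have "((\<lambda>x. inverse (2 * of_real pi * \<i>) * (2 * of_real pi * \<i> * Ln (1 + b * (of_real r * cis (2 * pi * x)))))
      has_integral (inverse (2 * of_real pi * \<i>) * 0)) {0..1}"
    by (rule has_integral_mult_right)
  then have "((\<lambda>x. Ln (1 + b * (of_real r * cis (2 * pi * x)))) has_integral 0) {0..1}"
    unfolding cancel[OF pi_i] mult_zero_right .
  from has_integral_Re[OF this]
  have "((\<lambda>x. Re (Ln (1 + b * (of_real r * cis (2 * pi * x))))) has_integral 0) {0..1}"
    by (simp only: zero_complex.sel)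
  moreover have "Re (Ln (1 + b * (of_real r * cis (2 * pi * x)))) = ln (cmod (1 + b * (of_real r * cis (2 * pi * x))))" for x
  proof (rule Re_Ln)
    show "1 + b * (of_real r * cis (2 * pi * x)) \<noteq> 0"
    proof -
      have "Re (1 + b * (of_real r * cis (2 * pi * x))) > 0"
        by (rule pos) (use assms in \<open>simp add: norm_mult\<close>)
      then show ?thesis by (intro notI) (simp only: zero_complex.sel less_irrefl)
    qed
  qed
  ultimately show ?thesis by simp
qed

text \<open>Jensen's formula for a single zero. The circle through the zero is excluded; later it
  only affects a null set of centres.\<close>

lemma circle_mean_ln_norm:
  assumes "r > 0" "cmod a \<noteq> r"
  shows "(LINT x|unit_interval. ln (cmod (a + of_real r * cis (2 * pi * x)))) = ln (max (cmod a) r)"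
proof -
  have nz: "a + of_real r * cis (2 * pi * x) \<noteq> 0" for x
  proof
    assume "a + of_real r * cis (2 * pi * x) = 0"
    then have "a = - (of_real r * cis (2 * pi * x))" by (simp add: eq_neg_iff_add_eq_0)
    then have "cmod a = r" using assms by (simp add: norm_mult)
    with assms show False by simp
  qed
  have "((\<lambda>x. ln (cmod (a + of_real r * cis (2 * pi * x)))) has_integral ln (max (cmod a) r)) {0..1}"
  proof (cases "r < cmod a")
    case True
    then have a: "a \<noteq> 0" using assms by auto
    have "((\<lambda>x. ln (cmod a) + ln (cmod (1 + inverse a * (of_real r * cis (2 * pi * x))))) has_integral (1 - 0) *\<^sub>R ln (cmod a) + 0) {0..1}"
      using True assms a has_integral_const_real[of "ln (cmod a)" 0 1]
      by (intro has_integral_add circle_mean_ln_norm_one_plus) (auto simp: norm_inverse inverse_eq_divide[of "cmod a"])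
    moreover have "ln (cmod a) + ln (cmod (1 + inverse a * (of_real r * cis (2 * pi * x)))) =
        ln (cmod (a + of_real r * cis (2 * pi * x)))" for x
    proof -
      have eq: "a + of_real r * cis (2 * pi * x) = a * (1 + inverse a * (of_real r * cis (2 * pi * x)))"
        using a by (simp add: field_simps)
      show ?thesis
        using nz[of x] unfolding eq norm_mult by (subst ln_mult) auto
    qed
    ultimately show ?thesis using True by simp
  next
    case False
    \<comment> \<open>Reflection in the circle: if e has modulus 1, then
      \<open>r * (1 + b * r * e) = e * cnj (a + r * e)\<close>. The modulus is kept and the zero, if
      there is one, moves outside the disc.\<close>
    define b where "b = cnj a / of_real (r\<^sup>2)"
    have lt: "cmod a < r" using False assms by simp
    have "((\<lambda>x. ln r + ln (cmod (1 + b * (of_real r * cis (2 * pi * x))))) has_integral (1 - 0) *\<^sub>R ln r + 0) {0..1}"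
      using lt assms has_integral_const_real[of "ln r" 0 1]
      by (intro has_integral_add circle_mean_ln_norm_one_plus)
         (auto simp: b_def norm_divide norm_mult field_simps power2_eq_square)
    moreover have "ln r + ln (cmod (1 + b * (of_real r * cis (2 * pi * x)))) =
        ln (cmod (a + of_real r * cis (2 * pi * x)))" for x
    proof -
      define e where "e = cis (2 * pi * x)"
      have e: "cnj e * e = 1" by (simp add: e_def cis_cnj cis_mult)
      have "of_real r * (1 + b * (of_real r * e)) = e * cnj (a + of_real r * e)"
        using assms e by (simp add: b_def field_simps power2_eq_square)
      then have "cmod (of_real r * (1 + b * (of_real r * e))) = cmod (a + of_real r * e)"
        by (simp only: norm_mult complex_mod_cnj) (simp add: e_def)
      then have "r * cmod (1 + b * (of_real r * e)) = cmod (a + of_real r * e)"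
        using assms by (simp add: norm_mult)
      moreover have "cmod (a + of_real r * e) > 0" using nz[of x] by (simp add: e_def)
      ultimately show ?thesis
        using assms unfolding e_def[symmetric] by (metis ln_mult_pos zero_less_mult_pos)
    qed
    ultimately show ?thesis using lt by (simp add: max_def)
  qed
  then show ?thesis
    by (subst integral_unit_interval) (auto intro!: continuous_intros simp: nz dest: integral_unique)
qed

text \<open>Dyadic discs: for \<open>(1/2)^(j+1) < \<bar>w - a\<bar> \<le> (1/2)^j\<close> the
  integrand is at most \<open>2^(j+1)\<close>, while the disc of radius \<open>(1/2)^j\<close> has
  area proportional to \<open>(1/4)^j\<close>, so the series is geometric. A bound independent of
  \<open>a\<close> is what controls averages over unknown zeros.\<close>

lemma nn_integral_inverse_norm_cball:
  "\<exists>C\<ge>0. \<forall>a :: complex. (\<integral>\<^sup>+w\<in>cball a 1. ennreal (inverse (cmod (w - a))) \<partial>lborel) \<le> ennreal C"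
proof -
  let ?v = "unit_ball_vol 2"
  have "(\<integral>\<^sup>+w\<in>cball a 1. ennreal (inverse (cmod (w - a))) \<partial>lborel) \<le> ennreal (4 * ?v)" for a :: complex
  proof -
    have "ennreal (inverse (cmod (w - a))) * indicator (cball a 1) w \<le>
      (\<Sum>j. ennreal (2 ^ Suc j) * indicator (cball a ((1/2) ^ j)) w)" for w
    proof (cases "w = a \<or> w \<notin> cball a 1")
      case False
      then have w: "cmod (w - a) \<le> 1" "cmod (w - a) > 0" by (auto simp: dist_norm norm_minus_commute)
      obtain k where k: "(1/2) ^ k < cmod (w - a)"
        using real_arch_pow_inv[of "cmod (w - a)" "1/2"] w by auto
      define m where "m = (LEAST k. (1/2) ^ k < cmod (w - a))"
      have m: "(1/2) ^ m < cmod (w - a)" unfolding m_def using k by (rule LeastI)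
      with w have "m \<noteq> 0" by (intro notI) auto
      then obtain j where j: "m = Suc j" by (cases m) auto
      then have "\<not> (1/2) ^ j < cmod (w - a)"
        using not_less_Least[of j "\<lambda>k. (1/2) ^ k < cmod (w - a)"] by (auto simp: m_def)
      then have w': "w \<in> cball a ((1/2) ^ j)" by (auto simp: dist_norm norm_minus_commute)
      have "inverse (cmod (w - a)) \<le> inverse ((1/2) ^ m)"
        using m by (intro le_imp_inverse_le) auto
      then have "inverse (cmod (w - a)) \<le> 2 ^ Suc j"
        by (simp add: j power_one_over)
      then have "ennreal (inverse (cmod (w - a))) * indicator (cball a 1) w \<le> ennreal (2 ^ Suc j)"
        using w by (auto intro!: ennreal_leI simp: indicator_def simp del: power_Suc)
      also have "\<dots> = (\<Sum>i\<in>{j}. ennreal (2 ^ Suc i) * indicator (cball a ((1/2) ^ i)) w)"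
        using w' by simp
      also have "\<dots> \<le> (\<Sum>j. ennreal (2 ^ Suc j) * indicator (cball a ((1/2) ^ j)) w)"
        by (intro sum_le_suminf) auto
      finally show ?thesis .
    qed auto
    then have "(\<integral>\<^sup>+w\<in>cball a 1. ennreal (inverse (cmod (w - a))) \<partial>lborel) \<le>
       (\<integral>\<^sup>+w. (\<Sum>j. ennreal (2 ^ Suc j) * indicator (cball a ((1/2) ^ j)) w) \<partial>lborel)"
      by (intro nn_integral_mono)
    also have "\<dots> = (\<Sum>j. \<integral>\<^sup>+w. ennreal (2 ^ Suc j) * indicator (cball a ((1/2) ^ j)) w \<partial>lborel)"
      by (intro nn_integral_suminf borel_measurable_times_ennreal borel_measurable_const
        borel_measurable_indicator) simp
    also have "\<dots> = (\<Sum>j. ennreal (2 * ?v * (1/2) ^ j))"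
    proof (intro suminf_cong)
      fix j
      have "(\<integral>\<^sup>+w. ennreal (2 ^ Suc j) * indicator (cball a ((1/2) ^ j)) w \<partial>lborel) =
         ennreal (2 ^ Suc j) * ennreal (?v * ((1/2) ^ j)\<^sup>2)"
        by (subst nn_integral_cmult_indicator) (auto simp: emeasure_cball)
      also have "\<dots> = ennreal (2 ^ Suc j * (?v * ((1/2) ^ j)\<^sup>2))"
        by (rule ennreal_mult[symmetric]) auto
      also have "2 ^ Suc j * (?v * ((1/2) ^ j)\<^sup>2) = 2 * ?v * (1/2) ^ j"
        by (simp add: power2_eq_square field_simps)
      finally show "(\<integral>\<^sup>+w. ennreal (2 ^ Suc j) * indicator (cball a ((1/2) ^ j)) w \<partial>lborel) = ennreal (2 * ?v * (1/2) ^ j)" .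
    qed
    also have "\<dots> = ennreal (\<Sum>j. 2 * ?v * (1/2) ^ j)"
      by (intro suminf_ennreal2) (auto intro!: summable_mult summable_geometric)
    also have "(\<Sum>j. 2 * ?v * (1/2) ^ j) = 4 * ?v"
      by (subst suminf_mult) (auto simp: suminf_geometric intro!: summable_geometric)
    finally show ?thesis .
  qed
  then show ?thesis by (intro exI[of _ "4 * ?v"]) auto
qed

text \<open>This is \<open>x - K \<le> exp (x - K)\<close> at \<open>x = - ln (cmod v)\<close>. A
  large \<open>K\<close> makes the unbounded part small in mean, equally for all translates: uniform
  integrability of the logarithmic singularity. At \<open>v = 0\<close> the convention
  \<open>ln 0 = 0\<close> applies.\<close>

lemma neg_ln_norm_le:
  "max 0 (- ln (cmod v)) \<le> K + exp (- K) * (inverse (cmod v) * indicator (cball 0 1) v)" if "K \<ge> 0"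
proof (cases "v = 0 \<or> cmod v > 1")
  case False
  then have v: "cmod v > 0" "cmod v \<le> 1" by auto
  have "- ln (cmod v) - K \<le> exp (- ln (cmod v) - K)"
    using exp_ge_add_one_self[of "- ln (cmod v) - K"] by linarith
  also have "\<dots> = exp (- K) * inverse (cmod v)"
    using v by (simp add: exp_diff exp_minus field_simps)
  finally show ?thesis using v that by (auto simp: indicator_def)
next
  case True
  then have "max 0 (- ln (cmod v)) = 0"
    using ln_ge_zero[of "cmod v"] by auto
  then show ?thesis using that by (simp add: add_nonneg_nonneg)
qed

lemma nn_integral_abs_ln_norm_finite:
  "(\<integral>\<^sup>+w\<in>cball 0 R. ennreal \<bar>ln (cmod (w - a))\<bar> \<partial>lborel) < \<infinity>"
proof -
  obtain C where C: "C \<ge> 0" "\<And>a :: complex. (\<integral>\<^sup>+w\<in>cball a 1. ennreal (inverse (cmod (w - a))) \<partial>lborel) \<le> ennreal C"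
    using nn_integral_inverse_norm_cball by blast
  have "(\<integral>\<^sup>+w\<in>cball 0 R. ennreal \<bar>ln (cmod (w - a))\<bar> \<partial>lborel) \<le>
    (\<integral>\<^sup>+w. ennreal (inverse (cmod (w - a))) * indicator (cball a 1) w + ennreal (\<bar>R\<bar> + cmod a) * indicator (cball 0 R) w \<partial>lborel)"
  proof (intro nn_integral_mono)
    fix w
    show "ennreal \<bar>ln (cmod (w - a))\<bar> * indicator (cball 0 R) w \<le>
       ennreal (inverse (cmod (w - a))) * indicator (cball a 1) w + ennreal (\<bar>R\<bar> + cmod a) * indicator (cball 0 R) w"
    proof (cases "w \<in> cball 0 R")
      case True
      show ?thesis
      proof (cases "cmod (w - a) \<le> 1")
        case le: True
        then have "\<bar>ln (cmod (w - a))\<bar> \<le> inverse (cmod (w - a))"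
          using neg_ln_norm_le[of 0 "w - a"] by (cases "w = a") (auto simp: indicator_def abs_real_def)
        then have "ennreal \<bar>ln (cmod (w - a))\<bar> \<le> ennreal (inverse (cmod (w - a)))"
          by (rule ennreal_leI)
        then show ?thesis using le True
          by (simp add: dist_norm norm_minus_commute add_increasing2)
      next
        case False
        then have "\<bar>ln (cmod (w - a))\<bar> \<le> cmod (w - a)"
          using ln_le_minus_one[of "cmod (w - a)"] ln_ge_zero[of "cmod (w - a)"] by linarith
        also have "\<dots> \<le> \<bar>R\<bar> + cmod a"
          using True norm_triangle_ineq4[of w a] by auto
        finally have "ennreal \<bar>ln (cmod (w - a))\<bar> \<le> ennreal (\<bar>R\<bar> + cmod a)"
          by (rule ennreal_leI)
        then show ?thesis using True by (simp add: add_increasing)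
      qed
    qed auto
  qed
  also have "\<dots> \<le> ennreal C + ennreal (\<bar>R\<bar> + cmod a) * emeasure lborel (cball (0 :: complex) R)"
    by (subst nn_integral_add) (auto intro!: add_mono C simp: nn_integral_cmult_indicator)
  also have "\<dots> < \<infinity>"
    using emeasure_lborel_cball_finite[of "0 :: complex" R]
    by (auto simp: ennreal_mult_less_top ennreal_mult_eq_top_iff ennreal_add_eq_top less_top[symmetric])
  finally show ?thesis .
qed


section \<open>Approximation of test functions by logarithmic potentials\<close>

definition circle_average :: "(complex \<Rightarrow> real) \<Rightarrow> real \<Rightarrow> complex \<Rightarrow> real" where
  "circle_average f r w = (LINT x|unit_interval. f (w - of_real r * cis (2 * pi * x)))"

lemma nn_integral_lborel_shift:
  fixes f :: "'a::euclidean_space \<Rightarrow> ennreal"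
  assumes [measurable]: "f \<in> borel_measurable borel"
  shows "(\<integral>\<^sup>+w. f (w + c) \<partial>lborel) = (\<integral>\<^sup>+w. f w \<partial>lborel)"
proof -
  have "(\<integral>\<^sup>+w. f w \<partial>lborel) = (\<integral>\<^sup>+w. f w \<partial>distr lborel borel (\<lambda>x. c + x))"
    by (simp add: lborel_distr_plus)
  also have "\<dots> = (\<integral>\<^sup>+w. f (c + w) \<partial>lborel)"
    by (rule nn_integral_distr) auto
  finally show ?thesis by (simp add: add.commute)
qed

lemma integral_lborel_shift:
  fixes f :: "'a::euclidean_space \<Rightarrow> real"
  assumes [measurable]: "f \<in> borel_measurable borel"
  shows "(LINT w|lborel. f (w + c)) = (LINT w|lborel. f w)"
proof -
  have "(LINT w|lborel. f w) = (LINT w|distr lborel borel (\<lambda>x. c + x). f w)"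
    by (simp add: lborel_distr_plus)
  also have "\<dots> = (LINT w|lborel. f (c + w))"
    by (rule integral_distr) auto
  finally show ?thesis by (simp add: add.commute)
qed

lemma nn_integral_bounded_support_mult_le:
  fixes f g :: "complex \<Rightarrow> real"
  assumes [measurable]: "g \<in> borel_measurable borel"
    and B: "\<And>w. \<bar>f w\<bar> \<le> B" and supp: "\<And>w. w \<notin> cball 0 R \<Longrightarrow> f w = 0"
  shows "(\<integral>\<^sup>+w. ennreal (norm (f w * g w)) \<partial>lborel) \<le>
    ennreal B * (\<integral>\<^sup>+w\<in>cball 0 R. ennreal \<bar>g w\<bar> \<partial>lborel)"
proof -
  have B0: "B \<ge> 0" using B[of 0] by linarith
  have "(\<integral>\<^sup>+w. ennreal (norm (f w * g w)) \<partial>lborel) \<le>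
      (\<integral>\<^sup>+w. ennreal B * (ennreal \<bar>g w\<bar> * indicator (cball 0 R) w) \<partial>lborel)"
  proof (intro nn_integral_mono)
    fix w
    show "ennreal (norm (f w * g w)) \<le> ennreal B * (ennreal \<bar>g w\<bar> * indicator (cball 0 R) w)"
    proof (cases "w \<in> cball 0 R")
      case True
      have "ennreal (norm (f w * g w)) \<le> ennreal (B * \<bar>g w\<bar>)"
        using B[of w] by (intro ennreal_leI) (simp add: abs_mult mult_right_mono)
      then show ?thesis using True B0 by (simp add: ennreal_mult)
    qed (use supp in simp)
  qed
  also have "\<dots> = ennreal B * (\<integral>\<^sup>+w\<in>cball 0 R. ennreal \<bar>g w\<bar> \<partial>lborel)"
    by (rule nn_integral_cmult) measurable
  finally show ?thesis .
qed

lemma integrable_bounded_support_mult: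
  fixes f g :: "complex \<Rightarrow> real"
  assumes [measurable]: "f \<in> borel_measurable borel" "g \<in> borel_measurable borel"
    and B: "\<And>w. \<bar>f w\<bar> \<le> B" and supp: "\<And>w. w \<notin> cball 0 R \<Longrightarrow> f w = 0"
    and g: "(\<integral>\<^sup>+w\<in>cball 0 R. ennreal \<bar>g w\<bar> \<partial>lborel) < \<infinity>"
  shows "integrable lborel (\<lambda>w. f w * g w)"
proof (rule integrableI_bounded)
  have "(\<integral>\<^sup>+w. ennreal (norm (f w * g w)) \<partial>lborel) \<le>
      ennreal B * (\<integral>\<^sup>+w\<in>cball 0 R. ennreal \<bar>g w\<bar> \<partial>lborel)"
    by (rule nn_integral_bounded_support_mult_le) (use B supp in auto)
  also have "\<dots> < \<infinity>" using g by (simp add: ennreal_mult_less_top)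
  finally show "(\<integral>\<^sup>+w. ennreal (norm (f w * g w)) \<partial>lborel) < \<infinity>" .
qed measurable

text \<open>Fubini and a translation move the averaging from \<open>f\<close> to \<open>g\<close>.
  The two integrability facts serve the exchange of integrals before and after the
  translation.\<close>

lemma integral_circle_average:
  fixes f g :: "complex \<Rightarrow> real"
  assumes [measurable]: "f \<in> borel_measurable borel" "g \<in> borel_measurable borel"
    and B: "\<And>w. \<bar>f w\<bar> \<le> B" and supp: "\<And>w. w \<notin> cball 0 R \<Longrightarrow> f w = 0"
    and g: "\<And>S. (\<integral>\<^sup>+w\<in>cball 0 S. ennreal \<bar>g w\<bar> \<partial>lborel) < \<infinity>"
    and r: "r > 0"
  shows "(LINT w|lborel. circle_average f r w * g w) =
    (LINT c|lborel. f c * (LINT x|unit_interval. g (c + of_real r * cis (2 * pi * x))))"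
proof -
  define e where "e x = of_real r * cis (2 * pi * x)" for x
  have [measurable]: "e \<in> borel_measurable borel"
    unfolding e_def by (intro borel_measurable_continuous_onI continuous_intros)
  have norm_e: "cmod (e x) = r" for x using r by (simp add: e_def norm_mult)
  interpret P: pair_sigma_finite unit_interval "lborel :: complex measure" ..
  define G where "G = (\<integral>\<^sup>+w. ennreal \<bar>g w\<bar> * indicator (cball 0 (R + r)) w \<partial>lborel)"
  have G: "ennreal B * G < \<infinity>"
    using g[of "R + r"] by (auto simp: G_def ennreal_mult_less_top)
  have bound: "(\<integral>\<^sup>+w. ennreal (norm (f (w - e x) * g w)) \<partial>lborel) \<le> ennreal B * G" for x
    unfolding G_def
  proof (rule nn_integral_bounded_support_mult_le)
    fix w :: complex assume "w \<notin> cball 0 (R + r)"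
    then show "f (w - e x) = 0"
      using norm_triangle_ineq2[of w "e x"] norm_e[of x] by (intro supp) auto
  qed (use B in auto)
  have int1: "integrable (unit_interval \<Otimes>\<^sub>M lborel) (\<lambda>(x, w). f (w - e x) * g w)"
  proof (rule integrableI_bounded)
    have "(\<integral>\<^sup>+p. ennreal (norm (case p of (x, w) \<Rightarrow> f (w - e x) * g w)) \<partial>(unit_interval \<Otimes>\<^sub>M lborel)) =
       (\<integral>\<^sup>+x. (\<integral>\<^sup>+w. ennreal (norm (f (w - e x) * g w)) \<partial>lborel) \<partial>unit_interval)"
      by (subst lborel.nn_integral_fst[symmetric]) auto
    also have "\<dots> \<le> (\<integral>\<^sup>+x. ennreal B * G \<partial>unit_interval)"
      by (intro nn_integral_mono bound)
    also have "\<dots> < \<infinity>" using G by (simp add: unit_interval.emeasure_space_1[simplified])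
    finally show "(\<integral>\<^sup>+p. ennreal (norm (case p of (x, w) \<Rightarrow> f (w - e x) * g w)) \<partial>(unit_interval \<Otimes>\<^sub>M lborel)) < \<infinity>" .
  qed measurable
  have int2: "integrable (unit_interval \<Otimes>\<^sub>M lborel) (\<lambda>(x, c). f c * g (c + e x))"
  proof (rule integrableI_bounded)
    have "(\<integral>\<^sup>+p. ennreal (norm (case p of (x, c) \<Rightarrow> f c * g (c + e x))) \<partial>(unit_interval \<Otimes>\<^sub>M lborel)) =
       (\<integral>\<^sup>+x. (\<integral>\<^sup>+c. ennreal (norm (f c * g (c + e x))) \<partial>lborel) \<partial>unit_interval)"
      by (subst lborel.nn_integral_fst[symmetric]) auto
    also have "\<dots> \<le> (\<integral>\<^sup>+x. ennreal B * G \<partial>unit_interval)"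
    proof (intro nn_integral_mono)
      fix x
      have "(\<integral>\<^sup>+c. ennreal (norm (f c * g (c + e x))) \<partial>lborel) =
         (\<integral>\<^sup>+c. (\<lambda>w. ennreal (norm (f (w - e x) * g w))) (c + e x) \<partial>lborel)"
        by simp
      also have "\<dots> = (\<integral>\<^sup>+w. ennreal (norm (f (w - e x) * g w)) \<partial>lborel)"
        by (rule nn_integral_lborel_shift) measurable
      finally show "(\<integral>\<^sup>+c. ennreal (norm (f c * g (c + e x))) \<partial>lborel) \<le> ennreal B * G"
        using bound[of x] by simp
    qed
    also have "\<dots> < \<infinity>" using G by (simp add: unit_interval.emeasure_space_1[simplified])
    finally show "(\<integral>\<^sup>+p. ennreal (norm (case p of (x, c) \<Rightarrow> f c * g (c + e x))) \<partial>(unit_interval \<Otimes>\<^sub>M lborel)) < \<infinity>" .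
  qed measurable
  have "(LINT w|lborel. circle_average f r w * g w) = (LINT w|lborel. (LINT x|unit_interval. f (w - e x) * g w))"
    by (simp add: circle_average_def e_def)
  also have "\<dots> = (LINT x|unit_interval. (LINT w|lborel. f (w - e x) * g w))"
    using int1 by (rule P.Fubini_integral[of "\<lambda>x w. f (w - e x) * g w"])
  also have "\<dots> = (LINT x|unit_interval. (LINT c|lborel. f c * g (c + e x)))"
  proof (rule Bochner_Integration.integral_cong[OF refl])
    fix x
    have "(LINT c|lborel. (\<lambda>w. f (w - e x) * g w) (c + e x)) = (LINT w|lborel. f (w - e x) * g w)"
      by (rule integral_lborel_shift) measurable
    then show "(LINT w|lborel. f (w - e x) * g w) = (LINT c|lborel. f c * g (c + e x))"
      by simp
  qed
  also have "\<dots> = (LINT c|lborel. (LINT x|unit_interval. f c * g (c + e x)))"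
    using int2 by (rule P.Fubini_integral[of "\<lambda>x c. f c * g (c + e x)", symmetric])
  finally show ?thesis by (simp add: e_def)
qed

lemma circle_average_measurable [measurable]:
  assumes [measurable]: "f \<in> borel_measurable borel"
  shows "circle_average f r \<in> borel_measurable borel"
proof -
  define e where "e x = of_real r * cis (2 * pi * x)" for x
  have [measurable]: "e \<in> borel_measurable borel"
    unfolding e_def by (intro borel_measurable_continuous_onI continuous_intros)
  show ?thesis unfolding circle_average_def e_def[symmetric] by measurable
qed


lemma integrable_continuous_support:
  fixes f :: "'a::euclidean_space \<Rightarrow> real"
  assumes "continuous_on UNIV f" and supp: "\<And>w. w \<notin> cball 0 R \<Longrightarrow> f w = 0"
  shows "integrable lborel f"
proof -
  have "integrable lborel (\<lambda>w. indicator (cball 0 R) w *\<^sub>R f w)"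
    using continuous_on_subset[OF assms(1)] by (intro borel_integrable_compact) auto
  also have "(\<lambda>w. indicator (cball 0 R) w *\<^sub>R f w) = f"
    by (intro ext) (use supp in \<open>auto simp: indicator_def\<close>)
  finally show ?thesis .
qed

lemma continuous_support_bounded:
  fixes f :: "'a::euclidean_space \<Rightarrow> real"
  assumes cont: "continuous_on UNIV f" and supp: "\<And>w. w \<notin> cball 0 R \<Longrightarrow> f w = 0"
  obtains B where "\<And>w. \<bar>f w\<bar> \<le> B"
proof -
  have "compact (f ` cball 0 R)"
    using cont continuous_on_subset by (intro compact_continuous_image) auto
  then have "bounded (f ` cball 0 R)" by (rule compact_imp_bounded)
  then obtain B0 where B0: "\<forall>y\<in>f ` cball 0 R. norm y \<le> B0"
    unfolding bounded_iff by blast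
  show ?thesis
  proof (rule that)
    fix w
    show "\<bar>f w\<bar> \<le> \<bar>B0\<bar>"
    proof (cases "w \<in> cball 0 R")
      case True
      then have "norm (f w) \<le> B0" using B0 by blast
      then show ?thesis by simp
    qed (use supp in simp)
  qed
qed

lemma continuous_support_uniform:
  fixes f :: "'a::euclidean_space \<Rightarrow> real"
  assumes cont: "continuous_on UNIV f" and supp: "\<And>w. w \<notin> cball 0 R \<Longrightarrow> f w = 0" and \<epsilon>: "\<epsilon> > 0"
  obtains d where "d > 0" "\<And>x y. norm (x - y) \<le> d \<Longrightarrow> \<bar>f x - f y\<bar> \<le> \<epsilon>"
proof -
  have "uniformly_continuous_on (cball 0 (R + 1)) f"
    using cont continuous_on_subset by (intro compact_uniformly_continuous) auto
  then obtain d where d: "d > 0" "\<And>x y. x \<in> cball 0 (R + 1) \<Longrightarrow> y \<in> cball 0 (R + 1) \<Longrightarrow> dist x y < d \<Longrightarrow> dist (f x) (f y) < \<epsilon>"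
    using \<epsilon> unfolding uniformly_continuous_on_def by metis
  show ?thesis
  proof (rule that[of "min d 1 / 2"])
    fix x y :: 'a assume le: "norm (x - y) \<le> min d 1 / 2"
    show "\<bar>f x - f y\<bar> \<le> \<epsilon>"
    proof (cases "x \<in> cball 0 R \<or> y \<in> cball 0 R")
      case True
      then have "x \<in> cball 0 (R + 1)" "y \<in> cball 0 (R + 1)"
        using le norm_triangle_ineq2[of x y] norm_triangle_ineq3[of x y] by auto
      then show ?thesis using d(2)[of x y] le d(1) by (simp add: dist_norm)
    qed (use supp \<epsilon> in simp)
  qed (use d in simp)
qed

lemma abs_circle_average_le:
  assumes "\<And>w. \<bar>f w\<bar> \<le> B"
  shows "\<bar>circle_average f r w\<bar> \<le> B"
proof (cases "integrable unit_interval (\<lambda>x. f (w - of_real r * cis (2 * pi * x)))")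
  case True
  then have "\<bar>circle_average f r w\<bar> \<le> (LINT x|unit_interval. B)"
    unfolding circle_average_def using assms
    by (intro order_trans[OF integral_abs_bound] integral_mono) auto
  then show ?thesis by (simp add: unit_interval.prob_space[simplified])
next
  case False
  then show ?thesis
    using assms[of 0] by (simp add: circle_average_def not_integrable_integral_eq)
qed

lemma circle_average_eq_0:
  assumes supp: "\<And>w. w \<notin> cball 0 R \<Longrightarrow> f w = 0" and "r > 0" "w \<notin> cball 0 (R + r)"
  shows "circle_average f r w = 0"
proof -
  have "f (w - of_real r * cis (2 * pi * x)) = 0" for x
    using norm_triangle_ineq2[of w "of_real r * cis (2 * pi * x)"] assms
    by (intro supp) (auto simp: norm_mult)
  then show ?thesis by (simp add: circle_average_def)
qed

text \<open>Averaging the kernel instead of \<open>f\<close> brings in Jensen's formula; the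
  excluded circle around \<open>a\<close> is a null set of centres.\<close>

lemma integral_circle_average_ln_norm:
  fixes f :: "complex \<Rightarrow> real"
  assumes cont: "continuous_on UNIV f"
    and B: "\<And>w. \<bar>f w\<bar> \<le> B" and supp: "\<And>w. w \<notin> cball 0 R \<Longrightarrow> f w = 0" and r: "r > 0"
  shows "(LINT w|lborel. circle_average f r w * ln (cmod (w - a))) = (LINT c|lborel. f c * ln (max (cmod (c - a)) r))"
proof -
  have [measurable]: "f \<in> borel_measurable borel"
    using cont by (rule borel_measurable_continuous_onI)
  define e where "e x = of_real r * cis (2 * pi * x)" for x
  have [measurable]: "e \<in> borel_measurable borel"
    unfolding e_def by (intro borel_measurable_continuous_onI continuous_intros)
  have "(LINT w|lborel. circle_average f r w * ln (cmod (w - a))) =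
      (LINT c|lborel. f c * (LINT x|unit_interval. ln (cmod (c + e x - a))))"
    unfolding e_def by (rule integral_circle_average[OF _ _ B supp nn_integral_abs_ln_norm_finite r]) measurable
  also have "\<dots> = (LINT c|lborel. f c * ln (max (cmod (c - a)) r))"
  proof (rule integral_cong_AE)
    have "sphere a r \<in> null_sets lborel"
      using negligible_sphere[of a r]
      by (auto simp: null_sets_completion_iff negligible_iff_null_sets)
    then have "AE c in lborel. c \<notin> sphere a r" by (rule AE_not_in)
    then show "AE c in lborel. f c * (LINT x|unit_interval. ln (cmod (c + e x - a))) = f c * ln (max (cmod (c - a)) r)"
    proof eventually_elim
      case (elim c)
      then have "(LINT x|unit_interval. ln (cmod (c - a + e x))) = ln (max (cmod (c - a)) r)"
        unfolding e_def using r by (intro circle_mean_ln_norm) (auto simp: dist_norm norm_minus_commute)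
      then show ?case by (simp add: algebra_simps)
    qed
  qed measurable
  finally show ?thesis .
qed

text \<open>The difference of two concentric circle averages of the logarithmic potential of a point mass
  vanishes when the point is far away, so it is a bump function.\<close>

lemma log_kernel_approx:
  fixes f :: "complex \<Rightarrow> real"
  assumes cont: "continuous_on UNIV f" and supp: "\<And>w. w \<notin> cball 0 R \<Longrightarrow> f w = 0" and \<epsilon>: "\<epsilon> > 0"
  obtains \<psi> B S where "\<psi> \<in> borel_measurable borel" "\<And>w. \<bar>\<psi> w\<bar> \<le> B" "\<And>w. w \<notin> cball 0 S \<Longrightarrow> \<psi> w = 0"
    "(LINT w|lborel. \<psi> w) = 0" "\<And>a. \<bar>f a - (LINT w|lborel. \<psi> w * ln (cmod (w - a)))\<bar> \<le> \<epsilon>"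
proof -
  have [measurable]: "f \<in> borel_measurable borel"
    using cont by (rule borel_measurable_continuous_onI)
  obtain B where B: "\<And>w. \<bar>f w\<bar> \<le> B"
    using continuous_support_bounded[OF cont supp] by blast
  obtain d where d: "d > 0" "\<And>x y. cmod (x - y) \<le> d \<Longrightarrow> \<bar>f x - f y\<bar> \<le> \<epsilon>"
    using continuous_support_uniform[OF cont supp \<epsilon>] by blast
  \<comment> \<open>The kernel built below has support of radius \<open>2 * \<rho> = d\<close>,
    where \<open>f\<close> oscillates by at most \<epsilon>.\<close>
  define \<rho> where "\<rho> = d / 2"
  have \<rho>: "\<rho> > 0" using d by (simp add: \<rho>_def)
  have close: "\<bar>f x - f y\<bar> \<le> \<epsilon>" if "cmod (x - y) \<le> 2 * \<rho>" for x y
    using d that by (simp add: \<rho>_def)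
  \<comment> \<open>By Jensen's formula, the difference of the means of the logarithmic kernel over
    circles of radii \<open>2 * \<rho>\<close> and \<open>\<rho>\<close>: a radial, nonnegative
    bump.\<close>
  define H where "H v = ln (max (cmod v) (2 * \<rho>)) - ln (max (cmod v) \<rho>)" for v
  have H_cont: "continuous_on UNIV H"
    unfolding H_def using \<rho> by (intro continuous_intros) (auto simp: max_def)
  then have [measurable]: "H \<in> borel_measurable borel" by (rule borel_measurable_continuous_onI)
  have H0: "H v = 0" if "v \<notin> cball 0 (2 * \<rho>)" for v
    using that \<rho> by (auto simp: H_def max_def)
  have H_nonneg: "H v \<ge> 0" for v
  proof -
    have "ln (max (cmod v) \<rho>) \<le> ln (max (cmod v) (2 * \<rho>))"
      using \<rho> by (intro ln_mono) auto
    then show ?thesis by (simp add: H_def)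
  qed
  have H_int: "integrable lborel H"
    using H_cont H0 by (rule integrable_continuous_support)
  define I where "I = (LINT v|lborel. H v)"
  have I_shift: "(LINT c|lborel. H (c - a)) = I" for a
    using integral_lborel_shift[of H "- a"] by (simp add: I_def)
  have H_int': "integrable lborel (\<lambda>c. H (c - a))" for a
  proof (rule integrable_continuous_support)
    show "continuous_on UNIV (\<lambda>c. H (c - a))"
      by (intro continuous_on_compose2[OF H_cont] continuous_intros) auto
    show "H (c - a) = 0" if "c \<notin> cball 0 (2 * \<rho> + cmod a)" for c
      using that norm_triangle_ineq2[of c a] by (intro H0) auto
  qed
  \<comment> \<open>The kernel equals \<open>ln 2\<close> on \<open>cball 0 \<rho>\<close>, so its
    mass \<open>I\<close> is positive and may be used for normalisation.\<close>
  have "0 < ln 2 * measure lborel (cball (0::complex) \<rho>)"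
    using \<rho> by (simp add: content_cball)
  also have "\<dots> = (LINT v|lborel. ln 2 * indicator (cball 0 \<rho> :: complex set) v)"
    by simp
  also have "\<dots> \<le> I"
    unfolding I_def
  proof (rule integral_mono)
    show "integrable lborel (\<lambda>v. ln 2 * indicator (cball 0 \<rho> :: complex set) v :: real)"
      using emeasure_lborel_cball_finite[of "0 :: complex" \<rho>]
      by (intro integrable_mult_right integrable_real_indicator) simp_all
    fix v :: complex
    show "ln 2 * indicator (cball 0 \<rho>) v \<le> H v"
    proof (cases "v \<in> cball 0 \<rho>")
      case True
      then have "H v = ln (2 * \<rho>) - ln \<rho>" using \<rho> by (simp add: H_def max_def)
      also have "\<dots> = ln 2" using \<rho> by (simp add: ln_mult)
      finally show ?thesis using True by simp
    qed (use H_nonneg in simp)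
  qed (rule H_int)
  finally have I: "I > 0" .
  \<comment> \<open>Paired with the logarithm this gives the convolution of \<open>f\<close> with
    the probability density \<open>H / I\<close>.\<close>
  define \<psi> where "\<psi> w = (circle_average f (2 * \<rho>) w - circle_average f \<rho> w) / I" for w
  have ca: "integrable lborel (\<lambda>w. circle_average f r w * g w)"
    if [measurable]: "g \<in> borel_measurable borel" and "r > 0"
      and "\<And>S. (\<integral>\<^sup>+w\<in>cball 0 S. ennreal \<bar>g w\<bar> \<partial>lborel) < \<infinity>" for g r
    by (rule integrable_bounded_support_mult[where R = "R + r"])
       (use that in \<open>auto intro!: abs_circle_average_le B circle_average_eq_0 supp\<close>)
  have one: "(\<integral>\<^sup>+w\<in>cball (0 :: complex) S. ennreal \<bar>1\<bar> \<partial>lborel) < \<infinity>" for S :: real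
    using emeasure_lborel_cball_finite[of "0::complex" S] by simp
  show ?thesis
  proof (rule that)
    show "\<psi> \<in> borel_measurable borel" unfolding \<psi>_def by measurable
    show "\<bar>\<psi> w\<bar> \<le> 2 * B / I" for w
      using abs_circle_average_le[of f B "2 * \<rho>" w] abs_circle_average_le[of f B \<rho> w] B I
      by (auto simp: \<psi>_def intro!: divide_right_mono)
    show "\<psi> w = 0" if "w \<notin> cball 0 (R + 2 * \<rho>)" for w
      using that \<rho> circle_average_eq_0[of R f "2 * \<rho>" w] circle_average_eq_0[of R f \<rho> w] supp
      by (auto simp: \<psi>_def)
    \<comment> \<open>Circle averaging preserves the total integral, so the two halves of \<psi>
      cancel.\<close>
    have "(LINT w|lborel. circle_average f r w * 1) = (LINT c|lborel. f c * 1)" if "r > 0" for r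
      by (subst integral_circle_average[OF _ _ B supp one that])
         (auto simp: unit_interval.prob_space[simplified])
    from this[of \<rho>] this[of "2 * \<rho>"] show "(LINT w|lborel. \<psi> w) = 0"
      using ca[of "\<lambda>_. 1" \<rho>] ca[of "\<lambda>_. 1" "2 * \<rho>"] one \<rho> by (simp add: \<psi>_def)
    fix a
    let ?l = "\<lambda>w. ln (cmod (w - a))"
    have [measurable]: "?l \<in> borel_measurable borel" by measurable
    have ca_l: "integrable lborel (\<lambda>w. circle_average f r w * ?l w)" if "r > 0" for r
      using that nn_integral_abs_ln_norm_finite by (intro ca) auto
    have fl: "integrable lborel (\<lambda>c. f c * ln (max (cmod (c - a)) r))" if "r > 0" for r
    proof (rule integrable_continuous_support)
      show "continuous_on UNIV (\<lambda>c. f c * ln (max (cmod (c - a)) r))"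
        using that by (intro continuous_intros cont) (auto simp: max_def)
      show "f c * ln (max (cmod (c - a)) r) = 0" if "c \<notin> cball 0 R" for c
        using supp[OF that] by simp
    qed
    have "(LINT w|lborel. \<psi> w * ?l w) = (LINT w|lborel. (circle_average f (2 * \<rho>) w * ?l w - circle_average f \<rho> w * ?l w) / I)"
      by (simp add: \<psi>_def algebra_simps diff_divide_distrib)
    also have "\<dots> = ((LINT w|lborel. circle_average f (2 * \<rho>) w * ?l w) - (LINT w|lborel. circle_average f \<rho> w * ?l w)) / I"
      using ca_l[of \<rho>] ca_l[of "2 * \<rho>"] \<rho> by simp
    also have "\<dots> = ((LINT c|lborel. f c * ln (max (cmod (c - a)) (2 * \<rho>))) - (LINT c|lborel. f c * ln (max (cmod (c - a)) \<rho>))) / I"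
      using \<rho> integral_circle_average_ln_norm[OF cont B supp] by simp
    also have "\<dots> = (LINT c|lborel. f c * H (c - a)) / I"
      using fl[of \<rho>] fl[of "2 * \<rho>"] \<rho> by (simp add: H_def right_diff_distrib)
    finally have eq: "(LINT w|lborel. \<psi> w * ?l w) = (LINT c|lborel. f c * H (c - a)) / I" .
    have fH: "integrable lborel (\<lambda>c. f c * H (c - a))"
      using fl[of \<rho>] fl[of "2 * \<rho>"] \<rho> by (simp add: H_def right_diff_distrib)
    have "\<bar>(LINT c|lborel. (f a - f c) * H (c - a))\<bar> \<le> (LINT c|lborel. \<epsilon> * H (c - a))"
    proof (intro order_trans[OF integral_abs_bound] integral_mono)
      show "integrable lborel (\<lambda>c. \<bar>(f a - f c) * H (c - a)\<bar>)"
        using fH H_int'[of a] by (simp add: left_diff_distrib)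
      show "integrable lborel (\<lambda>c. \<epsilon> * H (c - a))" using H_int'[of a] by simp
      show "\<bar>(f a - f c) * H (c - a)\<bar> \<le> \<epsilon> * H (c - a)" for c
      proof (cases "c - a \<in> cball 0 (2 * \<rho>)")
        case True
        then have "\<bar>f a - f c\<bar> \<le> \<epsilon>"
          by (intro close) (simp add: norm_minus_commute)
        then show ?thesis using H_nonneg[of "c - a"] by (simp add: abs_mult mult_right_mono)
      qed (use H0 in simp)
    qed
    also have "\<dots> = \<epsilon> * I" using I_shift[of a] by simp
    also have "(LINT c|lborel. (f a - f c) * H (c - a)) = f a * I - (LINT c|lborel. f c * H (c - a))"
      using fH H_int'[of a] I_shift[of a] by (simp add: left_diff_distrib)
    finally have "\<bar>f a * I - (LINT c|lborel. f c * H (c - a))\<bar> / I \<le> \<epsilon> * I / I"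
      using I by (intro divide_right_mono) auto
    moreover have "\<bar>f a * I - (LINT c|lborel. f c * H (c - a))\<bar> / I = \<bar>(f a * I - (LINT c|lborel. f c * H (c - a))) / I\<bar>"
      using I by (simp add: abs_divide)
    ultimately show "\<bar>f a - (LINT w|lborel. \<psi> w * ?l w)\<bar> \<le> \<epsilon>"
      unfolding eq using I by (simp add: diff_divide_distrib)
  qed
qed

subsection \<open>Zeros of derivatives and logarithmic potentials\<close>

lemma pderiv_funpow_pcompose_shift:
  "(pderiv ^^ k) (pcompose p [:w, 1:]) = pcompose ((pderiv ^^ k) p) [:w, 1:]" for p :: "complex poly"
  by (induction k) (simp_all add: pderiv_pcompose pderiv_pCons)

lemma poly_higher_pderiv_eq_coeff_pcompose:
  "poly ((pderiv ^^ k) p) w = fact k * coeff (pcompose p [:w, 1:]) k" for p :: "complex poly"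
proof -
  have "poly ((pderiv ^^ k) p) w = poly (pcompose ((pderiv ^^ k) p) [:w, 1:]) 0"
    by (simp add: poly_pcompose)
  also have "\<dots> = coeff ((pderiv ^^ k) (pcompose p [:w, 1:])) 0"
    by (simp add: pderiv_funpow_pcompose_shift poly_0_coeff_0)
  also have "\<dots> = fact k * coeff (pcompose p [:w, 1:]) k"
    by (simp add: coeff_higher_pderiv pochhammer_fact)
  finally show ?thesis .
qed

text \<open>Expand around \<open>w\<close>: the shifted polynomial in t is \<open>poly p w\<close>
  times the product of the factors \<open>1 + t / (w - \<xi> i)\<close>. The coefficient of degree
  \<open>k\<close> is the Taylor coefficient.\<close>

lemma poly_higher_pderiv_prod_linear:
  fixes \<xi> :: "nat \<Rightarrow> complex" and n :: nat
  defines "p \<equiv> (\<Prod>i=1..n. [:- \<xi> i, 1:])"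
  assumes "poly p w \<noteq> 0"
  shows "poly ((pderiv ^^ k) p) w = fact k * (poly p w * deriv_ratio \<xi> k n w)"
proof -
  have nz: "w - \<xi> i \<noteq> 0" if "i \<in> {1..n}" for i
    using assms that by (auto simp: p_def poly_prod)
  have "pcompose p [:w, 1:] = (\<Prod>i=1..n. [:w - \<xi> i, 1:])"
    unfolding p_def pcompose_prod by (intro prod.cong) (simp_all add: pcompose_pCons)
  also have "\<dots> = (\<Prod>i=1..n. smult (w - \<xi> i) [:1, inverse (w - \<xi> i):])"
    using nz by (intro prod.cong) auto
  also have "\<dots> = smult (\<Prod>i=1..n. w - \<xi> i) (\<Prod>i=1..n. [:1, inverse (w - \<xi> i):])"
    by (rule prod_smult)
  also have "(\<Prod>i=1..n. w - \<xi> i) = poly p w"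
    by (simp add: p_def poly_prod)
  finally show ?thesis
    unfolding poly_higher_pderiv_eq_coeff_pcompose deriv_ratio_def by simp
qed

lemma degree_prod_linear: "degree (\<Prod>i=1..n. [:- \<xi> i, 1:]) = n" for \<xi> :: "nat \<Rightarrow> complex"
  by (subst degree_prod_sum_eq) auto

lemma degree_higher_pderiv: "degree ((pderiv ^^ k) p) = degree p - k" for p :: "complex poly"
  by (induction k) (simp_all add: degree_pderiv)

lemma lead_coeff_higher_pderiv_prod_linear:
  fixes \<xi> :: "nat \<Rightarrow> complex" and n :: nat
  defines "p \<equiv> (\<Prod>i=1..n. [:- \<xi> i, 1:])"
  assumes "k \<le> n"
  shows "lead_coeff ((pderiv ^^ k) p) = fact k * of_nat (n choose k)"
proof -
  have deg: "degree p = n" unfolding p_def by (rule degree_prod_linear)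
  have "lead_coeff p = 1" unfolding p_def by (simp add: lead_coeff_prod)
  then have "coeff p n = 1" by (simp add: deg)
  then have "lead_coeff ((pderiv ^^ k) p) = pochhammer (of_nat (Suc (n - k))) k"
    using assms(2) by (simp add: degree_higher_pderiv deg coeff_higher_pderiv)
  also have "of_nat (Suc (n - k)) = (of_nat n - of_nat k + 1 :: complex)"
    using assms(2) by (simp add: of_nat_diff)
  also have "pochhammer (of_nat n - of_nat k + 1 :: complex) k = fact k * (of_nat n gchoose k)"
    by (simp add: gbinomial_pochhammer')
  finally show ?thesis by (simp add: binomial_gbinomial)
qed

lemma prod_mset_positive: "(\<And>x. x \<in># A \<Longrightarrow> f x > 0) \<Longrightarrow> (\<Prod>x\<in>#A. f x) > (0 :: real)"
  by (induction A) simp_all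

lemma ln_prod_mset:
  "(\<And>x. x \<in># A \<Longrightarrow> f x > 0) \<Longrightarrow> ln (\<Prod>x\<in>#A. f x) = (\<Sum>x\<in>#A. ln (f x :: real))"
proof (induction A)
  case (add x A)
  moreover have "(\<Prod>x\<in>#A. f x) > 0"
    using add.prems by (intro prod_mset_positive) auto
  then have "ln (f x * (\<Prod>x\<in>#A. f x)) = ln (f x) + ln (\<Prod>x\<in>#A. f x)"
    using add.prems by (intro ln_mult_pos) auto
  ultimately show ?case by simp
qed simp

lemma norm_prod_mset: "norm (\<Prod>x\<in>#A. f x) = (\<Prod>x\<in>#A. norm (f x :: complex))"
  by (induction A) (simp_all add: norm_mult)

lemma ln_norm_poly:
  assumes "poly p w \<noteq> 0"
  shows "ln (cmod (poly p w)) = ln (cmod (lead_coeff p)) + (\<Sum>x\<in>#proots p. ln (cmod (w - x)))"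
proof -
  have p: "p \<noteq> 0" using assms by auto
  have "poly p w = poly (smult (lead_coeff p) (\<Prod>x\<in>#proots p. [:-x, 1:])) w"
    by (simp only: complex_poly_decompose_multiset)
  also have "\<dots> = lead_coeff p * (\<Prod>x\<in>#proots p. w - x)"
    by (simp add: poly_prod_mset image_mset.compositionality comp_def)
  finally have eq: "cmod (poly p w) = cmod (lead_coeff p) * (\<Prod>x\<in>#proots p. cmod (w - x))"
    by (simp add: norm_mult norm_prod_mset)
  have pos: "cmod (w - x) > 0" if "x \<in># proots p" for x
    using that assms p by auto
  then have "(\<Prod>x\<in>#proots p. cmod (w - x)) > 0"
    by (intro prod_mset_positive)
  then have "ln (cmod (poly p w)) = ln (cmod (lead_coeff p)) + ln (\<Prod>x\<in>#proots p. cmod (w - x))"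
    unfolding eq using p by (intro ln_mult_pos) auto
  then show ?thesis
    using pos by (simp add: ln_prod_mset)
qed

lemma proots_prod_linear:
  "proots (\<Prod>i=1..n. [:- \<xi> i, 1:]) = image_mset \<xi> (mset_set {1..n})" for \<xi> :: "nat \<Rightarrow> complex"
  by (subst proots_prod) (auto simp: sum_unfold_sum_mset)

text \<open>Two expressions for the modulus of the derivative are compared, one through the ratio
  and one through its zeros and leading coefficient. The factor \<open>fact k\<close> cancels and
  the binomial coefficient remains.\<close>

lemma ln_norm_deriv_ratio:
  fixes \<xi> :: "nat \<Rightarrow> complex" and n :: nat
  defines "p \<equiv> (\<Prod>i=1..n. [:- \<xi> i, 1:])"
  assumes "poly p w \<noteq> 0" "poly ((pderiv ^^ k) p) w \<noteq> 0" "k \<le> n"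
  shows "ln (cmod (deriv_ratio \<xi> k n w)) = ln (real (n choose k)) +
    (\<Sum>x\<in>#proots ((pderiv ^^ k) p). ln (cmod (w - x))) - (\<Sum>i=1..n. ln (cmod (w - \<xi> i)))"
proof -
  have eq: "poly ((pderiv ^^ k) p) w = fact k * (poly p w * deriv_ratio \<xi> k n w)"
    using assms(2) unfolding p_def by (rule poly_higher_pderiv_prod_linear)
  then have nz: "deriv_ratio \<xi> k n w \<noteq> 0" using assms by auto
  have p1: "lead_coeff p = 1" unfolding p_def by (simp add: lead_coeff_prod)
  have "ln (cmod (poly ((pderiv ^^ k) p) w)) = ln (fact k) + (ln (cmod (poly p w)) + ln (cmod (deriv_ratio \<xi> k n w)))"
    unfolding eq using nz assms(2) by (simp add: norm_mult ln_mult)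
  moreover have "ln (cmod (poly ((pderiv ^^ k) p) w)) =
     ln (fact k) + ln (real (n choose k)) + (\<Sum>x\<in>#proots ((pderiv ^^ k) p). ln (cmod (w - x)))"
  proof -
    have "cmod (lead_coeff ((pderiv ^^ k) p)) = fact k * real (n choose k)"
      unfolding p_def lead_coeff_higher_pderiv_prod_linear[OF assms(4)] by (simp add: norm_mult)
    then show ?thesis
      using ln_norm_poly[OF assms(3)] assms(4) by (simp add: ln_mult)
  qed
  moreover have "ln (cmod (poly p w)) = (\<Sum>i=1..n. ln (cmod (w - \<xi> i)))"
    using ln_norm_poly[OF assms(2)] unfolding p1 unfolding p_def proots_prod_linear
    by (simp add: image_mset.compositionality comp_def sum_unfold_sum_mset)
  ultimately show ?thesis by simp
qed

lemma AE_poly_nonzero: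
  assumes "p \<noteq> 0"
  shows "AE w in lborel. poly p (w :: complex) \<noteq> 0"
proof -
  have "finite {w. poly p w = 0}" using assms by (rule poly_roots_finite)
  then have "{w. poly p w = 0} \<in> null_sets lborel" by (rule finite_imp_null_set_lborel)
  then show ?thesis by (auto dest: AE_not_in)
qed

lemma AE_deriv_ratio:
  fixes \<xi> :: "nat \<Rightarrow> complex"
  assumes "k \<le> n"
  shows "AE w in lborel. ln (cmod (deriv_ratio \<xi> k n w)) = ln (real (n choose k)) +
    (\<Sum>x\<in>#proots ((pderiv ^^ k) (\<Prod>i=1..n. [:- \<xi> i, 1:])). ln (cmod (w - x))) - (\<Sum>i=1..n. ln (cmod (w - \<xi> i)))"
proof -
  have "lead_coeff ((pderiv ^^ k) (\<Prod>i=1..n. [:- \<xi> i, 1:])) \<noteq> 0"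
    using assms by (subst lead_coeff_higher_pderiv_prod_linear) auto
  then have "(pderiv ^^ k) (\<Prod>i=1..n. [:- \<xi> i, 1:]) \<noteq> 0" by (metis coeff_0)
  then have "AE w in lborel. poly ((pderiv ^^ k) (\<Prod>i=1..n. [:- \<xi> i, 1:])) w \<noteq> 0"
    by (rule AE_poly_nonzero)
  moreover have "AE w in lborel. poly (\<Prod>i=1..n. [:- \<xi> i, 1:]) w \<noteq> 0"
    by (rule AE_poly_nonzero) simp
  ultimately show ?thesis
    by eventually_elim (rule ln_norm_deriv_ratio[OF _ _ assms])
qed

lemma borel_measurable_deriv_ratio [measurable]: "deriv_ratio \<xi> k n \<in> borel_measurable borel"
  unfolding deriv_ratio_def by (rule borel_measurable_coeff_prod_linear) auto

lemma nn_integral_scaled_indicator_finite: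
  "(\<integral>\<^sup>+w\<in>cball (0 :: complex) S. ennreal \<bar>c\<bar> \<partial>lborel) < \<infinity>"
  using emeasure_lborel_cball_finite[of "0 :: complex" S]
  by (simp add: nn_integral_cmult_indicator ennreal_mult_less_top)

text \<open>Integrate the identity for the logarithm of the ratio against \<psi>. The constant
  \<open>ln (real (n choose k))\<close> is annihilated by the mean zero of \<psi>, and the rest is
  at most the supremum of \<psi> times an integral over its support.\<close>

lemma zeros_statistic_diff_le:
  fixes \<xi> :: "nat \<Rightarrow> complex" and \<psi> :: "complex \<Rightarrow> real"
  assumes [measurable]: "\<psi> \<in> borel_measurable borel" and B: "\<And>w. \<bar>\<psi> w\<bar> \<le> B"
    and supp: "\<And>w. w \<notin> cball 0 S \<Longrightarrow> \<psi> w = 0" and mean: "(LINT w|lborel. \<psi> w) = 0" and "k \<le> n"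
    and "c \<ge> 0" and le: "(\<integral>\<^sup>+w\<in>cball 0 S. ennreal \<bar>ln (cmod (deriv_ratio \<xi> k n w))\<bar> \<partial>lborel) \<le> ennreal c"
  defines "L \<equiv> (\<lambda>a. LINT w|lborel. \<psi> w * ln (cmod (w - a)))"
  shows "\<bar>(\<Sum>x\<in>#proots ((pderiv ^^ k) (\<Prod>i=1..n. [:- \<xi> i, 1:])). L x) - (\<Sum>i=1..n. L (\<xi> i))\<bar> \<le> B * c"
proof -
  define Z where "Z = proots ((pderiv ^^ k) (\<Prod>i=1..n. [:- \<xi> i, 1:]))"
  have B0: "B \<ge> 0" using B[of 0] by linarith
  have int: "integrable lborel (\<lambda>w. \<psi> w * ln (cmod (w - a)))" for a
    by (rule integrable_bounded_support_mult[OF _ _ B supp nn_integral_abs_ln_norm_finite]) measurable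
  have "integrable lborel (\<lambda>w. \<psi> w * ln (real (n choose k)))"
    by (rule integrable_bounded_support_mult[OF _ _ B supp nn_integral_scaled_indicator_finite]) measurable
  have sum: "integrable lborel (\<lambda>w. \<Sum>x\<in>#A. \<psi> w * ln (cmod (w - x))) \<and>
     (LINT w|lborel. (\<Sum>x\<in>#A. \<psi> w * ln (cmod (w - x)))) = (\<Sum>x\<in>#A. L x)" for A
    by (induction A) (simp_all add: int L_def)
  have "(\<Sum>x\<in>#Z. L x) - (\<Sum>i=1..n. L (\<xi> i)) =
      (LINT w|lborel. \<psi> w * ln (real (n choose k)) + (\<Sum>x\<in>#Z. \<psi> w * ln (cmod (w - x))) - (\<Sum>i=1..n. \<psi> w * ln (cmod (w - \<xi> i))))"
    using sum[of Z] int mean \<open>integrable lborel (\<lambda>w. \<psi> w * ln (real (n choose k)))\<close>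
    by (simp add: L_def)
  also have "\<dots> = (LINT w|lborel. \<psi> w * ln (cmod (deriv_ratio \<xi> k n w)))"
  proof (rule integral_cong_AE)
    show "(\<lambda>w. \<psi> w * ln (real (n choose k)) + (\<Sum>x\<in>#Z. \<psi> w * ln (cmod (w - x))) - (\<Sum>i=1..n. \<psi> w * ln (cmod (w - \<xi> i)))) \<in> borel_measurable lborel"
    proof -
      have [measurable]: "(\<lambda>w. \<Sum>x\<in>#Z. \<psi> w * ln (cmod (w - x))) \<in> borel_measurable borel"
        using sum[of Z] by (auto dest: borel_measurable_integrable)
      show ?thesis by measurable
    qed
    show "AE w in lborel. \<psi> w * ln (real (n choose k)) + (\<Sum>x\<in>#Z. \<psi> w * ln (cmod (w - x))) - (\<Sum>i=1..n. \<psi> w * ln (cmod (w - \<xi> i))) =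
       \<psi> w * ln (cmod (deriv_ratio \<xi> k n w))"
      using AE_deriv_ratio[OF \<open>k \<le> n\<close>, of \<xi>]
      by eventually_elim (simp only: Z_def right_diff_distrib distrib_left sum_distrib_left sum_mset_distrib_left)
  qed measurable
  also have "\<bar>\<dots>\<bar> \<le> B * c"
  proof -
    have "ennreal \<bar>LINT w|lborel. \<psi> w * ln (cmod (deriv_ratio \<xi> k n w))\<bar> \<le>
       (\<integral>\<^sup>+w. ennreal (norm (\<psi> w * ln (cmod (deriv_ratio \<xi> k n w)))) \<partial>lborel)"
    \<comment> \<open>In the non-integrable case the integral is 0 by convention, so the bound is
      trivial.\<close>
    proof (cases "integrable lborel (\<lambda>w. \<psi> w * ln (cmod (deriv_ratio \<xi> k n w)))")
      case True
      then show ?thesis using integral_norm_bound_ennreal[OF True] by simp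
    qed (simp add: not_integrable_integral_eq)
    also have "\<dots> \<le> ennreal B * (\<integral>\<^sup>+w\<in>cball 0 S. ennreal \<bar>ln (cmod (deriv_ratio \<xi> k n w))\<bar> \<partial>lborel)"
      by (rule nn_integral_bounded_support_mult_le[OF _ B supp]) measurable
    also have "\<dots> \<le> ennreal B * ennreal c" by (intro mult_left_mono le) auto
    also have "\<dots> = ennreal (B * c)" using B0 \<open>c \<ge> 0\<close> by (simp add: ennreal_mult)
    finally show ?thesis using B0 \<open>c \<ge> 0\<close> by (simp add: ennreal_le_iff)
  qed
  finally show ?thesis by (simp add: Z_def)
qed

section \<open>Deterministic bounds for the logarithm of the ratio\<close>

text \<open>Every product of \<open>k\<close> distinct \<open>a i\<close> also occurs in the
  expansion of the power of the sum.\<close>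

lemma norm_coeff_prod_linear_le:
  fixes a :: "'i \<Rightarrow> complex"
  assumes "finite J"
  shows "cmod (coeff (\<Prod>i\<in>J. [:1, a i:]) k) \<le> (\<Sum>i\<in>J. cmod (a i)) ^ k"
  using assms
proof (induction J arbitrary: k rule: finite_induct)
  case empty
  show ?case by (cases k) auto
next
  case (insert i J)
  define S where "S = (\<Sum>i\<in>J. cmod (a i))"
  have S: "S \<ge> 0" by (simp add: S_def sum_nonneg)
  define G where "G = (\<Prod>i\<in>J. [:1, a i:])"
  have G: "(\<Prod>i\<in>insert i J. [:1, a i:]) = [:1, a i:] * G" "(\<Sum>i\<in>insert i J. cmod (a i)) = cmod (a i) + S"
    using insert.hyps by (simp_all add: G_def S_def)
  have IH: "cmod (coeff G k) \<le> S ^ k" for k using insert.IH by (simp add: G_def S_def)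
  show ?case
  proof (cases k)
    case 0
    have "coeff G 0 = 1"
      unfolding G_def by (induction J rule: infinite_finite_induct) (auto simp: mult.commute)
    then show ?thesis unfolding G using 0 by simp
  next
    case (Suc j)
    have "coeff ([:1, a i:] * G) k = coeff G (Suc j) + a i * coeff G j"
      by (simp add: Suc)
    also have "cmod \<dots> \<le> cmod (coeff G (Suc j)) + cmod (a i) * cmod (coeff G j)"
      by (rule order_trans[OF norm_triangle_ineq]) (simp add: norm_mult)
    also have "\<dots> \<le> S ^ Suc j + cmod (a i) * S ^ j"
      by (intro add_mono mult_left_mono IH) auto
    also have "\<dots> = (cmod (a i) + S) * S ^ j"
      by (simp add: algebra_simps)
    also have "\<dots> \<le> (cmod (a i) + S) * (cmod (a i) + S) ^ j"
      using S by (intro mult_left_mono power_mono) auto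
    finally show ?thesis unfolding G by (simp add: Suc)
  qed
qed

text \<open>With \<open>S\<close> the sum of the \<open>1 / \<bar>w - \<xi> i\<bar>\<close>, the
  ratio is at most \<open>(1 + S)^k\<close>. Writing \<open>ln (1 + S)\<close> as
  \<open>ln n + ln ((1 + S) / n)\<close> and using \<open>ln x \<le> x\<close> leaves the average
  \<open>S / n\<close>, whose integral is bounded whatever the zeros are. The result is logarithmic
  in \<open>n\<close>, hence negligible after division by \<open>n\<close>.\<close>

lemma nn_integral_pos_part_ln_deriv_ratio:
  "\<exists>C\<ge>0. \<forall>\<xi> n. n \<ge> 1 \<longrightarrow>
    (\<integral>\<^sup>+w\<in>cball 0 R. ennreal (max 0 (ln (cmod (deriv_ratio \<xi> k n w)))) \<partial>lborel) \<le> ennreal (C * ln (real n) + C)"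
proof -
  obtain C where C: "C \<ge> 0" "\<And>a :: complex. (\<integral>\<^sup>+w\<in>cball a 1. ennreal (inverse (cmod (w - a))) \<partial>lborel) \<le> ennreal C"
    using nn_integral_inverse_norm_cball by blast
  define A where "A = measure lborel (cball (0 :: complex) R)"
  have A: "emeasure lborel (cball (0 :: complex) R) = ennreal A" "A \<ge> 0"
    unfolding A_def using emeasure_lborel_cball_finite[of "0 :: complex" R]
    by (auto intro!: emeasure_eq_ennreal_measure)
  \<comment> \<open>One \<open>A\<close> comes from the term \<open>1 / n\<close>; the other,
    together with \<open>C\<close>, is the bound \<open>C + A\<close> for the integral of one
    reciprocal over \<open>cball 0 R\<close>.\<close>
  define C' where "C' = real k * (2 * A + C)"
  have C': "C' \<ge> 0" "real k * A \<le> C'" using A C by (auto simp: C'_def algebra_simps)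
  have inv: "(\<integral>\<^sup>+w\<in>cball 0 R. ennreal (inverse (cmod (w - a))) \<partial>lborel) \<le> ennreal (C + A)" for a
  proof -
    have "(\<integral>\<^sup>+w\<in>cball 0 R. ennreal (inverse (cmod (w - a))) \<partial>lborel) \<le>
       (\<integral>\<^sup>+w. ennreal (inverse (cmod (w - a))) * indicator (cball a 1) w + indicator (cball 0 R) w \<partial>lborel)"
    proof (intro nn_integral_mono)
      fix w
      have "ennreal (inverse (cmod (w - a))) \<le> 1" if "w \<notin> cball a 1"
        using that by (auto simp: dist_norm norm_minus_commute inverse_le_1_iff)
      then show "ennreal (inverse (cmod (w - a))) * indicator (cball 0 R) w \<le>
          ennreal (inverse (cmod (w - a))) * indicator (cball a 1) w + indicator (cball 0 R) w"
        by (cases "w \<in> cball a 1"; cases "w \<in> cball 0 R") auto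
    qed
    also have "\<dots> \<le> ennreal C + ennreal A"
      by (subst nn_integral_add) (auto intro!: add_mono C simp: A)
    finally show ?thesis using A C by simp
  qed
  have "(\<integral>\<^sup>+w\<in>cball 0 R. ennreal (max 0 (ln (cmod (deriv_ratio \<xi> k n w)))) \<partial>lborel) \<le> ennreal (C' * ln (real n) + C')"
    if n: "n \<ge> 1" for \<xi> n
  proof -
    define S where "S w = (\<Sum>i=1..n. inverse (cmod (w - \<xi> i)))" for w
    have S0: "S w \<ge> 0" for w by (simp add: S_def sum_nonneg)
    have pt: "max 0 (ln (cmod (deriv_ratio \<xi> k n w))) \<le> real k * (ln (real n) + 1 / n) + (\<Sum>i=1..n. real k / n * inverse (cmod (w - \<xi> i)))" for w
    proof (cases "deriv_ratio \<xi> k n w = 0")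
      case True
      then show ?thesis using n by (auto intro!: add_nonneg_nonneg sum_nonneg)
    next
      case False
      have "cmod (deriv_ratio \<xi> k n w) \<le> S w ^ k"
        unfolding deriv_ratio_def S_def using norm_coeff_prod_linear_le[of "{1..n}" "\<lambda>i. inverse (w - \<xi> i)" k]
        by (simp add: norm_inverse)
      also have "\<dots> \<le> (1 + S w) ^ k" using S0 by (intro power_mono) auto
      finally have "ln (cmod (deriv_ratio \<xi> k n w)) \<le> ln ((1 + S w) ^ k)"
        using False by (intro ln_mono) auto
      also have "\<dots> = real k * ln (1 + S w)" by (simp add: ln_realpow)
      also have "ln (1 + S w) = ln (real n) + ln ((1 + S w) / n)"
        using n S0[of w] by (subst ln_div) auto
      also have "real k * \<dots> \<le> real k * (ln (real n) + (1 + S w) / n)"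
      proof (intro mult_left_mono add_left_mono)
        have "(1 + S w) / n > 0" using n S0[of w] by (intro divide_pos_pos) auto
        then show "ln ((1 + S w) / n) \<le> (1 + S w) / n" using ln_le_minus_one[of "(1 + S w) / n"] by linarith
      qed auto
      also have "\<dots> = real k * (ln (real n) + 1 / n) + (\<Sum>i=1..n. real k / n * inverse (cmod (w - \<xi> i)))"
      proof -
        have "(\<Sum>i=1..n. real k / n * inverse (cmod (w - \<xi> i))) = real k / n * S w"
          by (simp only: S_def sum_distrib_left)
        then show ?thesis by (simp add: algebra_simps add_divide_distrib)
      qed
      finally have "ln (cmod (deriv_ratio \<xi> k n w)) \<le> \<dots>" .
      moreover have "0 \<le> real k * (ln (real n) + 1 / n) + (\<Sum>i=1..n. real k / n * inverse (cmod (w - \<xi> i)))"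
        using n by (auto intro!: add_nonneg_nonneg sum_nonneg)
      ultimately show ?thesis by simp
    qed
    have "(\<integral>\<^sup>+w\<in>cball 0 R. ennreal (max 0 (ln (cmod (deriv_ratio \<xi> k n w)))) \<partial>lborel) \<le>
      (\<integral>\<^sup>+w. ennreal (real k * (ln (real n) + 1 / n)) * indicator (cball 0 R) w +
        (\<Sum>i=1..n. ennreal (real k / n) * (ennreal (inverse (cmod (w - \<xi> i))) * indicator (cball 0 R) w)) \<partial>lborel)"
    proof (intro nn_integral_mono)
      fix w
      have "ennreal (max 0 (ln (cmod (deriv_ratio \<xi> k n w)))) \<le>
        ennreal (real k * (ln (real n) + 1 / n) + (\<Sum>i=1..n. real k / n * inverse (cmod (w - \<xi> i))))"
        by (rule ennreal_leI[OF pt])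
      also have "\<dots> = ennreal (real k * (ln (real n) + 1 / n)) + (\<Sum>i=1..n. ennreal (real k / n) * ennreal (inverse (cmod (w - \<xi> i))))"
      proof -
        have "ennreal (\<Sum>i=1..n. real k / n * inverse (cmod (w - \<xi> i))) =
            (\<Sum>i=1..n. ennreal (real k / n * inverse (cmod (w - \<xi> i))))"
          by (intro sum_ennreal[symmetric]) auto
        also have "\<dots> = (\<Sum>i=1..n. ennreal (real k / n) * ennreal (inverse (cmod (w - \<xi> i))))"
          by (intro sum.cong refl ennreal_mult) auto
        finally have "ennreal (\<Sum>i=1..n. real k / n * inverse (cmod (w - \<xi> i))) =
            (\<Sum>i=1..n. ennreal (real k / n) * ennreal (inverse (cmod (w - \<xi> i))))" .
        moreover have "ennreal (real k * (ln (real n) + 1 / n) + (\<Sum>i=1..n. real k / n * inverse (cmod (w - \<xi> i)))) =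
            ennreal (real k * (ln (real n) + 1 / n)) + ennreal (\<Sum>i=1..n. real k / n * inverse (cmod (w - \<xi> i)))"
          using n by (intro ennreal_plus sum_nonneg mult_nonneg_nonneg add_nonneg_nonneg) auto
        ultimately show ?thesis by simp
      qed
      finally show "ennreal (max 0 (ln (cmod (deriv_ratio \<xi> k n w)))) * indicator (cball 0 R) w \<le>
        ennreal (real k * (ln (real n) + 1 / n)) * indicator (cball 0 R) w +
        (\<Sum>i=1..n. ennreal (real k / n) * (ennreal (inverse (cmod (w - \<xi> i))) * indicator (cball 0 R) w))"
        by (cases "w \<in> cball 0 R") auto
    qed
    also have "\<dots> = ennreal (real k * (ln (real n) + 1 / n)) * ennreal A +
        (\<Sum>i=1..n. ennreal (real k / n) * (\<integral>\<^sup>+w\<in>cball 0 R. ennreal (inverse (cmod (w - \<xi> i))) \<partial>lborel))"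
      by (simp add: nn_integral_add nn_integral_sum nn_integral_cmult nn_integral_cmult_indicator A)
    also have "\<dots> \<le> ennreal (real k * (ln (real n) + 1 / n)) * ennreal A + (\<Sum>i=1..n. ennreal (real k / n) * ennreal (C + A))"
      by (intro add_left_mono sum_mono mult_left_mono inv) auto
    also have "\<dots> = ennreal (real k * (ln (real n) + 1 / n) * A + (\<Sum>i=1..n. real k / n * (C + A)))"
    proof -
      have "(\<Sum>i=1..n. ennreal (real k / n) * ennreal (C + A)) = (\<Sum>i=1..n. ennreal (real k / n * (C + A)))"
        using A C by (intro sum.cong refl ennreal_mult[symmetric]) auto
      also have "\<dots> = ennreal (\<Sum>i=1..n. real k / n * (C + A))"
        using A C by (intro sum_ennreal) auto
      finally have "(\<Sum>i=1..n. ennreal (real k / n) * ennreal (C + A)) = ennreal (\<Sum>i=1..n. real k / n * (C + A))" .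
      moreover have "ennreal (real k * (ln (real n) + 1 / n)) * ennreal A = ennreal (real k * (ln (real n) + 1 / n) * A)"
        using n A by (intro ennreal_mult[symmetric] mult_nonneg_nonneg add_nonneg_nonneg) auto
      moreover have "ennreal (real k * (ln (real n) + 1 / n) * A + (\<Sum>i=1..n. real k / n * (C + A))) =
          ennreal (real k * (ln (real n) + 1 / n) * A) + ennreal (\<Sum>i=1..n. real k / n * (C + A))"
        using n A C by (intro ennreal_plus sum_nonneg mult_nonneg_nonneg add_nonneg_nonneg) auto
      ultimately show ?thesis by simp
    qed
    also have "\<dots> \<le> ennreal (C' * ln (real n) + C')"
    proof (rule ennreal_leI)
      have "real k * A * (1 / n) \<le> real k * A * 1"
        using n A by (intro mult_left_mono) auto
      moreover have "real k * A * ln (real n) \<le> C' * ln (real n)"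
        using n C' by (intro mult_right_mono) auto
      moreover have "(\<Sum>i=1..n. real k / n * (C + A)) = real k * (C + A)"
        using n by simp
      moreover have "real k * (ln (real n) + 1 / n) * A = real k * A * ln (real n) + real k * A * (1 / n)"
        by (simp add: algebra_simps)
      ultimately show "real k * (ln (real n) + 1 / n) * A + (\<Sum>i=1..n. real k / n * (C + A)) \<le> C' * ln (real n) + C'"
        by (simp add: C'_def algebra_simps)
    qed
    finally show ?thesis .
  qed
  with C' show ?thesis by blast
qed

text \<open>Measurability is carried in the same induction because additivity of the integral asks
  for it.\<close>

lemma nn_integral_sum_mset_le:
  assumes meas: "\<And>x. f x \<in> borel_measurable N" and le: "\<And>x. (\<integral>\<^sup>+w. f x w \<partial>N) \<le> c"
  shows "(\<lambda>w. \<Sum>x\<in>#A. f x w) \<in> borel_measurable N \<and> (\<integral>\<^sup>+w. (\<Sum>x\<in>#A. f x w) \<partial>N) \<le> of_nat (size A) * (c :: ennreal)"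
proof (induction A)
  case (add x A)
  then have "(\<integral>\<^sup>+w. (\<Sum>x\<in>#add_mset x A. f x w) \<partial>N) = (\<integral>\<^sup>+w. f x w \<partial>N) + (\<integral>\<^sup>+w. (\<Sum>x\<in>#A. f x w) \<partial>N)"
    using meas by (simp add: nn_integral_add)
  also have "\<dots> \<le> c + of_nat (size A) * c"
    using add le by (intro add_mono) auto
  finally show ?case using add meas by (auto simp: algebra_simps intro!: borel_measurable_add)
qed simp

lemma sum_mset_nonneg: "(\<And>x. f x \<ge> 0) \<Longrightarrow> (\<Sum>x\<in>#A. f x) \<ge> (0 :: real)"
  by (induction A) simp_all

lemma sum_mset_ennreal:
  "(\<And>x. f x \<ge> 0) \<Longrightarrow> (\<Sum>x\<in>#A. ennreal (f x)) = ennreal (\<Sum>x\<in>#A. f x)"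
  by (induction A) (simp_all add: ennreal_plus sum_mset_nonneg)

text \<open>Where the ratio is not exponentially small, the negative part is at most
  \<open>\<epsilon> * n\<close>. On the remaining set, of area at most \<open>s\<close>, the
  identity for the logarithm of the ratio is used: \<open>ln (real (n choose k))\<close> has the
  favourable sign, the zeros of the derivative contribute at most \<open>n\<close> translates of one
  singularity, each integrating to at most \<open>K * s + exp (- K) * C\<close>, and the original
  zeros contribute at most \<open>m\<close>. A small \<open>s\<close> thus beats all terms but the
  one made small by \<open>K\<close>.\<close>

lemma nn_integral_neg_part_ln_deriv_ratio:
  fixes \<xi> :: "nat \<Rightarrow> complex" and C :: real
  assumes "k \<le> n" "\<epsilon> \<ge> 0" "K \<ge> 0" "m \<ge> 0" "s \<ge> 0" "C \<ge> 0"
    and C: "\<And>a :: complex. (\<integral>\<^sup>+w\<in>cball a 1. ennreal (inverse (cmod (w - a))) \<partial>lborel) \<le> ennreal C"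
    and A: "emeasure lborel (cball (0 :: complex) R) \<le> ennreal A" "A \<ge> 0"
    and m: "\<And>w. w \<in> cball 0 R \<Longrightarrow> (\<Sum>i=1..n. max 0 (ln (cmod (w - \<xi> i)))) \<le> m"
    and s: "emeasure lborel {w \<in> cball 0 R. cmod (deriv_ratio \<xi> k n w) < exp (- (\<epsilon> * real n))} \<le> ennreal s"
  shows "(\<integral>\<^sup>+w\<in>cball 0 R. ennreal (max 0 (- ln (cmod (deriv_ratio \<xi> k n w)))) \<partial>lborel) \<le>
     ennreal (\<epsilon> * real n * A + (real n * (K * s + exp (- K) * C) + m * s))"
proof -
  define T where "T = {w \<in> cball 0 R. cmod (deriv_ratio \<xi> k n w) < exp (- (\<epsilon> * real n))}"
  define Z where "Z = proots ((pderiv ^^ k) (\<Prod>i=1..n. [:- \<xi> i, 1:]))"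
  have size: "size Z \<le> n"
    unfolding Z_def size_proots_complex degree_higher_pderiv degree_prod_linear by simp
  have T_sets [measurable]: "T \<in> sets borel" unfolding T_def by measurable
  define g where "g x w = ennreal (max 0 (- ln (cmod (w - x)))) * indicator T w" for x w
  have [measurable]: "g x \<in> borel_measurable borel" for x unfolding g_def by measurable
  have g: "(\<integral>\<^sup>+w. g x w \<partial>lborel) \<le> ennreal (K * s + exp (- K) * C)" for x
  proof -
    have "(\<integral>\<^sup>+w. g x w \<partial>lborel) \<le>
       (\<integral>\<^sup>+w. ennreal K * indicator T w + ennreal (exp (- K)) * (ennreal (inverse (cmod (w - x))) * indicator (cball x 1) w) \<partial>lborel)"
    proof (intro nn_integral_mono)
      fix w
      have "indicator (cball 0 1) (w - x) = (indicator (cball x 1) w :: real)"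
        by (simp add: indicator_def dist_norm norm_minus_commute)
      with neg_ln_norm_le[OF \<open>K \<ge> 0\<close>, of "w - x"]
      have "ennreal (max 0 (- ln (cmod (w - x)))) \<le> ennreal (K + exp (- K) * (inverse (cmod (w - x)) * indicator (cball x 1) w))"
        by (intro ennreal_leI) simp
      also have "\<dots> = ennreal K + ennreal (exp (- K)) * (ennreal (inverse (cmod (w - x))) * indicator (cball x 1) w)"
        using \<open>K \<ge> 0\<close> by (simp add: ennreal_plus ennreal_mult ennreal_indicator)
      finally show "g x w \<le> ennreal K * indicator T w + ennreal (exp (- K)) * (ennreal (inverse (cmod (w - x))) * indicator (cball x 1) w)"
        unfolding g_def by (cases "w \<in> T") auto
    qed
    also have "\<dots> = ennreal K * emeasure lborel T + ennreal (exp (- K)) * (\<integral>\<^sup>+w\<in>cball x 1. ennreal (inverse (cmod (w - x))) \<partial>lborel)"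
      by (simp add: nn_integral_add nn_integral_cmult nn_integral_cmult_indicator)
    also have "\<dots> \<le> ennreal K * ennreal s + ennreal (exp (- K)) * ennreal C"
      using s C by (intro add_mono mult_left_mono) (auto simp: T_def)
    also have "\<dots> = ennreal (K * s + exp (- K) * C)"
      using assms by (simp add: ennreal_plus ennreal_mult)
    finally show ?thesis .
  qed
  have sum_g: "(\<lambda>w. \<Sum>x\<in>#Z. g x w) \<in> borel_measurable lborel"
    "(\<integral>\<^sup>+w. (\<Sum>x\<in>#Z. g x w) \<partial>lborel) \<le> of_nat (size Z) * ennreal (K * s + exp (- K) * C)"
    using nn_integral_sum_mset_le[of g lborel "ennreal (K * s + exp (- K) * C)" Z] g by auto
  note sum_g(1)[measurable]
  have "(\<integral>\<^sup>+w\<in>cball 0 R. ennreal (max 0 (- ln (cmod (deriv_ratio \<xi> k n w)))) \<partial>lborel) \<le>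
    (\<integral>\<^sup>+w. ennreal (\<epsilon> * n) * indicator (cball 0 R) w + ((\<Sum>x\<in>#Z. g x w) + ennreal m * indicator T w) \<partial>lborel)"
  proof (intro nn_integral_mono_AE)
    show "AE w in lborel. ennreal (max 0 (- ln (cmod (deriv_ratio \<xi> k n w)))) * indicator (cball 0 R) w \<le>
       ennreal (\<epsilon> * n) * indicator (cball 0 R) w + ((\<Sum>x\<in>#Z. g x w) + ennreal m * indicator T w)"
      using AE_deriv_ratio[OF \<open>k \<le> n\<close>, of \<xi>]
    proof eventually_elim
      case (elim w)
      show ?case
      proof (cases "w \<in> T")
        case True
        then have w: "w \<in> cball 0 R" by (simp add: T_def)
        have "(n choose k) \<noteq> 0" using \<open>k \<le> n\<close> by simp
        then have "ln (real (n choose k)) \<ge> 0" by (intro ln_ge_zero) linarith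
        moreover have "- (\<Sum>x\<in>#Z. ln (cmod (w - x))) \<le> (\<Sum>x\<in>#Z. max 0 (- ln (cmod (w - x))))"
          by (induction Z) auto
        moreover have "(\<Sum>i=1..n. ln (cmod (w - \<xi> i))) \<le> m"
          using m[OF w] sum_mono[of "{1..n}" "\<lambda>i. ln (cmod (w - \<xi> i))" "\<lambda>i. max 0 (ln (cmod (w - \<xi> i)))"] by fastforce
        moreover have "(\<Sum>x\<in>#Z. max 0 (- ln (cmod (w - x)))) \<ge> 0"
          by (intro sum_mset_nonneg) auto
        ultimately have "max 0 (- ln (cmod (deriv_ratio \<xi> k n w))) \<le> (\<Sum>x\<in>#Z. max 0 (- ln (cmod (w - x)))) + m"
          unfolding elim Z_def[symmetric] using \<open>m \<ge> 0\<close> by linarith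
        then have "ennreal (max 0 (- ln (cmod (deriv_ratio \<xi> k n w)))) \<le> ennreal ((\<Sum>x\<in>#Z. max 0 (- ln (cmod (w - x)))) + m)"
          by (rule ennreal_leI)
        also have "\<dots> = (\<Sum>x\<in>#Z. g x w) + ennreal m"
        proof -
          have "g x w = ennreal (max 0 (- ln (cmod (w - x))))" for x
            unfolding g_def using True by (simp only: indicator_simps mult_1_right)
          then show ?thesis
            using \<open>m \<ge> 0\<close> \<open>(\<Sum>x\<in>#Z. max 0 (- ln (cmod (w - x)))) \<ge> 0\<close>
            by (simp only: ennreal_plus sum_mset_ennreal max.cobounded1)
        qed
        finally show ?thesis using True w by (simp add: add_increasing)
      next
        case False
        show ?thesis
        proof (cases "w \<in> cball 0 R")
          case w: True
          with False have "cmod (deriv_ratio \<xi> k n w) \<ge> exp (- (\<epsilon> * n))" by (simp add: T_def)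
          then have "ln (cmod (deriv_ratio \<xi> k n w)) \<ge> - (\<epsilon> * n)"
            by (metis exp_gt_zero ln_exp ln_mono)
          then have "ennreal (max 0 (- ln (cmod (deriv_ratio \<xi> k n w)))) \<le> ennreal (\<epsilon> * n)"
            using \<open>\<epsilon> \<ge> 0\<close> by (intro ennreal_leI) simp
          then show ?thesis using w by (simp add: add_increasing2)
        qed simp
      qed
    qed
  qed
  also have "\<dots> = ennreal (\<epsilon> * n) * emeasure lborel (cball (0 :: complex) R) + ((\<integral>\<^sup>+w. (\<Sum>x\<in>#Z. g x w) \<partial>lborel) + ennreal m * emeasure lborel T)"
    by (simp add: nn_integral_add nn_integral_cmult_indicator)
  also have "\<dots> \<le> ennreal (\<epsilon> * n) * ennreal A + (of_nat n * ennreal (K * s + exp (- K) * C) + ennreal m * ennreal s)"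
    using size s A by (intro add_mono mult_left_mono order_trans[OF sum_g(2)] mult_right_mono) (auto simp: T_def)
  also have "\<dots> = ennreal (\<epsilon> * real n * A + (real n * (K * s + exp (- K) * C) + m * s))"
    using assms by (simp add: ennreal_plus ennreal_mult ennreal_of_nat_eq_real_of_nat)
  finally show ?thesis .
qed

lemma tendsto_zero_ennrealI:
  fixes f :: "'a \<Rightarrow> ennreal"
  assumes "\<And>\<delta> :: real. \<delta> > 0 \<Longrightarrow> \<forall>\<^sub>F x in F. f x \<le> ennreal \<delta>"
  shows "(f \<longlongrightarrow> 0) F"
proof (rule order_tendstoI)
  fix a :: ennreal assume "0 < a"
  then obtain b where b: "0 < b" "b < a" using dense by blast
  then have "b < \<top>" by (auto intro: order.strict_trans2)
  with b have "enn2real b > 0" "ennreal (enn2real b) = b" by (auto simp: enn2real_positive_iff)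
  with assms[of "enn2real b"] have "\<forall>\<^sub>F x in F. f x \<le> b" by simp
  then show "\<forall>\<^sub>F x in F. f x < a"
    by eventually_elim (use b in simp)
qed simp

section \<open>The logarithm of the ratio is negligible in probability\<close>

context random_perturbation begin

lemma borel_measurable_deriv_ratio_pair [measurable]:
  "(\<lambda>(\<omega>, w). deriv_ratio (\<lambda>i. zero_at i \<omega>) k n w) \<in> borel_measurable (M \<Otimes>\<^sub>M borel)"
  unfolding deriv_ratio_def case_prod_beta
proof (rule borel_measurable_coeff_prod_linear)
  fix i assume "i \<in> {1..n}"
  then have [measurable]: "zero_at i \<in> borel_measurable M" by (intro zero_at_measurable) simp
  show "(\<lambda>p. inverse (snd p - zero_at i (fst p))) \<in> borel_measurable (M \<Otimes>\<^sub>M borel)"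
    by measurable
qed simp

lemma AE_not_lim: "AE w in lborel. \<not> z \<longlonglongrightarrow> w"
proof (cases "\<exists>w. z \<longlonglongrightarrow> w")
  case True
  then obtain w0 where w0: "z \<longlonglongrightarrow> w0" ..
  have "AE w in lborel. w \<noteq> w0" by (rule AE_lborel_singleton)
  then show ?thesis by eventually_elim (use w0 LIMSEQ_unique in blast)
qed simp

text \<open>For every \<delta> the threshold \<open>exp (- (\<epsilon> * real n))\<close> eventually
  drops below the fixed radius from the anti-concentration bound.\<close>

lemma prob_deriv_ratio_small:
  assumes "\<not> z \<longlonglongrightarrow> w" "\<epsilon> > 0"
  shows "(\<lambda>n. emeasure M {\<omega> \<in> space M. cmod (deriv_ratio (\<lambda>i. zero_at i \<omega>) k n w) < exp (- (\<epsilon> * real n))}) \<longlonglongrightarrow> 0"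
proof (rule tendsto_zero_ennrealI)
  fix \<delta> :: real assume "\<delta> > 0"
  obtain r N where rN: "r > 0" "\<And>n. n \<ge> N \<Longrightarrow>
      emeasure M {\<omega> \<in> space M. cmod (deriv_ratio (\<lambda>i. zero_at i \<omega>) k n w) < r} \<le> ennreal \<delta>"
    using deriv_ratio_anticoncentration[OF assms(1) \<open>\<delta> > 0\<close>] by blast
  have "(\<lambda>n. exp (- (\<epsilon> * real n))) \<longlonglongrightarrow> 0"
    using assms(2) by real_asymp
  then have "\<forall>\<^sub>F n in sequentially. exp (- (\<epsilon> * real n)) < r"
    by (rule order_tendstoD) (rule rN)
  then show "\<forall>\<^sub>F n in sequentially. emeasure M {\<omega> \<in> space M. cmod (deriv_ratio (\<lambda>i. zero_at i \<omega>) k n w) < exp (- (\<epsilon> * real n))} \<le> ennreal \<delta>"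
    using eventually_ge_at_top[of N]
  proof eventually_elim
    case (elim n)
    have "emeasure M {\<omega> \<in> space M. cmod (deriv_ratio (\<lambda>i. zero_at i \<omega>) k n w) < exp (- (\<epsilon> * real n))} \<le>
        emeasure M {\<omega> \<in> space M. cmod (deriv_ratio (\<lambda>i. zero_at i \<omega>) k n w) < r}"
      using elim by (intro emeasure_mono) auto
    also have "\<dots> \<le> ennreal \<delta>" by (rule rN(2)[OF elim(2)])
    finally show ?case .
  qed
qed

definition small_set :: "nat \<Rightarrow> real \<Rightarrow> real \<Rightarrow> nat \<Rightarrow> 'w \<Rightarrow> complex set" where
  "small_set k R \<epsilon> n \<omega> = {w \<in> cball 0 R. cmod (deriv_ratio (\<lambda>i. zero_at i \<omega>) k n w) < exp (- (\<epsilon> * real n))}"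

text \<open>By Fubini the expected area is the integral over the disc of the probability at a fixed
  \<open>w\<close>. That probability tends to 0 for almost every \<open>w\<close> and is bounded by
  1.\<close>

lemma small_set_expectation:
  assumes "\<epsilon> > 0"
  shows "(\<lambda>n. \<integral>\<^sup>+\<omega>. emeasure lborel (small_set k R \<epsilon> n \<omega>) \<partial>M) \<longlonglongrightarrow> 0"
    and "(\<lambda>\<omega>. emeasure lborel (small_set k R \<epsilon> n \<omega>)) \<in> borel_measurable M"
proof -
  interpret P: pair_sigma_finite M "lborel :: complex measure" ..
  define h where "h n \<omega> w = (if w \<in> cball 0 R \<and> cmod (deriv_ratio (\<lambda>i. zero_at i \<omega>) k n w) < exp (- (\<epsilon> * real n)) then 1 else 0 :: ennreal)" for n \<omega> w
  have [measurable]: "(\<lambda>(\<omega>, w). h n \<omega> w) \<in> borel_measurable (M \<Otimes>\<^sub>M lborel)" for n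
    unfolding h_def by measurable
  have h: "emeasure lborel (small_set k R \<epsilon> n \<omega>) = (\<integral>\<^sup>+w. h n \<omega> w \<partial>lborel)" for n \<omega>
  proof -
    have "emeasure lborel {w \<in> space lborel. w \<in> cball 0 R \<and> cmod (deriv_ratio (\<lambda>i. zero_at i \<omega>) k n w) < exp (- (\<epsilon> * real n))} = (\<integral>\<^sup>+w. h n \<omega> w \<partial>lborel)"
      unfolding h_def by (rule emeasure_Collect_eq_nn_integral) measurable
    then show ?thesis by (simp add: small_set_def)
  qed
  show "(\<lambda>\<omega>. emeasure lborel (small_set k R \<epsilon> n \<omega>)) \<in> borel_measurable M"
    unfolding h by measurable
  define p where "p n w = emeasure M {\<omega> \<in> space M. cmod (deriv_ratio (\<lambda>i. zero_at i \<omega>) k n w) < exp (- (\<epsilon> * real n))}" for n w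
  have hp: "(\<integral>\<^sup>+\<omega>. h n \<omega> w \<partial>M) = p n w * indicator (cball 0 R) w" for n w
  proof (cases "w \<in> cball 0 R")
    case True
    have "p n w = (\<integral>\<^sup>+\<omega>. (if cmod (deriv_ratio (\<lambda>i. zero_at i \<omega>) k n w) < exp (- (\<epsilon> * real n)) then 1 else 0) \<partial>M)"
      unfolding p_def by (rule emeasure_Collect_eq_nn_integral) measurable
    then show ?thesis using True by (simp add: h_def)
  qed (simp add: h_def)
  have "(\<integral>\<^sup>+\<omega>. emeasure lborel (small_set k R \<epsilon> n \<omega>) \<partial>M) = (\<integral>\<^sup>+w\<in>cball 0 R. p n w \<partial>lborel)" for n
    unfolding h hp[symmetric] by (rule P.Fubini'[symmetric]) measurable
  moreover have "(\<lambda>n. \<integral>\<^sup>+w\<in>cball 0 R. p n w \<partial>lborel) \<longlonglongrightarrow> (\<integral>\<^sup>+w. 0 \<partial>(lborel :: complex measure))"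
  proof (rule nn_integral_dominated_convergence[where w = "indicator (cball 0 R)"])
    show "(\<lambda>w. p n w * indicator (cball 0 R) w) \<in> borel_measurable lborel" for n
      unfolding hp[symmetric] by measurable
    show "(\<integral>\<^sup>+w. indicator (cball (0 :: complex) R) w \<partial>lborel) < \<infinity>"
      using emeasure_lborel_cball_finite[of "0 :: complex" R] by simp
    have "p n w \<le> 1" for n w unfolding p_def by (rule measure_le_1)
    then show "AE w in lborel. p n w * indicator (cball 0 R) w \<le> indicator (cball 0 R) w" for n
      by (intro AE_I2) (auto simp: indicator_def)
    show "AE w in lborel. (\<lambda>n. p n w * indicator (cball 0 R) w) \<longlonglongrightarrow> 0"
      using AE_not_lim
    proof eventually_elim
      case (elim w)
      then have "(\<lambda>n. p n w) \<longlonglongrightarrow> 0"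
        unfolding p_def using assms by (rule prob_deriv_ratio_small)
      then show ?case by (auto simp: indicator_def)
    qed
  qed auto
  ultimately show "(\<lambda>n. \<integral>\<^sup>+\<omega>. emeasure lborel (small_set k R \<epsilon> n \<omega>) \<partial>M) \<longlonglongrightarrow> 0"
    by simp
qed

text \<open>Majorant for the sum of the positive parts of
  \<open>ln (cmod (w - zero_at i \<omega>))\<close>, the same for all \<open>w\<close> in
  \<open>cball 0 R\<close>. The \<open>z i\<close> enter logarithmically, as they are controlled
  only in that sense; X enters linearly, so that its first moment suffices.\<close>

definition log_growth :: "real \<Rightarrow> nat \<Rightarrow> 'w \<Rightarrow> real" where
  "log_growth R n \<omega> = (\<Sum>i=1..n. ln 2 + log_plus (cmod (z i)) + \<bar>R\<bar> + \<sigma> 1 * cmod (X i \<omega>))"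

lemma log_plus_nonneg: "log_plus x \<ge> 0"
  by (simp add: log_plus_def)

lemma log_growth_nonneg: "log_growth R n \<omega> \<ge> 0"
  unfolding log_growth_def using \<sigma>_pos[of 1]
  by (intro sum_nonneg add_nonneg_nonneg mult_nonneg_nonneg log_plus_nonneg) auto

lemma sum_ln_norm_le_log_growth:
  assumes "w \<in> cball 0 R"
  shows "(\<Sum>i=1..n. max 0 (ln (cmod (w - zero_at i \<omega>)))) \<le> log_growth R n \<omega>"
  unfolding log_growth_def
proof (rule sum_mono)
  fix i assume i: "i \<in> {1..n}"
  define a where "a = cmod (z i)"
  define b where "b = cmod w + \<sigma> i * cmod (X i \<omega>)"
  have \<sigma>: "\<sigma> i > 0" "\<sigma> i \<le> \<sigma> 1" using \<sigma>_pos[of i] \<sigma>_decreasing[of 1 i] i by auto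
  have ab: "a \<ge> 0" "b \<ge> 0" using \<sigma> by (auto simp: a_def b_def)
  have "cmod (w - zero_at i \<omega>) \<le> cmod w + cmod (z i) + \<sigma> i * cmod (X i \<omega>)"
  proof -
    have "cmod (w - zero_at i \<omega>) = cmod ((w - z i) + of_real (\<sigma> i) * X i \<omega>)"
      by (simp add: zero_at_def algebra_simps)
    also have "\<dots> \<le> cmod (w - z i) + cmod (of_real (\<sigma> i) * X i \<omega>)" by (rule norm_triangle_ineq)
    also have "cmod (w - z i) \<le> cmod w + cmod (z i)" by (rule norm_triangle_ineq4)
    finally show ?thesis using \<sigma> by (simp add: norm_mult)
  qed
  also have "\<dots> = a + b" by (simp add: a_def b_def)
  \<comment> \<open>Turning the sum into a product lets the logarithm treat \<open>z i\<close> and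
    the perturbation separately.\<close>
  also have "\<dots> \<le> (1 + a) * (1 + b)" using mult_nonneg_nonneg[OF ab] by (simp add: algebra_simps)
  finally have le: "cmod (w - zero_at i \<omega>) \<le> (1 + a) * (1 + b)" .
  have "ln (1 + a) \<le> ln 2 + log_plus a"
  proof (cases "a \<le> 1")
    case True
    then have "ln (1 + a) \<le> ln 2" using ab by (intro ln_mono) auto
    then show ?thesis using log_plus_nonneg[of a] by linarith
  next
    case False
    then have "ln (1 + a) \<le> ln (2 * a)" by (intro ln_mono) auto
    also have "\<dots> = ln 2 + ln a" using False by (intro ln_mult_pos) auto
    finally show ?thesis using False by (simp add: log_plus_def)
  qed
  moreover have "ln (1 + b) \<le> b" using ab(2) by (rule ln_add_one_self_le_self)
  moreover have "b \<le> \<bar>R\<bar> + \<sigma> 1 * cmod (X i \<omega>)"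
    unfolding b_def using assms \<sigma> by (intro add_mono mult_right_mono) auto
  moreover have "ln ((1 + a) * (1 + b)) = ln (1 + a) + ln (1 + b)"
    using ab by (intro ln_mult_pos) auto
  ultimately have *: "ln ((1 + a) * (1 + b)) \<le> ln 2 + log_plus (cmod (z i)) + \<bar>R\<bar> + \<sigma> 1 * cmod (X i \<omega>)"
    by (simp add: a_def)
  have "ln (cmod (w - zero_at i \<omega>)) \<le> ln ((1 + a) * (1 + b))"
  proof (cases "w = zero_at i \<omega>")
    case True
    have "1 \<le> (1 + a) * (1 + b)" using ab by (simp add: algebra_simps)
    then show ?thesis using True by simp
  next
    case False
    then show ?thesis using le by (intro ln_mono) auto
  qed
  moreover have "0 \<le> ln 2 + log_plus (cmod (z i)) + \<bar>R\<bar> + \<sigma> 1 * cmod (X i \<omega>)"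
    using \<sigma> log_plus_nonneg[of "cmod (z i)"] by (intro add_nonneg_nonneg mult_nonneg_nonneg) auto
  ultimately show "max 0 (ln (cmod (w - zero_at i \<omega>))) \<le> ln 2 + log_plus (cmod (z i)) + \<bar>R\<bar> + \<sigma> 1 * cmod (X i \<omega>)"
    using * by simp
qed

lemma integrable_norm_X:
  assumes "i \<ge> 1"
  shows "integrable M (\<lambda>\<omega>. cmod (X i \<omega>))" "expectation (\<lambda>\<omega>. cmod (X i \<omega>)) = expectation (\<lambda>\<omega>. cmod (X 1 \<omega>))"
proof -
  have Xi: "X i \<in> borel_measurable M" and X1: "X 1 \<in> borel_measurable M"
    using assms by (auto intro: X_measurable)
  have "integrable (distr M borel (X 1)) cmod"
    using integrable_X by (subst integrable_distr_eq[OF X1]) auto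
  then have "integrable (distr M borel (X i)) cmod"
    unfolding ident[OF assms] .
  then show "integrable M (\<lambda>\<omega>. cmod (X i \<omega>))"
    by (subst (asm) integrable_distr_eq[OF Xi]) auto
  have "expectation (\<lambda>\<omega>. cmod (X i \<omega>)) = (LINT x|distr M borel (X i). cmod x)"
    by (rule integral_distr[OF Xi, symmetric]) simp
  also have "\<dots> = (LINT x|distr M borel (X 1). cmod x)"
    unfolding ident[OF assms] ..
  also have "\<dots> = expectation (\<lambda>\<omega>. cmod (X 1 \<omega>))"
    by (rule integral_distr[OF X1]) simp
  finally show "expectation (\<lambda>\<omega>. cmod (X i \<omega>)) = expectation (\<lambda>\<omega>. cmod (X 1 \<omega>))" .
qed

lemma integrable_log_growth: "integrable M (log_growth R n)"
  unfolding log_growth_def using integrable_norm_X(1)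
  by (intro Bochner_Integration.integrable_sum Bochner_Integration.integrable_add integrable_mult_right) auto

lemma expectation_log_growth_le:
  assumes "log_Cesaro_bounded z"
  shows "\<exists>c\<ge>0. \<forall>n. expectation (log_growth R n) \<le> c * real n"
proof -
  obtain K where K: "K > 0" "\<And>n. norm ((\<Sum>i=1..n. log_plus (cmod (z i))) / real n) \<le> K"
    using assms unfolding log_Cesaro_bounded_def Bseq_def by blast
  define E where "E = expectation (\<lambda>\<omega>. cmod (X 1 \<omega>))"
  have E: "E \<ge> 0" unfolding E_def by (rule Bochner_Integration.integral_nonneg) simp
  have "expectation (log_growth R n) \<le> (K + (ln 2 + \<bar>R\<bar> + \<sigma> 1 * E)) * real n" for n
  proof (cases "n = 0")
    case True
    then show ?thesis by (simp add: log_growth_def[abs_def])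
  next
    case False
    have "expectation (log_growth R n) = (\<Sum>i=1..n. expectation (\<lambda>\<omega>. ln 2 + log_plus (cmod (z i)) + \<bar>R\<bar> + \<sigma> 1 * cmod (X i \<omega>)))"
      unfolding log_growth_def using integrable_norm_X(1)
      by (intro Bochner_Integration.integral_sum Bochner_Integration.integrable_add integrable_mult_right) auto
    also have "\<dots> = (\<Sum>i=1..n. ln 2 + log_plus (cmod (z i)) + \<bar>R\<bar> + \<sigma> 1 * E)"
    proof (intro sum.cong refl)
      fix i assume "i \<in> {1..n}"
      then have "i \<ge> 1" by simp
      then show "expectation (\<lambda>\<omega>. ln 2 + log_plus (cmod (z i)) + \<bar>R\<bar> + \<sigma> 1 * cmod (X i \<omega>)) = ln 2 + log_plus (cmod (z i)) + \<bar>R\<bar> + \<sigma> 1 * E"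
        using integrable_norm_X[of i] unfolding E_def by (subst Bochner_Integration.integral_add) (auto simp: prob_space)
    qed
    also have "\<dots> = (\<Sum>i=1..n. log_plus (cmod (z i))) + (ln 2 + \<bar>R\<bar> + \<sigma> 1 * E) * real n"
      by (simp add: sum.distrib algebra_simps)
    also have "(\<Sum>i=1..n. log_plus (cmod (z i))) \<le> K * real n"
    proof -
      have "(\<Sum>i=1..n. log_plus (cmod (z i))) / real n \<le> K"
        using abs_le_D1[OF K(2)[of n, unfolded real_norm_def]] .
      then show ?thesis using False by (simp add: field_simps)
    qed
    finally show ?thesis by (simp add: algebra_simps)
  qed
  moreover have "0 \<le> K + (ln 2 + \<bar>R\<bar> + \<sigma> 1 * E)"
    using K E \<sigma>_pos[of 1] by (intro add_nonneg_nonneg mult_nonneg_nonneg) auto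
  ultimately show ?thesis by blast
qed

definition log_energy :: "nat \<Rightarrow> real \<Rightarrow> nat \<Rightarrow> 'w \<Rightarrow> ennreal" where
  "log_energy k R n \<omega> = (\<integral>\<^sup>+w\<in>cball 0 R. ennreal \<bar>ln (cmod (deriv_ratio (\<lambda>i. zero_at i \<omega>) k n w))\<bar> \<partial>lborel)"

lemma log_energy_measurable [measurable]: "log_energy k R n \<in> borel_measurable M"
  unfolding log_energy_def by measurable

text \<open>Two applications of Markov's inequality, to the area of the small set and to the growth,
  reduce the claim to the deterministic bounds. Four error terms receive \<open>\<eta>/8\<close>
  each.\<close>

lemma log_energy_in_prob:
  assumes Cesaro: "log_Cesaro_bounded z" and "\<eta> > 0" "\<delta> > 0"
  shows "\<forall>\<^sub>F n in sequentially. emeasure M {\<omega> \<in> space M. log_energy k R n \<omega> > ennreal (\<eta> * real n)} \<le> ennreal \<delta>"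
proof -
  obtain C where C: "C \<ge> 0" "\<And>a :: complex. (\<integral>\<^sup>+w\<in>cball a 1. ennreal (inverse (cmod (w - a))) \<partial>lborel) \<le> ennreal C"
    using nn_integral_inverse_norm_cball by blast
  obtain C1 where C1: "C1 \<ge> 0" "\<And>\<xi> n. n \<ge> 1 \<Longrightarrow>
    (\<integral>\<^sup>+w\<in>cball 0 R. ennreal (max 0 (ln (cmod (deriv_ratio \<xi> k n w)))) \<partial>lborel) \<le> ennreal (C1 * ln (real n) + C1)"
    using nn_integral_pos_part_ln_deriv_ratio[of k R] by blast
  obtain c where c: "c \<ge> 0" "\<And>n. expectation (log_growth R n) \<le> c * real n"
    using expectation_log_growth_le[OF Cesaro] by blast
  define A where "A = measure lborel (cball (0 :: complex) R)"
  have A: "emeasure lborel (cball (0 :: complex) R) = ennreal A" "A \<ge> 0"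
    unfolding A_def using emeasure_lborel_cball_finite[of "0 :: complex" R]
    by (auto intro!: emeasure_eq_ennreal_measure)
  \<comment> \<open>The added 1 avoids division by zero when the disc has area 0.\<close>
  define \<epsilon> where "\<epsilon> = \<eta> / 8 / (A + 1)"
  have \<epsilon>: "\<epsilon> > 0" "\<epsilon> * A \<le> \<eta> / 8"
    using \<open>\<eta> > 0\<close> A by (auto simp: \<epsilon>_def field_simps)
  \<comment> \<open>Then \<open>exp (- K) * C = \<eta> * C / (\<eta> + 8 * C)\<close>, which is at
    most \<open>\<eta> / 8\<close>.\<close>
  define K where "K = ln (1 + 8 * C / \<eta>)"
  have K: "K \<ge> 0" "exp (- K) * C \<le> \<eta> / 8"
  proof -
    have pos: "1 + 8 * C / \<eta> \<ge> 1" using C \<open>\<eta> > 0\<close> by simp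
    then show "K \<ge> 0" by (simp add: K_def)
    have "exp (- K) = 1 / (1 + 8 * C / \<eta>)" using pos by (simp add: K_def exp_minus inverse_eq_divide)
    also have "\<dots> = \<eta> / (\<eta> + 8 * C)" using \<open>\<eta> > 0\<close> by (simp add: field_simps)
    finally have "exp (- K) * C = \<eta> * C / (\<eta> + 8 * C)" by simp
    also have "\<dots> \<le> \<eta> / 8" using \<open>\<eta> > 0\<close> C by (simp add: field_simps)
    finally show "exp (- K) * C \<le> \<eta> / 8" .
  qed
  \<comment> \<open>Markov bounds the probability of growth at least \<open>\<Lambda> * n\<close> by
    \<open>c / \<Lambda>\<close>, which must not exceed \<open>\<delta> / 2\<close>.\<close>
  define \<Lambda> where "\<Lambda> = 2 * (c + 1) / \<delta>"
  have \<Lambda>: "\<Lambda> > 0" "c / \<Lambda> \<le> \<delta> / 2" using c \<open>\<delta> > 0\<close> by (auto simp: \<Lambda>_def field_simps)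
  \<comment> \<open>The admissible area is fixed after \<open>K\<close> and \<Lambda>, since both
    multiply it in the bound for the negative part.\<close>
  define \<tau> where "\<tau> = \<eta> / 8 / (K + \<Lambda>)"
  have K\<Lambda>: "K + \<Lambda> > 0" using K \<Lambda> by simp
  then have "(K + \<Lambda>) * (\<eta> / 8) / (K + \<Lambda>) = \<eta> / 8" by (intro nonzero_mult_div_cancel_left) simp
  with K\<Lambda> have \<tau>: "\<tau> > 0" "(K + \<Lambda>) * \<tau> = \<eta> / 8"
    using \<open>\<eta> > 0\<close> unfolding \<tau>_def times_divide_eq_right by simp_all
  have "(\<lambda>n. (C1 * ln (real n) + C1) / real n) \<longlonglongrightarrow> 0" by real_asymp
  then have ev1: "\<forall>\<^sub>F n in sequentially. (C1 * ln (real n) + C1) / real n < \<eta> / 8"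
    by (rule order_tendstoD) (use \<open>\<eta> > 0\<close> in simp)
  \<comment> \<open>By Markov, an area of at least \<tau> then has probability at most
    \<open>\<delta> / 2\<close>.\<close>
  have ev2: "\<forall>\<^sub>F n in sequentially. (\<integral>\<^sup>+\<omega>. emeasure lborel (small_set k R \<epsilon> n \<omega>) \<partial>M) < ennreal (\<tau> * \<delta> / 2)"
    by (rule order_tendstoD(2)[OF small_set_expectation(1)[OF \<epsilon>(1)]]) (use \<tau> \<open>\<delta> > 0\<close> in simp)
  show ?thesis
    using ev1 ev2 eventually_ge_at_top[of "max 1 k"]
  proof eventually_elim
    case (elim n)
    then have n: "n \<ge> 1" "k \<le> n" by auto
    let ?s = "\<lambda>\<omega>. emeasure lborel (small_set k R \<epsilon> n \<omega>)"
    note [measurable] = small_set_expectation(2)[OF \<epsilon>(1), of k R n]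
    have [measurable]: "log_growth R n \<in> borel_measurable M"
      using integrable_log_growth by (rule borel_measurable_integrable)
    \<comment> \<open>Off the two events on the right the area is at most \<tau> and the growth at
      most \<open>\<Lambda> * real n\<close>; the condition on the area is scaled to the form of
      Markov's inequality.\<close>
    have "{\<omega> \<in> space M. log_energy k R n \<omega> > ennreal (\<eta> * real n)} \<subseteq>
      {\<omega> \<in> space M. 1 \<le> ennreal (1 / \<tau>) * ?s \<omega>} \<union> {\<omega> \<in> space M. log_growth R n \<omega> \<ge> \<Lambda> * real n}"
    proof safe
      fix \<omega> assume \<omega>: "\<omega> \<in> space M" and gt: "log_energy k R n \<omega> > ennreal (\<eta> * real n)"
        and "\<not> \<Lambda> * real n \<le> log_growth R n \<omega>"
      then have growth: "log_growth R n \<omega> \<le> \<Lambda> * real n" by simp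
      show "1 \<le> ennreal (1 / \<tau>) * ?s \<omega>"
      proof (rule ccontr)
        assume "\<not> ?thesis"
        then have "ennreal (1 / \<tau>) * ?s \<omega> < 1" by simp
        then have s: "?s \<omega> \<le> ennreal \<tau>"
        proof -
          have "?s \<omega> = ennreal \<tau> * (ennreal (1 / \<tau>) * ?s \<omega>)"
            using \<tau> by (simp add: mult.assoc[symmetric] ennreal_mult[symmetric])
          also have "\<dots> \<le> ennreal \<tau> * 1"
            using \<open>ennreal (1 / \<tau>) * ?s \<omega> < 1\<close> by (intro mult_left_mono) auto
          finally show ?thesis by simp
        qed
        have pt: "ennreal \<bar>x\<bar> = ennreal (max 0 x) + ennreal (max 0 (- x))" for x :: real
          by (cases "x \<ge> 0") auto
        have "log_energy k R n \<omega> =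
            (\<integral>\<^sup>+w\<in>cball 0 R. ennreal (max 0 (ln (cmod (deriv_ratio (\<lambda>i. zero_at i \<omega>) k n w)))) \<partial>lborel) +
            (\<integral>\<^sup>+w\<in>cball 0 R. ennreal (max 0 (- ln (cmod (deriv_ratio (\<lambda>i. zero_at i \<omega>) k n w)))) \<partial>lborel)"
          unfolding log_energy_def pt distrib_right by (rule nn_integral_add) measurable
        also have "\<dots> \<le> ennreal (C1 * ln (real n) + C1) +
            ennreal (\<epsilon> * real n * A + (real n * (K * \<tau> + exp (- K) * C) + (\<Lambda> * real n) * \<tau>))"
        proof (intro add_mono C1(2) n nn_integral_neg_part_ln_deriv_ratio)
          show "(\<Sum>i=1..n. max 0 (ln (cmod (w - zero_at i \<omega>)))) \<le> \<Lambda> * real n" if "w \<in> cball 0 R" for w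
            using sum_ln_norm_le_log_growth[OF that] growth by (rule order_trans)
          show "emeasure lborel {w \<in> cball 0 R. cmod (deriv_ratio (\<lambda>i. zero_at i \<omega>) k n w) < exp (- (\<epsilon> * real n))} \<le> ennreal \<tau>"
            using s by (simp only: small_set_def)
          show "emeasure lborel (cball (0 :: complex) R) \<le> ennreal A" using A by simp
        qed (use \<epsilon> K \<Lambda> \<tau> C A in auto)
        also have "\<dots> = ennreal (C1 * ln (real n) + C1 + (\<epsilon> * real n * A + (real n * (K * \<tau> + exp (- K) * C) + (\<Lambda> * real n) * \<tau>)))"
          using n C1 \<epsilon> K \<Lambda> \<tau> C A by (intro ennreal_plus[symmetric] add_nonneg_nonneg mult_nonneg_nonneg) auto
        also have "\<dots> \<le> ennreal (\<eta> * real n)"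
        proof (rule ennreal_leI)
          have "C1 * ln (real n) + C1 \<le> \<eta> / 8 * real n"
            using elim(1) n by (simp add: field_simps)
          moreover have "\<epsilon> * A * real n \<le> \<eta> / 8 * real n"
            using \<epsilon> by (intro mult_right_mono) auto
          moreover have "exp (- K) * C * real n \<le> \<eta> / 8 * real n"
            using K by (intro mult_right_mono) auto
          moreover have "\<epsilon> * real n * A + (real n * (K * \<tau> + exp (- K) * C) + (\<Lambda> * real n) * \<tau>) =
              \<epsilon> * A * real n + exp (- K) * C * real n + ((K + \<Lambda>) * \<tau>) * real n"
            by (simp add: algebra_simps)
          moreover have "((K + \<Lambda>) * \<tau>) * real n = \<eta> / 8 * real n" using \<tau> by simp
          moreover have "\<eta> / 8 * real n = \<eta> * real n / 8" "\<eta> * real n \<ge> 0" using \<open>\<eta> > 0\<close> by auto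
          ultimately show "C1 * ln (real n) + C1 + (\<epsilon> * real n * A + (real n * (K * \<tau> + exp (- K) * C) + (\<Lambda> * real n) * \<tau>)) \<le> \<eta> * real n"
            by linarith
        qed
        finally show False using gt by simp
      qed
    qed
    then have "emeasure M {\<omega> \<in> space M. log_energy k R n \<omega> > ennreal (\<eta> * real n)} \<le>
      emeasure M ({\<omega> \<in> space M. 1 \<le> ennreal (1 / \<tau>) * ?s \<omega>} \<union> {\<omega> \<in> space M. log_growth R n \<omega> \<ge> \<Lambda> * real n})"
      by (intro emeasure_mono) measurable
    also have "\<dots> \<le> emeasure M {\<omega> \<in> space M. 1 \<le> ennreal (1 / \<tau>) * ?s \<omega>} + emeasure M {\<omega> \<in> space M. log_growth R n \<omega> \<ge> \<Lambda> * real n}"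
      by (intro emeasure_subadditive) measurable
    also have "\<dots> \<le> ennreal (\<delta> / 2) + ennreal (\<delta> / 2)"
    proof (intro add_mono)
      have "emeasure M {\<omega> \<in> space M. 1 \<le> ennreal (1 / \<tau>) * ?s \<omega>} \<le> ennreal (1 / \<tau>) * (\<integral>\<^sup>+\<omega>\<in>space M. ?s \<omega> \<partial>M)"
        by (rule nn_integral_Markov_inequality) measurable
      also have "(\<integral>\<^sup>+\<omega>\<in>space M. ?s \<omega> \<partial>M) = (\<integral>\<^sup>+\<omega>. ?s \<omega> \<partial>M)"
        by (intro nn_integral_cong) simp
      also have "ennreal (1 / \<tau>) * \<dots> \<le> ennreal (1 / \<tau>) * ennreal (\<tau> * \<delta> / 2)"
        using elim(2) by (intro mult_left_mono) auto
      also have "\<dots> = ennreal (\<delta> / 2)"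
        using \<tau> \<open>\<delta> > 0\<close> by (simp add: ennreal_mult[symmetric])
      finally show "emeasure M {\<omega> \<in> space M. 1 \<le> ennreal (1 / \<tau>) * ?s \<omega>} \<le> ennreal (\<delta> / 2)" .
      have "emeasure M {\<omega> \<in> space M. log_growth R n \<omega> \<ge> \<Lambda> * real n} \<le> ennreal (1 / (\<Lambda> * real n) * expectation (log_growth R n))"
        using \<Lambda> n log_growth_nonneg
        by (intro integral_Markov_inequality integrable_log_growth) auto
      also have "\<dots> \<le> ennreal (1 / (\<Lambda> * real n) * (c * real n))"
        using \<Lambda> n c by (intro ennreal_leI mult_left_mono) auto
      also have "\<dots> \<le> ennreal (\<delta> / 2)"
        using \<Lambda> n by (intro ennreal_leI) (simp add: field_simps)
      finally show "emeasure M {\<omega> \<in> space M. log_growth R n \<omega> \<ge> \<Lambda> * real n} \<le> ennreal (\<delta> / 2)" .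
    qed
    also have "\<dots> = ennreal \<delta>" using \<open>\<delta> > 0\<close> by (simp flip: ennreal_plus)
    finally show ?case .
  qed
qed

end

subsection \<open>Weak convergence\<close>

definition test_function :: "('a::euclidean_space \<Rightarrow> real) \<Rightarrow> bool" where
  "test_function g \<longleftrightarrow> continuous_on UNIV g \<and> (\<exists>R. \<forall>w. w \<notin> cball 0 R \<longrightarrow> g w = 0)"

lemma borel_prob_measuresD:
  assumes "N \<in> borel_prob_measures"
  shows "prob_space N" "sets N = sets borel"
  using assms by (auto simp: borel_prob_measures_def)

text \<open>Quantitative form of the fact that vague convergence to a probability measure is weak
  convergence: besides a truncation of \<open>f\<close>, the cut-off \<open>h\<close> is tested,
  which keeps mass from escaping to infinity. Being a statement about one measure \<open>N\<close>,
  it serves both modes of convergence.\<close>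

lemma weak_closeness_from_compact_support:
  fixes \<mu> :: "'a::euclidean_space measure" and f :: "'a \<Rightarrow> real"
  assumes \<mu>: "\<mu> \<in> borel_prob_measures" and f: "continuous_on UNIV f" "bounded (range f)" and \<epsilon>: "\<epsilon> > 0"
  obtains g h :: "'a \<Rightarrow> real" and \<delta> where "test_function g" "test_function h" "\<delta> > 0"
    "\<And>N. N \<in> borel_prob_measures \<Longrightarrow> \<bar>(LINT x|N. g x) - (LINT x|\<mu>. g x)\<bar> < \<delta> \<Longrightarrow>
       \<bar>(LINT x|N. h x) - (LINT x|\<mu>. h x)\<bar> < \<delta> \<Longrightarrow> \<bar>(LINT x|N. f x) - (LINT x|\<mu>. f x)\<bar> < \<epsilon>"
proof -
  interpret \<mu>: prob_space \<mu> by (rule borel_prob_measuresD[OF \<mu>])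
  have sets_\<mu>: "sets \<mu> = sets borel" by (rule borel_prob_measuresD[OF \<mu>])
  obtain B where B: "B \<ge> 0" "\<And>x. \<bar>f x\<bar> \<le> B"
  proof -
    from f(2) obtain B where "\<forall>y\<in>range f. norm y \<le> B" unfolding bounded_iff by blast
    then have "\<bar>f x\<bar> \<le> B" for x by auto
    moreover from this[of undefined] have "B \<ge> 0" by linarith
    ultimately show ?thesis using that by blast
  qed
  \<comment> \<open>The final error is at most
    \<open>\<delta> + 2 * B * \<delta> + B * \<delta>\<close>, hence at most
    \<open>3 * \<delta> * (B + 1) = 3 * \<epsilon> / 4\<close>.\<close>
  define \<delta> where "\<delta> = \<epsilon> / 4 / (B + 1)"
  have B1: "B + 1 > 0" using B by simp
  then have "(\<epsilon> / 4) * (B + 1) / (B + 1) = \<epsilon> / 4" by (intro nonzero_mult_div_cancel_right) simp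
  with B1 have \<delta>: "\<delta> > 0" "\<delta> * (B + 1) = \<epsilon> / 4"
    using \<epsilon> unfolding \<delta>_def times_divide_eq_left by simp_all
  obtain R where R: "R > 0" "measure \<mu> {x. norm x \<ge> R} \<le> \<delta>"
    using measure_norm_ge_eventually_small[OF \<mu>.prob_space_axioms sets_\<mu> \<delta>(1)] by (metis order_refl)
  define h :: "'a \<Rightarrow> real" where "h x = max 0 (min 1 (R + 1 - norm x))" for x
  have h01: "0 \<le> h x" "h x \<le> 1" for x by (auto simp: h_def)
  have h_cont: "continuous_on UNIV h" unfolding h_def by (intro continuous_intros)
  have h_supp: "h x = 0" if "x \<notin> cball 0 (R + 1)" for x using that by (auto simp: h_def)
  have [measurable]: "f \<in> borel_measurable borel" "h \<in> borel_measurable borel"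
    using f(1) h_cont by (auto intro: borel_measurable_continuous_onI)
  \<comment> \<open>The truncation error is governed by the mass that \<open>h\<close> misses; it
    applies to \<mu> and to \<open>N\<close> alike.\<close>
  have key: "\<bar>(LINT x|N. f x) - (LINT x|N. f x * h x)\<bar> \<le> B * (1 - (LINT x|N. h x)) \<and> (LINT x|N. h x) \<le> 1"
    if N: "N \<in> borel_prob_measures" for N
  proof -
    interpret N: prob_space N by (rule borel_prob_measuresD[OF N])
    note [measurable_cong] = borel_prob_measuresD(2)[OF N]
    have h_int: "integrable N h" using h01 by (intro N.integrable_const_bound[of _ 1]) auto
    have f_int: "integrable N f" using B by (intro N.integrable_const_bound[of _ B]) auto
    have fh_int: "integrable N (\<lambda>x. f x * h x)"
    proof (intro N.integrable_const_bound[of _ B] AE_I2)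
      fix x show "norm (f x * h x) \<le> B"
        using mult_mono[OF B(2)[of x] h01(2)[of x]] h01(1)[of x] B(1) by (simp add: abs_mult)
    qed measurable
    have "(LINT x|N. f x) - (LINT x|N. f x * h x) = (LINT x|N. f x * (1 - h x))"
      using f_int fh_int by (simp add: right_diff_distrib)
    also have "\<bar>\<dots>\<bar> \<le> (LINT x|N. B * (1 - h x))"
    proof (intro order_trans[OF integral_abs_bound] integral_mono)
      show "integrable N (\<lambda>x. \<bar>f x * (1 - h x)\<bar>)"
        using f_int fh_int by (simp add: right_diff_distrib)
      show "integrable N (\<lambda>x. B * (1 - h x))" using h_int by simp
      show "\<bar>f x * (1 - h x)\<bar> \<le> B * (1 - h x)" for x
        using B(2)[of x] h01[of x] by (simp add: abs_mult mult_right_mono)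
    qed
    also have "\<dots> = B * (1 - (LINT x|N. h x))"
      using h_int by (simp add: N.prob_space)
    finally have "\<bar>(LINT x|N. f x) - (LINT x|N. f x * h x)\<bar> \<le> B * (1 - (LINT x|N. h x))" .
    moreover have "(LINT x|N. h x) \<le> 1"
      using integral_mono[OF h_int, of "\<lambda>_. 1"] h01 by (simp add: N.prob_space)
    ultimately show ?thesis by simp
  qed
  have tight: "1 - (LINT x|\<mu>. h x) \<le> \<delta>"
  proof -
    note [measurable_cong] = sets_\<mu>
    have h_int: "integrable \<mu> h" using h01 by (intro \<mu>.integrable_const_bound[of _ 1]) auto
    have sp: "space \<mu> = UNIV" using sets_eq_imp_space_eq[OF sets_\<mu>] by simp
    have meas: "{x. norm x \<ge> R} \<in> sets \<mu>" unfolding sets_\<mu> by measurable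
    have ind_int: "integrable \<mu> (indicator {x. norm x \<ge> R} :: 'a \<Rightarrow> real)"
      using meas by (intro integrable_real_indicator) (auto simp: \<mu>.emeasure_eq_measure)
    have "1 - (LINT x|\<mu>. h x) = (LINT x|\<mu>. 1 - h x)"
      using h_int by (simp add: \<mu>.prob_space)
    also have "\<dots> \<le> (LINT x|\<mu>. indicator {x. norm x \<ge> R} x)"
    proof (rule integral_mono)
      show "integrable \<mu> (\<lambda>x. 1 - h x)" using h_int by simp
      show "integrable \<mu> (\<lambda>x. indicator {x. norm x \<ge> R} x :: real)" using ind_int .
    qed (auto simp: h_def indicator_def)
    also have "\<dots> = measure \<mu> {x. norm x \<ge> R}"
      using sp by simp
    finally show ?thesis using R by simp
  qed
  show ?thesis
  proof (rule that)
    have "continuous_on UNIV (\<lambda>x. f x * h x)" using f(1) h_cont by (intro continuous_intros)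
    with h_supp show "test_function (\<lambda>x. f x * h x)"
      unfolding test_function_def by (intro conjI exI[of _ "R + 1"]) auto
    show "test_function h"
      unfolding test_function_def using h_cont h_supp by blast
    fix N :: "'a measure" assume N: "N \<in> borel_prob_measures"
      and 1: "\<bar>(LINT x|N. f x * h x) - (LINT x|\<mu>. f x * h x)\<bar> < \<delta>"
      and 2: "\<bar>(LINT x|N. h x) - (LINT x|\<mu>. h x)\<bar> < \<delta>"
    have "1 - (LINT x|N. h x) \<le> 2 * \<delta>" using 2 tight by linarith
    then have "B * (1 - (LINT x|N. h x)) \<le> B * (2 * \<delta>)" "B * (1 - (LINT x|\<mu>. h x)) \<le> B * \<delta>"
      using B tight by (auto intro: mult_left_mono)
    then have "\<bar>(LINT x|N. f x) - (LINT x|\<mu>. f x)\<bar> < \<delta> + B * (2 * \<delta>) + B * \<delta>"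
      using key[OF N] key[OF \<mu>] 1 by linarith
    also have "\<dots> \<le> 3 * (\<delta> * (B + 1))" using \<delta>(1) by (simp add: algebra_simps)
    also have "\<dots> < \<epsilon>" using \<delta>(2) \<epsilon> by simp
    finally show "\<bar>(LINT x|N. f x) - (LINT x|\<mu>. f x)\<bar> < \<epsilon>" .
  qed (use \<delta> in auto)
qed

lemma limitin_weak_topology_compact_support:
  fixes N :: "nat \<Rightarrow> 'a::euclidean_space measure"
  assumes N: "\<And>n. N n \<in> borel_prob_measures" and \<mu>: "\<mu> \<in> borel_prob_measures"
    and lim: "\<And>g. test_function g \<Longrightarrow>
       (\<lambda>n. LINT x|N n. g x) \<longlonglongrightarrow> (LINT x|\<mu>. g x)"
  shows "limitin weak_topology N \<mu> sequentially"
  unfolding limitin_weak_topology_iff[OF N \<mu>]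
proof (intro allI impI)
  fix f :: "'a \<Rightarrow> real" assume f: "continuous_on UNIV f" "bounded (range f)"
  show "(\<lambda>n. LINT x|N n. f x) \<longlonglongrightarrow> (LINT x|\<mu>. f x)"
  proof (rule tendstoI)
    fix \<epsilon> :: real assume "\<epsilon> > 0"
    then obtain g h :: "'a \<Rightarrow> real" and \<delta>
      where g: "test_function g" and h: "test_function h" and "\<delta> > 0"
        and close: "\<And>N. N \<in> borel_prob_measures \<Longrightarrow> \<bar>(LINT x|N. g x) - (LINT x|\<mu>. g x)\<bar> < \<delta> \<Longrightarrow>
       \<bar>(LINT x|N. h x) - (LINT x|\<mu>. h x)\<bar> < \<delta> \<Longrightarrow> \<bar>(LINT x|N. f x) - (LINT x|\<mu>. f x)\<bar> < \<epsilon>"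
      by (rule weak_closeness_from_compact_support[OF \<mu> f]) (rule that; assumption)
    from tendstoD[OF lim[OF g] \<open>\<delta> > 0\<close>] tendstoD[OF lim[OF h] \<open>\<delta> > 0\<close>]
    show "\<forall>\<^sub>F n in sequentially. dist (LINT x|N n. f x) (LINT x|\<mu>. f x) < \<epsilon>"
      unfolding dist_real_def by eventually_elim (rule close[OF N])
  qed
qed

section \<open>Convergence in probability with outer measures\<close>

lemma outer_measure_of_Un_le:
  "outer_measure_of M (A \<union> B) \<le> outer_measure_of M A + outer_measure_of M B"
  if "A \<subseteq> space M" "B \<subseteq> space M"
proof -
  from outer_measure_of_attain[OF that(1)] obtain E where E: "E \<in> sets M" "A \<subseteq> E" "outer_measure_of M A = emeasure M E" by blast
  from outer_measure_of_attain[OF that(2)] obtain F where F: "F \<in> sets M" "B \<subseteq> F" "outer_measure_of M B = emeasure M F" by blast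
  have "outer_measure_of M (A \<union> B) \<le> outer_measure_of M (E \<union> F)"
    using E F by (intro outer_measure_of_mono) auto
  also have "\<dots> = emeasure M (E \<union> F)" using E F by (intro outer_measure_of_eq) auto
  also have "\<dots> \<le> emeasure M E + emeasure M F" using E F by (intro emeasure_subadditive) auto
  finally show ?thesis using E F by simp
qed

text \<open>Induction over the generation of open sets: subadditivity handles intersections,
  monotonicity handles unions, and subbasic sets reduce to two test functions. Outer measures do
  this without any measurability of \<open>Y\<close>.\<close>

lemma limit_in_prob_weak_topology_compact_support:
  fixes Y :: "nat \<Rightarrow> 'w \<Rightarrow> 'a::euclidean_space measure"
  assumes Y: "\<And>n \<omega>. Y n \<omega> \<in> borel_prob_measures" and \<mu>: "\<mu> \<in> borel_prob_measures"
    and lim: "\<And>g \<epsilon>. test_function g \<Longrightarrow> \<epsilon> > 0 \<Longrightarrow>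
       (\<lambda>n. outer_measure_of M {\<omega> \<in> space M. \<not> \<bar>(LINT x|Y n \<omega>. g x) - (LINT x|\<mu>. g x)\<bar> < \<epsilon>}) \<longlonglongrightarrow> 0"
  shows "limit_in_prob M weak_topology Y \<mu>"
proof -
  let ?S = "{{N \<in> borel_prob_measures. (LINT x|N. f x) \<in> U} | (f :: 'a \<Rightarrow> real) U.
        continuous_on UNIV f \<and> bounded (range f) \<and> open U}"
  let ?out = "\<lambda>V n. outer_measure_of M {\<omega> \<in> space M. Y n \<omega> \<notin> V}"
  have squeeze: "?out V \<longlonglongrightarrow> 0" if "h \<longlonglongrightarrow> 0" "\<And>n. ?out V n \<le> h n" for V h
    using that by (intro tendsto_sandwich[of "\<lambda>_. 0" "?out V" sequentially h]) auto
  have "?out V \<longlonglongrightarrow> 0" if "generate_topology_on ?S V" "\<mu> \<in> V" for V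
    using that
  proof (induction rule: generate_topology_on.induct)
    case (Int a b)
    then have "(\<lambda>n. ?out a n + ?out b n) \<longlonglongrightarrow> 0 + 0" by (intro tendsto_add) auto
    then show ?case
    proof (intro squeeze[of "\<lambda>n. ?out a n + ?out b n"])
      fix n
      have "{\<omega> \<in> space M. Y n \<omega> \<notin> a \<inter> b} = {\<omega> \<in> space M. Y n \<omega> \<notin> a} \<union> {\<omega> \<in> space M. Y n \<omega> \<notin> b}" by auto
      then show "?out (a \<inter> b) n \<le> ?out a n + ?out b n"
        by (simp only:) (intro outer_measure_of_Un_le, auto)
    qed simp
  next
    case (UN K)
    then obtain k where "k \<in> K" "\<mu> \<in> k" by blast
    with UN.IH[of k] have "?out k \<longlonglongrightarrow> 0" by simp
    then show ?case
      by (rule squeeze) (use \<open>k \<in> K\<close> in \<open>auto intro!: outer_measure_of_mono\<close>)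
  next
    case (Basis s)
    then obtain f :: "'a \<Rightarrow> real" and U where
      s: "s = {N \<in> borel_prob_measures. (LINT x|N. f x) \<in> U}"
      and f: "continuous_on UNIV f" "bounded (range f)" and U: "open U" by blast
    from Basis s have "(LINT x|\<mu>. f x) \<in> U" by blast
    with U obtain \<epsilon> where \<epsilon>: "\<epsilon> > 0" "\<And>y. dist y (LINT x|\<mu>. f x) < \<epsilon> \<Longrightarrow> y \<in> U"
      unfolding open_dist by blast
    from \<epsilon>(1) obtain g h :: "'a \<Rightarrow> real" and \<delta>
      where g: "test_function g" and h: "test_function h" and \<delta>: "\<delta> > 0"
        and close: "\<And>N. N \<in> borel_prob_measures \<Longrightarrow> \<bar>(LINT x|N. g x) - (LINT x|\<mu>. g x)\<bar> < \<delta> \<Longrightarrow>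
       \<bar>(LINT x|N. h x) - (LINT x|\<mu>. h x)\<bar> < \<delta> \<Longrightarrow> \<bar>(LINT x|N. f x) - (LINT x|\<mu>. f x)\<bar> < \<epsilon>"
      by (rule weak_closeness_from_compact_support[OF \<mu> f]) (rule that; assumption)
    let ?bad = "\<lambda>g n. {\<omega> \<in> space M. \<not> \<bar>(LINT x|Y n \<omega>. g x) - (LINT x|\<mu>. g x)\<bar> < \<delta>}"
    have "(\<lambda>n. outer_measure_of M (?bad g n) + outer_measure_of M (?bad h n)) \<longlonglongrightarrow> 0 + 0"
      by (intro tendsto_add lim[OF g \<delta>] lim[OF h \<delta>])
    then show ?case
    proof (intro squeeze[of "\<lambda>n. outer_measure_of M (?bad g n) + outer_measure_of M (?bad h n)"])
      fix n
      have "{\<omega> \<in> space M. Y n \<omega> \<notin> s} \<subseteq> ?bad g n \<union> ?bad h n"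
      proof safe
        fix \<omega> assume "\<omega> \<in> space M" "Y n \<omega> \<notin> s"
          and 1: "\<bar>(LINT x|Y n \<omega>. h x) - (LINT x|\<mu>. h x)\<bar> < \<delta>" "\<bar>(LINT x|Y n \<omega>. g x) - (LINT x|\<mu>. g x)\<bar> < \<delta>"
        have "(LINT x|Y n \<omega>. f x) \<in> U"
          using close[OF Y 1(2,1)] by (intro \<epsilon>(2)) (simp add: dist_real_def)
        with \<open>Y n \<omega> \<notin> s\<close> show False by (simp add: s Y)
      qed
      then have "?out s n \<le> outer_measure_of M (?bad g n \<union> ?bad h n)"
        by (intro outer_measure_of_mono) auto
      also have "\<dots> \<le> outer_measure_of M (?bad g n) + outer_measure_of M (?bad h n)"
        by (intro outer_measure_of_Un_le) auto
      finally show "?out s n \<le> outer_measure_of M (?bad g n) + outer_measure_of M (?bad h n)" .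
    qed simp
  qed simp
  then show ?thesis
    using \<mu> unfolding limit_in_prob_def topspace_weak_topology
    by (simp add: weak_topology_def openin_topology_generated_by_iff)
qed

lemma integral_zeros_measure:
  fixes p :: "complex poly" and g :: "complex \<Rightarrow> real"
  assumes "degree p \<noteq> 0" "continuous_on UNIV g"
  shows "(LINT x|zeros_measure p. g x) = (\<Sum>x\<in>#proots p. g x) / real (degree p)"
proof -
  have "proots p \<noteq> {#}"
    using assms(1) size_proots_complex[of p] by auto
  then show ?thesis
    unfolding zeros_measure_def using assms(2)
    by (subst integral_uniform_mset_measure)
       (auto simp: size_proots_complex intro: borel_measurable_continuous_onI)
qed

lemma integral_empirical_measure:
  assumes "n \<ge> 1" "continuous_on UNIV (g :: complex \<Rightarrow> real)"
  shows "(LINT x|empirical_measure z n. g x) = (\<Sum>i=1..n. g (z i)) / real n"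
  unfolding empirical_measure_def using assms
  by (subst integral_uniform_mset_measure)
     (auto simp: image_mset.compositionality comp_def sum_unfold_sum_mset mset_set_empty_iff
       intro: borel_measurable_continuous_onI)

section \<open>Perturbed zeros are distributed like the given sequence\<close>

context random_perturbation begin

text \<open>Counts the \<open>i \<le> n\<close> with \<open>zero_at i \<omega>\<close> farther than
  \<open>d\<close> from \<open>z i\<close>. Each summand is a function of
  \<open>X i \<omega>\<close>, so independence is inherited.\<close>

definition large_jumps :: "real \<Rightarrow> nat \<Rightarrow> 'w \<Rightarrow> real" where
  "large_jumps d n \<omega> = (\<Sum>i=1..n. indicator {x. \<sigma> i * cmod x > d} (X i \<omega>))"

lemma prob_large_jump_le:
  fixes d \<epsilon> :: real
  assumes "d > 0" "\<epsilon> > 0"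
  obtains N where "\<And>i. i \<ge> N \<Longrightarrow> i \<ge> 1 \<Longrightarrow> expectation (\<lambda>\<omega>. indicator {x. \<sigma> i * cmod x > d} (X i \<omega>)) \<le> \<epsilon>"
proof -
  have X1: "X 1 \<in> borel_measurable M" by (rule X_measurable) simp
  define \<nu> where "\<nu> = distr M borel (X 1)"
  have \<nu>: "prob_space \<nu>" unfolding \<nu>_def by (rule prob_space_distr[OF X1])
  interpret \<nu>: prob_space \<nu> by (rule \<nu>)
  have sets_\<nu>: "sets \<nu> = sets borel" by (simp add: \<nu>_def)
  obtain L where L: "L > 0" "\<And>L'. L' \<ge> L \<Longrightarrow> measure \<nu> {x. norm x \<ge> L'} \<le> \<epsilon>"
    using measure_norm_ge_eventually_small[OF \<nu> sets_\<nu> \<open>\<epsilon> > 0\<close>] by blast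
  have "\<forall>\<^sub>F i in sequentially. \<sigma> i < d / L"
    by (rule order_tendstoD[OF \<sigma>_lim]) (use assms L in simp)
  then obtain N where N: "\<And>i. i \<ge> N \<Longrightarrow> \<sigma> i < d / L" by (auto simp: eventually_sequentially)
  show ?thesis
  proof (rule that)
    fix i assume i: "i \<ge> N" "i \<ge> 1"
    have Xi: "X i \<in> borel_measurable M" using i by (intro X_measurable)
    have \<sigma>: "\<sigma> i > 0" using \<sigma>_pos i by simp
    have [measurable]: "{x. \<sigma> i * cmod x > d} \<in> sets borel" by measurable
    have "expectation (\<lambda>\<omega>. indicator {x. \<sigma> i * cmod x > d} (X i \<omega>)) = (LINT x|distr M borel (X i). indicator {x. \<sigma> i * cmod x > d} x :: real)"
      by (rule integral_distr[OF Xi, of "indicator {x. \<sigma> i * cmod x > d}", symmetric]) measurable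
    also have "distr M borel (X i) = \<nu>" unfolding \<nu>_def by (rule ident[OF i(2)])
    also have "(LINT x|\<nu>. indicator {x. \<sigma> i * cmod x > d} x) = measure \<nu> {x. \<sigma> i * cmod x > d}"
      using sets_eq_imp_space_eq[OF sets_\<nu>] by simp
    also have "\<dots> \<le> measure \<nu> {x. norm x \<ge> L}"
    proof (rule \<nu>.finite_measure_mono)
      show "{x. \<sigma> i * cmod x > d} \<subseteq> {x. norm x \<ge> L}"
      proof safe
        fix x assume "d < \<sigma> i * cmod x"
        moreover have "\<sigma> i * L < d" using N[OF i(1)] L by (simp add: field_simps)
        ultimately have "\<sigma> i * L < \<sigma> i * cmod x" by linarith
        then show "L \<le> cmod x" using \<sigma> by simp
      qed
      show "{x. norm x \<ge> L} \<in> sets \<nu>" unfolding sets_\<nu> by measurable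
    qed
    also have "\<dots> \<le> \<epsilon>" by (rule L) simp
    finally show "expectation (\<lambda>\<omega>. indicator {x. \<sigma> i * cmod x > d} (X i \<omega>)) \<le> \<epsilon>" .
  qed
qed

text \<open>The 3 collects three errors of size \<open>\<epsilon> * n\<close>: the indices below
  \<open>N\<close>, the expectations beyond \<open>N\<close>, and Hoeffding's deviation. The last
  one is exceeded with probability at most \<open>exp (- 2 * \<epsilon>\<^sup>2 * n)\<close>, which
  is summable.\<close>

lemma AE_large_jumps_le:
  assumes "d > 0" "\<epsilon> > 0"
  shows "AE \<omega> in M. \<forall>\<^sub>F n in sequentially. large_jumps d n \<omega> \<le> 3 * \<epsilon> * real n"
proof -
  define Y where "Y i \<omega> = (indicator {x. \<sigma> i * cmod x > d} (X i \<omega>) :: real)" for i \<omega>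
  have Y_meas [measurable]: "Y i \<in> borel_measurable M" if "i \<ge> 1" for i
    unfolding Y_def by (rule measurable_compose[OF X_measurable[OF that]]) measurable
  have Y_int: "integrable M (Y i)" if "i \<ge> 1" for i
    using Y_meas[OF that] by (intro integrable_const_bound[of _ 1]) (auto simp: Y_def)
  have Y01: "Y i \<omega> \<in> {0..1}" for i \<omega> by (simp add: Y_def)
  obtain N where N: "\<And>i. i \<ge> N \<Longrightarrow> i \<ge> 1 \<Longrightarrow> expectation (Y i) \<le> \<epsilon>"
    using prob_large_jump_le[OF assms] unfolding Y_def by blast
  have EY: "expectation (Y i) \<le> 1" if "i \<ge> 1" for i
    using integral_mono[OF Y_int[OF that], of "\<lambda>_. 1"] Y01 by (simp add: prob_space)
  have mean: "(\<Sum>i=1..n. expectation (Y i)) \<le> real N + \<epsilon> * real n" for n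
  proof -
    have "(\<Sum>i=1..n. expectation (Y i)) \<le> (\<Sum>i=1..n. (if i < N then 1 else 0) + \<epsilon>)"
    proof (rule sum_mono)
      fix i assume "i \<in> {1..n}"
      then show "expectation (Y i) \<le> (if i < N then 1 else 0) + \<epsilon>"
        using N[of i] EY[of i] assms by (cases "i < N") auto
    qed
    also have "\<dots> = real (card ({1..n} \<inter> {i. i < N})) + \<epsilon> * real n"
      by (simp add: sum.distrib sum.If_cases)
    also have "card ({1..n} \<inter> {i. i < N}) \<le> card {..<N}"
      by (intro card_mono) auto
    finally show ?thesis by simp
  qed
  define A where "A n = {\<omega> \<in> space M. (\<Sum>i=1..n. Y i \<omega>) \<ge> (\<Sum>i=1..n. expectation (Y i)) + \<epsilon> * real n}" for n
  have A_sets: "A n \<in> sets M" for n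
  proof -
    have [measurable]: "(\<lambda>\<omega>. \<Sum>i=1..n. Y i \<omega>) \<in> borel_measurable M"
      by (intro borel_measurable_sum Y_meas) simp
    show ?thesis unfolding A_def by measurable
  qed
  have A_prob: "prob (A n) \<le> exp (- (2 * \<epsilon>\<^sup>2)) ^ n" if n: "n \<ge> 1" for n
  proof -
    interpret H: Hoeffding_ineq M "{1..n}" Y "\<lambda>_. 0" "\<lambda>_. 1" "\<Sum>i=1..n. expectation (Y i)"
    proof unfold_locales
      have "indep_vars (\<lambda>_. borel) X {1..n}"
        using indep by (rule indep_vars_subset) auto
      then show "indep_vars (\<lambda>_. borel) Y {1..n}"
        unfolding Y_def by (rule indep_vars_compose2) measurable
    qed (use Y01 in auto)
    have "prob (A n) \<le> exp (- 2 * (\<epsilon> * real n)\<^sup>2 / (\<Sum>i=1..n. (1 - 0)\<^sup>2))"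
      unfolding A_def using assms n by (intro H.Hoeffding_ineq_ge) auto
    also have "- 2 * (\<epsilon> * real n)\<^sup>2 / (\<Sum>i=1..n. (1 - 0)\<^sup>2) = real n * (- (2 * \<epsilon>\<^sup>2))"
      using n by (simp add: power2_eq_square)
    also have "exp (real n * (- (2 * \<epsilon>\<^sup>2))) = exp (- (2 * \<epsilon>\<^sup>2)) ^ n"
      by (rule exp_of_nat_mult)
    finally show ?thesis .
  qed
  have "summable (\<lambda>n. prob (A n))"
  proof (rule summable_comparison_test')
    show "summable (\<lambda>n. exp (- (2 * \<epsilon>\<^sup>2)) ^ n)"
      using assms by (intro summable_geometric) auto
    show "norm (prob (A n)) \<le> exp (- (2 * \<epsilon>\<^sup>2)) ^ n" if "n \<ge> 1" for n
      using A_prob[OF that] by simp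
  qed
  then have "AE \<omega> in M. \<forall>\<^sub>F n in sequentially. \<omega> \<in> space M - A n"
    by (intro borel_cantelli_AE1 A_sets) (auto simp: emeasure_eq_measure)
  then show ?thesis
  proof eventually_elim
    case (elim \<omega>)
    have "\<forall>\<^sub>F n in sequentially. real N \<le> \<epsilon> * real n"
      using assms by real_asymp
    with elim show ?case
    proof eventually_elim
      case (elim n)
      then have "(\<Sum>i=1..n. Y i \<omega>) < (\<Sum>i=1..n. expectation (Y i)) + \<epsilon> * real n"
        by (auto simp: A_def)
      then show ?case using mean[of n] elim(2) by (simp add: large_jumps_def Y_def)
    qed
  qed
qed

lemma AE_empirical_limit:
  assumes "distributed_as z \<mu>"
  shows "AE \<omega> in M. \<forall>g. test_function g \<longrightarrow> (\<lambda>n. (\<Sum>i=1..n. g (zero_at i \<omega>)) / real n) \<longlonglongrightarrow> (LINT x|\<mu>. g x)"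
proof -
  have \<mu>: "\<mu> \<in> borel_prob_measures"
    using assms unfolding distributed_as_def limitin_def topspace_weak_topology by simp
  have emp: "empirical_measure z n \<in> borel_prob_measures" for n
    unfolding empirical_measure_def by (rule uniform_mset_measure_in)
  \<comment> \<open>Countably many thresholds give a single null set that serves all test
    functions.\<close>
  have "AE \<omega> in M. \<forall>m l. \<forall>\<^sub>F n in sequentially. large_jumps (1 / real (Suc m)) n \<omega> \<le> 3 * (1 / real (Suc l)) * real n"
    by (intro AE_all_countable[THEN iffD2] allI AE_large_jumps_le) auto
  then show ?thesis
  proof (eventually_elim, intro allI impI)
    fix \<omega> and g :: "complex \<Rightarrow> real"
    assume jumps: "\<forall>m l. \<forall>\<^sub>F n in sequentially. large_jumps (1 / real (Suc m)) n \<omega> \<le> 3 * (1 / real (Suc l)) * real n"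
      and "test_function g"
    then obtain R where g: "continuous_on UNIV g" "\<And>w. w \<notin> cball 0 R \<Longrightarrow> g w = 0"
      unfolding test_function_def by blast
    obtain B where B: "\<And>w. \<bar>g w\<bar> \<le> B"
      using continuous_support_bounded[OF g] by blast
    have B0: "B \<ge> 0" using B[of 0] by linarith
    have "bounded (range g)" unfolding bounded_iff using B by auto
    then have "(\<lambda>n. LINT x|empirical_measure z n. g x) \<longlonglongrightarrow> (LINT x|\<mu>. g x)"
      using assms g(1) unfolding distributed_as_def limitin_weak_topology_iff[OF emp \<mu>] by blast
    moreover have "\<forall>\<^sub>F n in sequentially. (LINT x|empirical_measure z n. g x) = (\<Sum>i=1..n. g (z i)) / real n"
      using eventually_ge_at_top[of 1] by eventually_elim (rule integral_empirical_measure[OF _ g(1)])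
    ultimately have lim: "(\<lambda>n. (\<Sum>i=1..n. g (z i)) / real n) \<longlonglongrightarrow> (LINT x|\<mu>. g x)"
      by (rule Lim_transform_eventually)
    have "(\<lambda>n. (\<Sum>i=1..n. g (zero_at i \<omega>)) / real n - (\<Sum>i=1..n. g (z i)) / real n) \<longlonglongrightarrow> 0"
    proof (rule tendstoI)
      fix \<epsilon> :: real assume \<epsilon>: "\<epsilon> > 0"
      then have "\<epsilon> / 2 > 0" by simp
      obtain d where d: "d > 0" "\<And>x y. norm (x - y) \<le> d \<Longrightarrow> \<bar>g x - g y\<bar> \<le> \<epsilon> / 2"
        using continuous_support_uniform[OF g \<open>\<epsilon> / 2 > 0\<close>] by blast
      obtain m where m: "1 / real (Suc m) < d"
        using d(1) nat_approx_posE by blast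
      \<comment> \<open>A large jump changes \<open>g\<close> by at most \<open>2 * B\<close>, and
        at most \<open>3 * n / (l + 1)\<close> jumps are large; \<open>6 * B / (l + 1)\<close> has
        to stay below \<open>\<epsilon> / 2\<close>.\<close>
      have "\<epsilon> / (12 * (B + 1)) > 0" using \<epsilon> B0 by simp
      then obtain l where l: "1 / real (Suc l) < \<epsilon> / (12 * (B + 1))"
        using nat_approx_posE by blast
      have "\<forall>\<^sub>F n in sequentially. large_jumps (1 / real (Suc m)) n \<omega> \<le> 3 * (1 / real (Suc l)) * real n"
        using jumps by blast
      then show "\<forall>\<^sub>F n in sequentially. dist ((\<Sum>i=1..n. g (zero_at i \<omega>)) / real n - (\<Sum>i=1..n. g (z i)) / real n) 0 < \<epsilon>"
        using eventually_ge_at_top[of 1]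
      proof eventually_elim
        case (elim n)
        let ?J = "\<lambda>i. indicator {x. \<sigma> i * cmod x > 1 / real (Suc m)} (X i \<omega>) :: real"
        have "\<bar>(\<Sum>i=1..n. g (zero_at i \<omega>)) - (\<Sum>i=1..n. g (z i))\<bar> \<le> (\<Sum>i=1..n. \<bar>g (zero_at i \<omega>) - g (z i)\<bar>)"
          unfolding sum_subtractf[symmetric] by (rule sum_abs)
        also have "\<dots> \<le> (\<Sum>i=1..n. \<epsilon> / 2 + 2 * B * ?J i)"
        proof (rule sum_mono)
          fix i assume i: "i \<in> {1..n}"
          show "\<bar>g (zero_at i \<omega>) - g (z i)\<bar> \<le> \<epsilon> / 2 + 2 * B * ?J i"
          proof (cases "\<sigma> i * cmod (X i \<omega>) > 1 / real (Suc m)")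
            case True
            then show ?thesis using B[of "zero_at i \<omega>"] B[of "z i"] \<epsilon> by (simp add: abs_le_iff)
          next
            case False
            have "norm (zero_at i \<omega> - z i) = \<sigma> i * cmod (X i \<omega>)"
              using \<sigma>_pos[of i] i by (simp add: zero_at_def norm_mult)
            then have "\<bar>g (zero_at i \<omega>) - g (z i)\<bar> \<le> \<epsilon> / 2"
              using False m by (intro d(2)) linarith
            then show ?thesis using False by simp
          qed
        qed
        also have "\<dots> = \<epsilon> / 2 * real n + 2 * B * large_jumps (1 / real (Suc m)) n \<omega>"
          by (simp add: sum.distrib sum_distrib_left large_jumps_def)
        also have "\<dots> \<le> \<epsilon> / 2 * real n + 2 * B * (3 * (1 / real (Suc l)) * real n)"
          using elim B0 by (intro add_left_mono mult_left_mono) auto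
        also have "\<dots> = (\<epsilon> / 2 + 6 * B * (1 / real (Suc l))) * real n"
          by (simp add: algebra_simps)
        also have "\<dots> < \<epsilon> * real n"
        proof (rule mult_strict_right_mono)
          have "6 * B * (1 / real (Suc l)) \<le> 6 * B * (\<epsilon> / (12 * (B + 1)))"
            using l B0 by (intro mult_left_mono) auto
          also have "\<dots> < \<epsilon> / 2" using \<epsilon> B0 by (simp add: field_simps)
          finally show "\<epsilon> / 2 + 6 * B * (1 / real (Suc l)) < \<epsilon>" by simp
        qed (use elim in simp)
        finally have "\<bar>(\<Sum>i=1..n. g (zero_at i \<omega>)) - (\<Sum>i=1..n. g (z i))\<bar> < \<epsilon> * real n" .
        then have "\<bar>((\<Sum>i=1..n. g (zero_at i \<omega>)) - (\<Sum>i=1..n. g (z i))) / real n\<bar> < \<epsilon>"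
          using elim(2) by (simp add: abs_divide field_simps)
        then show ?case by (simp add: diff_divide_distrib)
      qed
    qed
    from tendsto_add[OF this lim] show "(\<lambda>n. (\<Sum>i=1..n. g (zero_at i \<omega>)) / real n) \<longlonglongrightarrow> (LINT x|\<mu>. g x)"
      by simp
  qed
qed

lemma perturbed_poly_eq: "perturbed_poly z \<sigma> X n \<omega> = (\<Prod>i=1..n. [:- zero_at i \<omega>, 1:])"
  unfolding perturbed_poly_def by (intro prod.cong) (auto simp: zero_at_def)

lemma integral_zeros_measure_perturbed_poly:
  assumes "n \<ge> 1" "continuous_on UNIV g"
  shows "(LINT x|zeros_measure (perturbed_poly z \<sigma> X n \<omega>). g x) = (\<Sum>i=1..n. g (zero_at i \<omega>)) / real n"
proof -
  have "degree (perturbed_poly z \<sigma> X n \<omega>) = n"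
    unfolding perturbed_poly_eq by (rule degree_prod_linear)
  then have "(LINT x|zeros_measure (perturbed_poly z \<sigma> X n \<omega>). g x) =
      (\<Sum>x\<in>#proots (perturbed_poly z \<sigma> X n \<omega>). g x) / real n"
    using assms by (subst integral_zeros_measure) auto
  then show ?thesis
    unfolding perturbed_poly_eq proots_prod_linear
    by (simp add: image_mset.compositionality comp_def sum_unfold_sum_mset)
qed

lemma zeros_measure_converges_AE:
  assumes "distributed_as z \<mu>"
  shows "AE \<omega> in M. limitin weak_topology (\<lambda>n. zeros_measure (perturbed_poly z \<sigma> X n \<omega>)) \<mu> sequentially"
  using AE_empirical_limit[OF assms]
proof eventually_elim
  case (elim \<omega>)
  have \<mu>: "\<mu> \<in> borel_prob_measures"
    using assms unfolding distributed_as_def limitin_def topspace_weak_topology by simp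
  show ?case
  proof (rule limitin_weak_topology_compact_support[OF _ \<mu>])
    show "zeros_measure (perturbed_poly z \<sigma> X n \<omega>) \<in> borel_prob_measures" for n
      unfolding zeros_measure_def by (rule uniform_mset_measure_in)
    fix g :: "complex \<Rightarrow> real" assume g: "test_function g"
    then have "continuous_on UNIV g" unfolding test_function_def by blast
    have "\<forall>\<^sub>F n in sequentially. (\<Sum>i=1..n. g (zero_at i \<omega>)) / real n = (LINT x|zeros_measure (perturbed_poly z \<sigma> X n \<omega>). g x)"
      using eventually_ge_at_top[of 1]
      by eventually_elim (rule integral_zeros_measure_perturbed_poly[symmetric, OF _ \<open>continuous_on UNIV g\<close>])
    with elim g show "(\<lambda>n. LINT x|zeros_measure (perturbed_poly z \<sigma> X n \<omega>). g x) \<longlonglongrightarrow> (LINT x|\<mu>. g x)"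
      by (blast intro: Lim_transform_eventually)
  qed
qed

text \<open>Almost sure convergence implies convergence in probability, by dominated convergence of
  the indicators.\<close>

lemma empirical_deviation_in_prob:
  assumes "distributed_as z \<mu>" "test_function g" "\<epsilon> > 0"
  defines "D \<equiv> \<lambda>n. {\<omega> \<in> space M. \<bar>(\<Sum>i=1..n. g (zero_at i \<omega>)) / real n - (LINT x|\<mu>. g x)\<bar> \<ge> \<epsilon>}"
  shows "D n \<in> sets M" "(\<lambda>n. emeasure M (D n)) \<longlonglongrightarrow> 0"
proof -
  have [measurable]: "g \<in> borel_measurable borel"
    using assms(2) unfolding test_function_def by (auto intro: borel_measurable_continuous_onI)
  have [measurable]: "(\<lambda>\<omega>. \<Sum>i=1..n. g (zero_at i \<omega>)) \<in> borel_measurable M" for n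
  proof (rule borel_measurable_sum)
    fix i assume "i \<in> {1..n}"
    then have "zero_at i \<in> borel_measurable M" by (intro zero_at_measurable) simp
    then show "(\<lambda>\<omega>. g (zero_at i \<omega>)) \<in> borel_measurable M" by measurable
  qed
  show D_sets: "D n \<in> sets M" for n unfolding D_def by measurable
  have "(\<lambda>n. \<integral>\<^sup>+\<omega>. indicator (D n) \<omega> \<partial>M) \<longlonglongrightarrow> (\<integral>\<^sup>+\<omega>. 0 \<partial>M)"
  proof (rule nn_integral_dominated_convergence[where w = "\<lambda>_. 1"])
    show "indicator (D n) \<in> borel_measurable M" for n using D_sets by simp
    show "AE \<omega> in M. (\<lambda>n. indicator (D n) \<omega> :: ennreal) \<longlonglongrightarrow> 0"
      using AE_empirical_limit[OF assms(1)]
    proof eventually_elim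
      case (elim \<omega>)
      then have "(\<lambda>n. (\<Sum>i=1..n. g (zero_at i \<omega>)) / real n) \<longlonglongrightarrow> (LINT x|\<mu>. g x)"
        using assms(2) by blast
      from tendstoD[OF this \<open>\<epsilon> > 0\<close>]
      have "\<forall>\<^sub>F n in sequentially. 0 = (indicator (D n) \<omega> :: ennreal)"
        by eventually_elim (simp add: D_def dist_real_def)
      then show ?case by (rule Lim_transform_eventually[OF tendsto_const])
    qed
    show "AE \<omega> in M. (indicator (D n) \<omega> :: ennreal) \<le> 1" for n by (auto simp: indicator_def)
  qed (auto simp: emeasure_space_1)
  then show "(\<lambda>n. emeasure M (D n)) \<longlonglongrightarrow> 0" using D_sets by simp
qed

section \<open>Zeros of the derivatives\<close>

text \<open>Unless the logarithmic energy or the deviation of the original zeros is large, the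
  comparison is deterministic. The bad set, possibly not measurable, is covered by two measurable
  events of vanishing probability.\<close>

lemma critical_zeros_deviation_in_prob:
  fixes k :: nat
  assumes "distributed_as z \<mu>" "log_Cesaro_bounded z" "test_function g" "\<epsilon> > 0"
  defines "Y \<equiv> \<lambda>n \<omega>. zeros_measure ((pderiv ^^ k) (perturbed_poly z \<sigma> X n \<omega>))"
  shows "(\<lambda>n. outer_measure_of M {\<omega> \<in> space M. \<not> \<bar>(LINT x|Y n \<omega>. g x) - (LINT x|\<mu>. g x)\<bar> < \<epsilon>}) \<longlonglongrightarrow> 0"
proof -
  obtain R where g: "continuous_on UNIV g" "\<And>w. w \<notin> cball 0 R \<Longrightarrow> g w = 0"
    using assms(3) unfolding test_function_def by blast
  obtain Bg where Bg: "\<And>w. \<bar>g w\<bar> \<le> Bg"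
    using continuous_support_bounded[OF g] by blast
  have Bg0: "Bg \<ge> 0" using Bg[of 0] by linarith
  have "\<epsilon> / 16 > 0" using assms(4) by simp
  obtain \<psi> B S where \<psi>: "\<psi> \<in> borel_measurable borel" "\<And>w. \<bar>\<psi> w\<bar> \<le> B" "\<And>w. w \<notin> cball 0 S \<Longrightarrow> \<psi> w = 0"
    "(LINT w|lborel. \<psi> w) = 0" and approx: "\<And>a. \<bar>g a - (LINT w|lborel. \<psi> w * ln (cmod (w - a)))\<bar> \<le> \<epsilon> / 16"
  proof (rule log_kernel_approx[OF g(1), of R])
    show "g w = 0" if "w \<notin> cball 0 R" for w using that by (rule g(2))
    show "\<epsilon> / 16 > 0" by fact
  qed (rule that; assumption)
  have B0: "B \<ge> 0" using \<psi>(2)[of 0] by linarith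
  define L where "L a = (LINT w|lborel. \<psi> w * ln (cmod (w - a)))" for a
  note approx = approx[folded L_def]
  \<comment> \<open>The comparison of potentials costs \<open>B * \<eta> * n\<close>, to be at most
    \<open>\<epsilon> / 8 * n\<close>; the 1 covers \<open>B = 0\<close>.\<close>
  define \<eta> where "\<eta> = \<epsilon> / (8 * (B + 1))"
  have \<eta>: "\<eta> > 0" "B * \<eta> \<le> \<epsilon> / 8"
    using assms(4) B0 by (auto simp: \<eta>_def field_simps)
  let ?E = "\<lambda>n. {\<omega> \<in> space M. log_energy k S n \<omega> > ennreal (\<eta> * real n)}"
  let ?D = "\<lambda>n. {\<omega> \<in> space M. \<bar>(\<Sum>i=1..n. g (zero_at i \<omega>)) / real n - (LINT x|\<mu>. g x)\<bar> \<ge> \<epsilon> / 2}"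
  have E_sets: "?E n \<in> sets M" for n by measurable
  have "\<epsilon> / 2 > 0" using assms(4) by simp
  note D = empirical_deviation_in_prob[OF assms(1,3) this]
  have E_lim: "(\<lambda>n. emeasure M (?E n)) \<longlonglongrightarrow> 0"
    by (intro tendsto_zero_ennrealI log_energy_in_prob assms(2) \<eta>(1))
  \<comment> \<open>Error budget after division by \<open>n\<close>: \<open>\<epsilon>/8\<close>
    from the potentials, \<open>\<epsilon>/16\<close> for each of the two replacements of
    \<open>g\<close> by \<open>L\<close>, and less than \<open>\<epsilon>/8\<close> for the
    normalisation.\<close>
  have det: "\<bar>(LINT x|Y n \<omega>. g x) - (\<Sum>i=1..n. g (zero_at i \<omega>)) / real n\<bar> < \<epsilon> / 2"
    if n: "n > k" "Bg * real k / real n < \<epsilon> / 8" and le: "log_energy k S n \<omega> \<le> ennreal (\<eta> * real n)" for n \<omega>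
  proof -
    define Z where "Z = proots ((pderiv ^^ k) (\<Prod>i=1..n. [:- zero_at i \<omega>, 1:]))"
    have deg: "degree ((pderiv ^^ k) (\<Prod>i=1..n. [:- zero_at i \<omega>, 1:])) = n - k"
      unfolding degree_higher_pderiv degree_prod_linear ..
    then have size: "size Z = n - k" by (simp add: Z_def size_proots_complex)
    have Y: "(LINT x|Y n \<omega>. g x) = (\<Sum>x\<in>#Z. g x) / real (n - k)"
      unfolding Y_def perturbed_poly_eq Z_def using deg n g by (subst integral_zeros_measure) auto
    have mset_le: "\<bar>\<Sum>x\<in>#A. f x\<bar> \<le> real (size A) * c" if "\<And>x. \<bar>f x\<bar> \<le> c" for A :: "complex multiset" and f and c :: real
    proof (induction A)
      case (add x A)
      then show ?case using that[of x] by (simp add: algebra_simps)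
    qed simp
    have "\<bar>(\<Sum>x\<in>#Z. L x) - (\<Sum>i=1..n. L (zero_at i \<omega>))\<bar> \<le> B * (\<eta> * real n)"
      unfolding L_def Z_def
      by (rule zeros_statistic_diff_le[OF \<psi>]) (use n \<eta> le in \<open>auto simp: log_energy_def\<close>)
    also have "\<dots> \<le> \<epsilon> / 8 * real n"
      using mult_right_mono[OF \<eta>(2), of "real n"] by (simp add: algebra_simps)
    finally have 1: "\<bar>(\<Sum>x\<in>#Z. L x) - (\<Sum>i=1..n. L (zero_at i \<omega>))\<bar> \<le> \<epsilon> / 8 * real n" .
    have "\<bar>\<Sum>x\<in>#Z. g x - L x\<bar> \<le> real (size Z) * (\<epsilon> / 16)"
      by (rule mset_le) (rule approx)
    also have "real (size Z) * (\<epsilon> / 16) \<le> real n * (\<epsilon> / 16)"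
      using size assms(4) by (intro mult_right_mono) auto
    finally have "\<bar>\<Sum>x\<in>#Z. g x - L x\<bar> \<le> real n * (\<epsilon> / 16)" .
    then have 2: "\<bar>(\<Sum>x\<in>#Z. g x) - (\<Sum>x\<in>#Z. L x)\<bar> \<le> real n * (\<epsilon> / 16)"
    proof -
      have "(\<Sum>x\<in>#Z. g x - L x) = (\<Sum>x\<in>#Z. g x) - (\<Sum>x\<in>#Z. L x)"
        by (induction Z) simp_all
      with \<open>\<bar>\<Sum>x\<in>#Z. g x - L x\<bar> \<le> real n * (\<epsilon> / 16)\<close> show ?thesis by simp
    qed
    have "\<bar>\<Sum>i=1..n. g (zero_at i \<omega>) - L (zero_at i \<omega>)\<bar> \<le> (\<Sum>i=1..n. \<epsilon> / 16)"
      by (intro order_trans[OF sum_abs] sum_mono approx)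
    then have 3: "\<bar>(\<Sum>i=1..n. g (zero_at i \<omega>)) - (\<Sum>i=1..n. L (zero_at i \<omega>))\<bar> \<le> real n * (\<epsilon> / 16)"
      by (simp add: sum_subtractf)
    have "\<bar>(\<Sum>x\<in>#Z. g x) - (\<Sum>i=1..n. g (zero_at i \<omega>))\<bar> \<le> \<epsilon> / 4 * real n"
    proof -
      have "\<epsilon> / 8 * real n = 2 * (real n * (\<epsilon> / 16))" "\<epsilon> / 4 * real n = 4 * (real n * (\<epsilon> / 16))"
        by simp_all
      with 1 2 3 show ?thesis by linarith
    qed
    then have 4: "\<bar>((\<Sum>x\<in>#Z. g x) - (\<Sum>i=1..n. g (zero_at i \<omega>))) / real n\<bar> \<le> \<epsilon> / 4"
      using n by (simp add: abs_divide field_simps)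
    \<comment> \<open>The derivative has only \<open>n - k\<close> zeros; changing the normalisation
      to \<open>n\<close> costs at most \<open>Bg * k / n\<close>.\<close>
    have "(\<Sum>x\<in>#Z. g x) / real (n - k) - (\<Sum>x\<in>#Z. g x) / real n = (\<Sum>x\<in>#Z. g x) * (real k / (real (n - k) * real n))"
      using n by (simp add: field_simps of_nat_diff)
    also have "\<bar>\<dots>\<bar> = \<bar>\<Sum>x\<in>#Z. g x\<bar> * (real k / (real (n - k) * real n))"
      by (simp add: abs_mult)
    also have "\<dots> \<le> (real (n - k) * Bg) * (real k / (real (n - k) * real n))"
      using mset_le[of g Bg Z, OF Bg] size by (intro mult_right_mono) auto
    also have "\<dots> = Bg * real k / real n" using n by simp
    finally have 5: "\<bar>(\<Sum>x\<in>#Z. g x) / real (n - k) - (\<Sum>x\<in>#Z. g x) / real n\<bar> \<le> Bg * real k / real n" .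
    have "\<bar>a - c\<bar> < \<epsilon> / 2" if "\<bar>b - c\<bar> \<le> \<epsilon> / 4" "\<bar>a - b\<bar> \<le> t" "t < \<epsilon> / 8" for a b c t
      using that assms(4) by linarith
    from this[OF 4[unfolded diff_divide_distrib] 5 n(2)] show ?thesis unfolding Y .
  qed
  have "(\<lambda>n. Bg * real k / real n) \<longlonglongrightarrow> 0" by real_asymp
  then have "\<forall>\<^sub>F n in sequentially. Bg * real k / real n < \<epsilon> / 8"
    by (rule order_tendstoD) (use assms(4) in simp)
  then have le: "\<forall>\<^sub>F n in sequentially. outer_measure_of M {\<omega> \<in> space M. \<not> \<bar>(LINT x|Y n \<omega>. g x) - (LINT x|\<mu>. g x)\<bar> < \<epsilon>} \<le>
      emeasure M (?E n) + emeasure M (?D n)"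
    using eventually_gt_at_top[of k]
  proof eventually_elim
    case (elim n)
    have "{\<omega> \<in> space M. \<not> \<bar>(LINT x|Y n \<omega>. g x) - (LINT x|\<mu>. g x)\<bar> < \<epsilon>} \<subseteq> ?E n \<union> ?D n"
    proof
      fix \<omega> assume \<omega>: "\<omega> \<in> {\<omega> \<in> space M. \<not> \<bar>(LINT x|Y n \<omega>. g x) - (LINT x|\<mu>. g x)\<bar> < \<epsilon>}"
      show "\<omega> \<in> ?E n \<union> ?D n"
      proof (rule ccontr)
        assume "\<omega> \<notin> ?E n \<union> ?D n"
        with \<omega> have le: "log_energy k S n \<omega> \<le> ennreal (\<eta> * real n)"
          and dev: "\<bar>(\<Sum>i=1..n. g (zero_at i \<omega>)) / real n - (LINT x|\<mu>. g x)\<bar> < \<epsilon> / 2"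
          by (auto simp: not_less)
        have "\<bar>a - c\<bar> < \<epsilon>" if "\<bar>a - b\<bar> < \<epsilon> / 2" "\<bar>b - c\<bar> < \<epsilon> / 2" for a b c
          using that by linarith
        from this[OF det[OF elim(2,1) le] dev]
        have "\<bar>(LINT x|Y n \<omega>. g x) - (LINT x|\<mu>. g x)\<bar> < \<epsilon>" .
        with \<omega> show False by simp
      qed
    qed
    then have "outer_measure_of M {\<omega> \<in> space M. \<not> \<bar>(LINT x|Y n \<omega>. g x) - (LINT x|\<mu>. g x)\<bar> < \<epsilon>} \<le> outer_measure_of M (?E n \<union> ?D n)"
      by (rule outer_measure_of_mono)
    also have "\<dots> = emeasure M (?E n \<union> ?D n)"
      by (intro outer_measure_of_eq sets.Un E_sets D(1))
    also have "\<dots> \<le> emeasure M (?E n) + emeasure M (?D n)"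
      by (intro emeasure_subadditive E_sets D(1))
    finally show ?case .
  qed
  have lim: "(\<lambda>n. emeasure M (?E n) + emeasure M (?D n)) \<longlonglongrightarrow> 0"
    using tendsto_add[OF E_lim D(2)] by simp
  show ?thesis
    by (rule tendsto_sandwich[OF _ le tendsto_const lim]) simp
qed

lemma zeros_measure_higher_pderiv_converges_in_prob:
  assumes "distributed_as z \<mu>" "log_Cesaro_bounded z"
  shows "limit_in_prob M weak_topology (\<lambda>n \<omega>. zeros_measure ((pderiv ^^ k) (perturbed_poly z \<sigma> X n \<omega>))) \<mu>"
proof (rule limit_in_prob_weak_topology_compact_support)
  show "zeros_measure ((pderiv ^^ k) (perturbed_poly z \<sigma> X n \<omega>)) \<in> borel_prob_measures" for n \<omega>
    unfolding zeros_measure_def by (rule uniform_mset_measure_in)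
  show "\<mu> \<in> borel_prob_measures"
    using assms(1) unfolding distributed_as_def limitin_def topspace_weak_topology by simp
qed (rule critical_zeros_deviation_in_prob[OF assms])

end

theorem corollary1p3:
  fixes M :: "'w measure" and \<mu> :: "complex measure"
    and z :: "nat \<Rightarrow> complex" and X :: "nat \<Rightarrow> 'w \<Rightarrow> complex" and \<sigma> :: "nat \<Rightarrow> real"
  assumes "prob_space M"
    and "prob_space \<mu>" and "sets \<mu> = sets borel"
    and "distributed_as z \<mu>"
    and "log_Cesaro_bounded z"
    and "prob_space.indep_vars M (\<lambda>_. borel) X {1..}"
    and "\<And>i. i \<ge> 1 \<Longrightarrow> distr M borel (X i) = distr M borel (X 1)"
    and "distr M borel (X 1) = distr M borel (\<lambda>\<omega>. - X 1 \<omega>)"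
    and "\<not> (AE \<omega> in M. X 1 \<omega> = 0)"
    and "integrable M (\<lambda>\<omega>. cmod (X 1 \<omega>))"
    and "\<And>i. i \<ge> 1 \<Longrightarrow> \<sigma> i > 0"
    and "\<And>i j. 1 \<le> i \<Longrightarrow> i \<le> j \<Longrightarrow> \<sigma> j \<le> \<sigma> i"
    and "\<sigma> \<longlonglongrightarrow> 0"
  shows "(AE \<omega> in M. limitin weak_topology
            (\<lambda>n. zeros_measure (perturbed_poly z \<sigma> X n \<omega>)) \<mu> sequentially)
       \<and> (\<forall>k. limit_in_prob M weak_topology
            (\<lambda>n \<omega>. zeros_measure ((pderiv ^^ k) (perturbed_poly z \<sigma> X n \<omega>))) \<mu>)"
proof -
  interpret random_perturbation M z X \<sigma>
    by (intro random_perturbation.intro random_perturbation_axioms.intro assms)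
  show ?thesis
    using zeros_measure_converges_AE[OF assms(4)]
      zeros_measure_higher_pderiv_converges_in_prob[OF assms(4,5)] by blast
qed

end
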